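(* Let $t_0\in(-1,1]\setminus\{0,1\}$ and let $\lambda_0$ be a multiple eigenvalue of $L_{t_0}(Q)$. Then $\lambda_0$ is a spectral singularity of $L(Q)$, and $\lambda_0$ is not an essential spectral singularity (ESS) of $L(Q)$.
   Context: Let $p,q$ be $\pi$-periodic complex-valued functions on $\mathbb{R}$ of bounded variation on $[0,\pi]$, $Q(x)=\begin{pmatrix}p(x)&q(x)\\ q(x)&-p(x)\end{pmatrix}$, $J=\begin{pmatrix}0&1\\-1&0\end{pmatrix}$, $l(\mathbf y,Q)=J\mathbf y'+Q\mathbf y$. $L(Q)$ is the operator in $L_2^2(-\infty,\infty)$ generated by $l$; for $t\in\mathbb{C}$, $L_t(Q)$ is the operator in $L_2^2[0,\pi]$ generated by $l$ and $\mathbf y(\pi)=e^{i\pi t}\mathbf y(0)$; $\sigma(L(Q))=\bigcup_{t\in(-1,1]}\sigma(L_t(Q))$. Eigenvalues of $L_t(Q)$ are the roots of $F(\lambda)=2\cos\pi t$, $F(\lambda)=c_1(\pi,\lambda)+s_2(\pi,\lambda)$, where $\mathbf c,\mathbf s$ solve $l(\mathbf y,Q)=\lambda\mathbf y$ with $\mathbf c(0)=(1,0)^T,\mathbf s(0)=(0,1)^T$. Labeling: the eigenvalues of $L_t(Q)$ (with multiplicity) are labeled $\lambda_{n,j}(t)$, $n\in\mathbb{Z}$, $j\in\{1,2\}$, so that whenever $\lambda_{n,j}(t_1)$ is a simple eigenvalue, $\lambda_{n,j}(t)$ remains simple and depends analytically on $t$ near $t_1$; for each $(n,j)$, $\lambda_{n,j}(t)$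 is simple except at finitely many $t$ in any bounded set. When $\lambda_{n,j}(t)$ is simple, let $\Psi_{n,j,t}$ be a unit-norm eigenfunction of $L_t(Q)$ for $\lambda_{n,j}(t)$, $\Psi^*_{n,j,t}$ a unit-norm eigenfunction of the adjoint $L_{\bar t}(\bar Q)$ for $\overline{\lambda_{n,j}(t)}$, and $\alpha_{n,j}(t)=(\Psi_{n,j,t},\Psi^*_{n,j,t})$ (inner product of $L_2^2[0,\pi]$); $|\alpha_{n,j}(t)|$ does not depend on the normalizations, and $1/|\alpha_{n,j}(t)|$ is the norm of the spectral (Riesz) projection of $L_t(Q)$ onto the eigenspace of $\lambda_{n,j}(t)$. Spectral singularity: $\lambda\in\sigma(L(Q))$ is a spectral singularity if for every $\varepsilon>0$ there is a sequence of closed contours $\gamma_k\subset\{z:|z-\lambda|<\varepsilon\}$, each enclosing at most one eigenvalue (with multiplicity) of $L_t(Q)$ for every $t\in(-1,1]$, such that $\lim_{k\to\infty}\sup_t\|\int_{\gamma_k}(L_t(Q)-zI)^{-1}dz\|=\infty$, the supremum over $t\in(-1,1]$ with $\gamma_k$ in the resolvent set of $L_t(Q)$. ESS: $\lambda_0\in\sigma(L(Q))$ is an ESS if there are $t_0\in(-1,1]$, $n\in\mathbb{Z}$, $j\in\{1,2\}$ with $\lambda_0=\lambda_{n,j}(t_0)$ such that for every $\varepsilon>0$ the function $t\mapsto 1/\alpha_{n,j}(t)$ is not (Lebesgue) integrable on $(t_0-\varepsilon,t_0+\varepsilon)$. *)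

theory Defs
  imports "HOL-Complex_Analysis.Complex_Analysis"
begin

text \<open>Vector-valued functions y = (y1, y2) are represented as real \<Rightarrow> complex \<times> complex.
 The norm on complex \<times> complex is the Euclidean one: sqrt(|y1|^2 + |y2|^2).\<close>

type_synonym cvec = "complex \<times> complex"

definition cscale :: "complex \<Rightarrow> cvec \<Rightarrow> cvec" where
  "cscale c v = (c * fst v, c * snd v)"

text \<open>Q(x) y with Q = [[p, q], [q, -p]].\<close>
definition Qapp :: "(real \<Rightarrow> complex) \<Rightarrow> (real \<Rightarrow> complex) \<Rightarrow> real \<Rightarrow> cvec \<Rightarrow> cvec" where
  "Qapp p q x y = (p x * fst y + q x * snd y, q x * fst y - p x * snd y)"

text \<open>J = [[0,1],[-1,0]]; J y = (y2, -y1); its inverse is -J, w \<mapsto> (-w2, w1).\<close>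
definition Japp :: "cvec \<Rightarrow> cvec" where
  "Japp y = (snd y, - fst y)"

definition Jinv :: "cvec \<Rightarrow> cvec" where
  "Jinv w = (- snd w, fst w)"

definition bounded_variation_on :: "(real \<Rightarrow> complex) \<Rightarrow> real \<Rightarrow> real \<Rightarrow> bool" where
  "bounded_variation_on f a b \<longleftrightarrow>
     (\<exists>M. \<forall>(n::nat) (x::nat \<Rightarrow> real).
        (\<forall>i\<le>n. a \<le> x i \<and> x i \<le> b) \<and> (\<forall>i<n. x i \<le> x (Suc i)) \<longrightarrow>
        (\<Sum>i<n. norm (f (x (Suc i)) - f (x i))) \<le> M)"

text \<open>Right-hand side of the first-order form of  J y' + Q y - z y = f,
  i.e.  y' = J^{-1} (f + z y - Q y).\<close>
definition dirac_rhs :: "(real \<Rightarrow> complex) \<Rightarrow> (real \<Rightarrow> complex) \<Rightarrow> complex \<Rightarrow>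
    (real \<Rightarrow> cvec) \<Rightarrow> (real \<Rightarrow> cvec) \<Rightarrow> real \<Rightarrow> cvec" where
  "dirac_rhs p q z f y s = Jinv (f s + cscale z (y s) - Qapp p q s (y s))"

text \<open>y is an (absolutely continuous) solution on [0,pi] of  l(y,Q) - z y = f,
  i.e. J y' + Q y - z y = f a.e., written in integrated form.\<close>
definition dirac_eq :: "(real \<Rightarrow> complex) \<Rightarrow> (real \<Rightarrow> complex) \<Rightarrow> complex \<Rightarrow>
    (real \<Rightarrow> cvec) \<Rightarrow> (real \<Rightarrow> cvec) \<Rightarrow> bool" where
  "dirac_eq p q z f y \<longleftrightarrow> continuous_on {0..pi} y \<and>
     (\<forall>x\<in>{0..pi}. dirac_rhs p q z f y integrable_on {0..x} \<and>
                  y x = y 0 + integral {0..x} (dirac_rhs p q z f y))"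

definition sq_int :: "(real \<Rightarrow> cvec) \<Rightarrow> bool" where
  "sq_int f \<longleftrightarrow> f \<in> borel_measurable (lebesgue_on {0..pi}) \<and>
                integrable (lebesgue_on {0..pi}) (\<lambda>x. (norm (f x))\<^sup>2)"

definition l2sq :: "(real \<Rightarrow> cvec) \<Rightarrow> ennreal" where
  "l2sq g = nn_integral (lebesgue_on {0..pi}) (\<lambda>x. ennreal ((norm (g x))\<^sup>2))"

definition l2norm :: "(real \<Rightarrow> cvec) \<Rightarrow> ennreal" where
  "l2norm g = (if l2sq g = \<infinity> then \<infinity> else ennreal (sqrt (enn2real (l2sq g))))"

definition l2inner :: "(real \<Rightarrow> cvec) \<Rightarrow> (real \<Rightarrow> cvec) \<Rightarrow> complex" where
  "l2inner f g = integral\<^sup>L (lebesgue_on {0..pi})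
      (\<lambda>x. fst (f x) * cnj (fst (g x)) + snd (f x) * cnj (snd (g x)))"

definition bc :: "complex \<Rightarrow> (real \<Rightarrow> cvec) \<Rightarrow> bool" where
  "bc t y \<longleftrightarrow> y pi = cscale (exp (\<i> * of_real pi * t)) (y 0)"

text \<open>opeq p q t z f y:  y belongs to the domain of L_t(Q) and (L_t(Q) - z I) y = f.\<close>
definition opeq :: "(real \<Rightarrow> complex) \<Rightarrow> (real \<Rightarrow> complex) \<Rightarrow> complex \<Rightarrow> complex \<Rightarrow>
    (real \<Rightarrow> cvec) \<Rightarrow> (real \<Rightarrow> cvec) \<Rightarrow> bool" where
  "opeq p q t z f y \<longleftrightarrow> sq_int f \<and> dirac_eq p q z f y \<and> bc t y"

definition eigfun :: "(real \<Rightarrow> complex) \<Rightarrow> (real \<Rightarrow> complex) \<Rightarrow> complex \<Rightarrow> complex \<Rightarrow>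
    (real \<Rightarrow> cvec) \<Rightarrow> bool" where
  "eigfun p q t \<mu> y \<longleftrightarrow> opeq p q t \<mu> (\<lambda>_. (0,0)) y \<and> (\<exists>x\<in>{0..pi}. y x \<noteq> (0,0))"

definition eigenvalue :: "(real \<Rightarrow> complex) \<Rightarrow> (real \<Rightarrow> complex) \<Rightarrow> complex \<Rightarrow> complex \<Rightarrow> bool" where
  "eigenvalue p q t \<mu> \<longleftrightarrow> (\<exists>y. eigfun p q t \<mu> y)"

fun in_ker_pow :: "(real \<Rightarrow> complex) \<Rightarrow> (real \<Rightarrow> complex) \<Rightarrow> complex \<Rightarrow> complex \<Rightarrow> nat \<Rightarrow>
    (real \<Rightarrow> cvec) \<Rightarrow> bool" where
  "in_ker_pow p q t \<mu> 0 y = (\<forall>x\<in>{0..pi}. y x = (0,0))"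
| "in_ker_pow p q t \<mu> (Suc k) y = (\<exists>g. opeq p q t \<mu> g y \<and> in_ker_pow p q t \<mu> k g)"

text \<open>Linear independence (as elements of L_2^2[0,pi]; the functions involved are continuous).\<close>
definition lin_indep_on :: "nat \<Rightarrow> (nat \<Rightarrow> real \<Rightarrow> cvec) \<Rightarrow> bool" where
  "lin_indep_on m fs \<longleftrightarrow> (\<forall>c::nat \<Rightarrow> complex.
      (\<forall>x\<in>{0..pi}. (\<Sum>i<m. cscale (c i) (fs i x)) = (0,0)) \<longrightarrow> (\<forall>i<m. c i = 0))"

text \<open>Algebraic multiplicity of mu as an eigenvalue of L_t(Q): dimension of the root
  space (union over k of ker (L_t(Q) - mu I)^k); 0 if mu is not an eigenvalue.\<close>
definition alg_mult :: "(real \<Rightarrow> complex) \<Rightarrow> (real \<Rightarrow> complex) \<Rightarrow> complex \<Rightarrow> complex \<Rightarrow> enat" where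
  "alg_mult p q t \<mu> = (SUP m \<in> {m. \<exists>fs. (\<forall>i<m. \<exists>k. in_ker_pow p q t \<mu> k (fs i)) \<and> lin_indep_on m fs}.
      enat m)"

definition multiple_eigenvalue :: "(real \<Rightarrow> complex) \<Rightarrow> (real \<Rightarrow> complex) \<Rightarrow> complex \<Rightarrow> complex \<Rightarrow> bool" where
  "multiple_eigenvalue p q t \<mu> \<longleftrightarrow> eigenvalue p q t \<mu> \<and> alg_mult p q t \<mu> \<ge> 2"

definition spec_L :: "(real \<Rightarrow> complex) \<Rightarrow> (real \<Rightarrow> complex) \<Rightarrow> complex set" where
  "spec_L p q = (\<Union>t\<in>{-1<..1::real}. {\<mu>. eigenvalue p q (of_real t) \<mu>})"

definition resolv :: "(real \<Rightarrow> complex) \<Rightarrow> (real \<Rightarrow> complex) \<Rightarrow> complex \<Rightarrow> complex \<Rightarrow>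
    (real \<Rightarrow> cvec) \<Rightarrow> real \<Rightarrow> cvec" where
  "resolv p q t z f = (THE y. opeq p q t z f y \<and> (\<forall>x. x \<notin> {0..pi} \<longrightarrow> y x = (0,0)))"

definition riesz_app :: "(real \<Rightarrow> complex) \<Rightarrow> (real \<Rightarrow> complex) \<Rightarrow> complex \<Rightarrow> (real \<Rightarrow> complex) \<Rightarrow>
    (real \<Rightarrow> cvec) \<Rightarrow> real \<Rightarrow> cvec" where
  "riesz_app p q t \<gamma> f x =
     (contour_integral \<gamma> (\<lambda>z. fst (resolv p q t z f x)),
      contour_integral \<gamma> (\<lambda>z. snd (resolv p q t z f x)))"

definition riesz_norm :: "(real \<Rightarrow> complex) \<Rightarrow> (real \<Rightarrow> complex) \<Rightarrow> complex \<Rightarrow> (real \<Rightarrow> complex) \<Rightarrow> ennreal" where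
  "riesz_norm p q t \<gamma> =
     (SUP f \<in> {f. f \<in> borel_measurable (lebesgue_on {0..pi}) \<and> l2norm f \<le> 1}.
        l2norm (riesz_app p q t \<gamma> f))"

definition encloses_at_most_one :: "(real \<Rightarrow> complex) \<Rightarrow> (real \<Rightarrow> complex) \<Rightarrow> (real \<Rightarrow> complex) \<Rightarrow> bool" where
  "encloses_at_most_one p q \<gamma> \<longleftrightarrow>
     (\<forall>t\<in>{-1<..1::real}. \<forall>\<mu>.
        eigenvalue p q (of_real t) \<mu> \<and> \<mu> \<notin> path_image \<gamma> \<and> winding_number \<gamma> \<mu> \<noteq> 0 \<longrightarrow>
          alg_mult p q (of_real t) \<mu> = 1 \<and>
          (\<forall>\<nu>. eigenvalue p q (of_real t) \<nu> \<and> \<nu> \<notin> path_image \<gamma> \<and> winding_number \<gamma> \<nu> \<noteq> 0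
                \<longrightarrow> \<nu> = \<mu>))"

definition spectral_singularity :: "(real \<Rightarrow> complex) \<Rightarrow> (real \<Rightarrow> complex) \<Rightarrow> complex \<Rightarrow> bool" where
  "spectral_singularity p q z0 \<longleftrightarrow> z0 \<in> spec_L p q \<and>
     (\<forall>\<epsilon>>0. \<exists>\<gamma>::nat \<Rightarrow> real \<Rightarrow> complex.
        (\<forall>k. valid_path (\<gamma> k) \<and> simple_path (\<gamma> k) \<and> pathfinish (\<gamma> k) = pathstart (\<gamma> k) \<and>
             path_image (\<gamma> k) \<subseteq> ball z0 \<epsilon> \<and> encloses_at_most_one p q (\<gamma> k)) \<and>
        ((\<lambda>k. SUP t \<in> {t\<in>{-1<..1::real}. \<forall>z\<in>path_image (\<gamma> k). \<not> eigenvalue p q (of_real t) z}.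
                riesz_norm p q (of_real t) (\<gamma> k)) \<longlonglongrightarrow> \<infinity>))"

definition valid_labeling :: "(real \<Rightarrow> complex) \<Rightarrow> (real \<Rightarrow> complex) \<Rightarrow>
    (int \<Rightarrow> nat \<Rightarrow> real \<Rightarrow> complex) \<Rightarrow> bool" where
  "valid_labeling p q lam \<longleftrightarrow>
     (\<forall>t::real. \<forall>\<mu>. finite {(n,j). j \<in> {1,2} \<and> lam n j t = \<mu>} \<and>
        alg_mult p q (of_real t) \<mu> = enat (card {(n,j). j \<in> {1,2} \<and> lam n j t = \<mu>})) \<and>
     (\<forall>n. \<forall>j\<in>{1,2}. \<forall>t1::real. alg_mult p q (of_real t1) (lam n j t1) = 1 \<longrightarrow>
        (\<exists>\<delta>>0. \<exists>g. g holomorphic_on ball (complex_of_real t1) \<delta> \<and>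
           (\<forall>t. \<bar>t - t1\<bar> < \<delta> \<longrightarrow> alg_mult p q (of_real t) (lam n j t) = 1 \<and>
                                     lam n j t = g (complex_of_real t)))) \<and>
     (\<forall>n. \<forall>j\<in>{1,2}. \<forall>a b::real.
        finite {t. a \<le> t \<and> t \<le> b \<and> alg_mult p q (of_real t) (lam n j t) \<noteq> 1})"

text \<open>|alpha(t)| = |(Psi, Psi^*)| for unit eigenfunctions of L_t(Q) (eigenvalue mu) and of
  the adjoint L_{conj t}(conj Q) (eigenvalue conj mu).  Only meaningful for simple mu,
  where it does not depend on the choice of the eigenfunctions.\<close>
definition alpha_abs :: "(real \<Rightarrow> complex) \<Rightarrow> (real \<Rightarrow> complex) \<Rightarrow> complex \<Rightarrow> complex \<Rightarrow> real" where
  "alpha_abs p q t \<mu> =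
     (let \<Psi> = (SOME y. eigfun p q t \<mu> y \<and> l2norm y = 1);
          \<Psi>s = (SOME y. eigfun (cnj \<circ> p) (cnj \<circ> q) (cnj t) (cnj \<mu>) y \<and> l2norm y = 1)
      in norm (l2inner \<Psi> \<Psi>s))"

definition ESS :: "(real \<Rightarrow> complex) \<Rightarrow> (real \<Rightarrow> complex) \<Rightarrow>
    (int \<Rightarrow> nat \<Rightarrow> real \<Rightarrow> complex) \<Rightarrow> complex \<Rightarrow> bool" where
  "ESS p q lam z0 \<longleftrightarrow> z0 \<in> spec_L p q \<and>
     (\<exists>t0\<in>{-1<..1::real}. \<exists>n. \<exists>j\<in>{1,2}. z0 = lam n j t0 \<and>
        (\<forall>\<epsilon>>0. \<not> set_integrable lborel {t0 - \<epsilon> <..< t0 + \<epsilon>}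
                    (\<lambda>t. 1 / alpha_abs p q (of_real t) (lam n j t))))"

end

theory Submission
  imports Defs
begin

text \<open>Let M(z) be the monodromy matrix of \<open>J y' + Q y = z y\<close>, an entire function of determinant 1, and
  \<open>F = tr M\<close> (\<open>hill\<close> below). The Lagrange identity for the Wronskian \<open>w\<^sup>T J y\<close> gives, for eigenvectors v, u of
  M(z) to the multipliers \<open>\<rho>\<close>, \<open>1/\<rho>\<close> with solutions Yv, Yu, the relation
  \<open>(\<rho> - 1/\<rho>) \<integral> (Yu)\<^sup>T(Yv) = F'(z) det(u, v)\<close>. Hence for \<open>\<rho>\<^sup>2 \<noteq> 1\<close> an eigenvalue is simple if \<open>F' \<noteq> 0\<close>, and
  \<open>1/\<bar>\<alpha>\<bar>\<close> is \<open>1/\<bar>F'\<bar>\<close> up to a locally bounded factor. At a multiple eigenvalue \<open>F'\<close> vanishes, so the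
  Riesz projections of the simple eigenvalues nearby blow up. On the other hand, near a root of
  \<open>F = F(z\<^sub>0)\<close> of order m one has \<open>\<bar>F'\<bar> \<ge> c \<bar>F - F(z\<^sub>0)\<bar>\<^bsup>1 - 1/m\<^esup>\<close> while \<open>F = 2 cos \<pi>t\<close> moves with nonzero speed
  in t, so \<open>1/\<bar>\<alpha>\<bar> = O(\<bar>t - t\<^sub>0\<bar>\<^bsup>-1 + 1/m\<^esup>)\<close> is integrable. The labelled eigenvalue may converge to any root as
  t tends to \<open>t\<^sub>0\<close>, but it cannot escape to infinity: by \<open>F(z) = 2 cos \<pi>z + O(e\<^bsup>\<pi>|Im z|\<^esup>/\<bar>z\<bar>)\<close>, on
  large rectangles with sides on integer lines \<open>\<bar>F\<bar>\<close> exceeds \<open>\<bar>2 cos \<pi>t\<bar>\<close>.\<close>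

section \<open>Fundamental theorem of calculus with countably many exceptions\<close>

text \<open>Bounded variation is used twice: the coefficients have countably many discontinuities,
  so calculus with countable exceptional sets applies, and the second mean value theorem turns
  oscillation into the factor 1/|z| in the asymptotics. That \<open>t0\<close> is no integer also
  has several effects: \<rho> differs from 1/\<rho>, 2 cos \<pi>t has nonzero speed, and |2 cos
  \<pi>t| stays below 2, the lower bound of |2 cos \<pi>z| on integer vertical lines. The blow-up is
  tested only on functions solving the equation at a fixed parameter \<mu> that is no eigenvalue at
  \<open>t0\<close>. On these the resolvent is explicit, through the adjugate of \<rho> - M(z), and
  the Riesz integral is one residue. For integrability the obstacle is that a label is controlled
  only where it is simple, so it may jump at \<open>t0\<close>, and that \<alpha> rests on
  arbitrarily chosen eigenfunctions. The first is met by estimates uniform over a compact set that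
  contains all nearby values of the label, the second by expressing |\<alpha>| through the entries
  of M.\<close>

lemma mono_of_deriv_pos_countable:
  fixes f :: "real \<Rightarrow> real"
  assumes "a \<le> b" and cont: "continuous_on {a..b} f" and "countable S"
    and deriv: "\<And>x. x \<in> {a<..<b} - S \<Longrightarrow> \<exists>D>0. (f has_real_derivative D) (at x)"
  shows "f a \<le> f b"
proof (rule ccontr)
  assume "\<not> f a \<le> f b"
  then have lt: "f b < f a" by simp
  then have "a < b" using \<open>a \<le> b\<close> by (cases "a = b") auto
  \<comment> \<open>The level y avoids the countable image of S, so the last point at which f
    reaches y is one where the derivative is positive; just after it f would exceed y again.\<close>
  have "uncountable {f b<..<f a}" using lt by (simp add: uncountable_open_interval)
  moreover have "countable (f ` S)" using \<open>countable S\<close> by simp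
  ultimately obtain y where y: "f b < y" "y < f a" "y \<notin> f ` S"
    by (metis countable_subset greaterThanLessThan_iff subsetI)
  define X where "X = {x \<in> {a..b}. y \<le> f x}"
  have "X = {a..b} \<inter> f -` {y..}" by (auto simp: X_def)
  then have "closed X" using continuous_closed_preimage[OF cont, of "{y..}"] by simp
  moreover have "X \<noteq> {}" "bdd_above X"
    using y \<open>a \<le> b\<close> by (auto simp: X_def intro!: exI[of _ a] bdd_aboveI[of _ b])
  ultimately have SX: "Sup X \<in> X" by (intro closed_contains_Sup)
  define s where "s = Sup X"
  have s: "a \<le> s" "s \<le> b" "y \<le> f s" using SX by (auto simp: X_def s_def)
  have above: "f x < y" if "s < x" "x \<le> b" for x
    using cSup_upper[OF _ \<open>bdd_above X\<close>, of x] that s unfolding X_def s_def by force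
  have "s < b" using y s by (cases "s = b") auto
  have fs: "f s = y"
  proof (rule ccontr)
    assume "f s \<noteq> y"
    then have "y < f s" using s by simp
    have "\<exists>x. s \<le> x \<and> x \<le> b \<and> f x = (y + f s) / 2"
      by (rule IVT2') (use \<open>y < f s\<close> y s continuous_on_subset[OF cont] in auto)
    then obtain x where "s \<le> x" "x \<le> b" "f x = (y + f s) / 2" by blast
    then show False using above[of x] \<open>y < f s\<close> by (cases "s = x") auto
  qed
  then have "s \<in> {a<..<b} - S" using y s \<open>s < b\<close> by (cases "s = a") auto
  then obtain D where "D > 0" "(f has_real_derivative D) (at s)" using deriv by blast
  from DERIV_pos_inc_right[OF this(2,1)] obtain d where
    d: "d > 0" "\<And>h. h > 0 \<Longrightarrow> h < d \<Longrightarrow> f s < f (s + h)" by blast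
  define h where "h = min (d/2) (b - s)"
  have "h > 0" "h < d" "s + h \<le> b" using d \<open>s < b\<close> by (auto simp: h_def)
  then show False using d(2)[of h] above[of "s + h"] fs by auto
qed

lemma mono_of_deriv_nonneg_countable:
  fixes f :: "real \<Rightarrow> real"
  assumes "a \<le> b" and cont: "continuous_on {a..b} f" and "countable S"
    and deriv: "\<And>x. x \<in> {a<..<b} - S \<Longrightarrow> \<exists>D\<ge>0. (f has_real_derivative D) (at x)"
  shows "f a \<le> f b"
proof (rule field_le_epsilon)
  fix e :: real assume "e > 0"
  \<comment> \<open>Adding slope e' makes the derivative positive at a total cost of at most e; the
    summand 1 covers a = b.\<close>
  define e' where "e' = e / (b - a + 1)"
  have "e' > 0" using \<open>e > 0\<close> \<open>a \<le> b\<close> by (simp add: e'_def)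
  have "f a + e' * a \<le> f b + e' * b"
  proof (rule mono_of_deriv_pos_countable[OF \<open>a \<le> b\<close> _ \<open>countable S\<close>])
    fix x assume "x \<in> {a<..<b} - S"
    then obtain D where "D \<ge> 0" "(f has_real_derivative D) (at x)" using deriv by blast
    then show "\<exists>D>0. ((\<lambda>x. f x + e' * x) has_real_derivative D) (at x)"
      using \<open>e' > 0\<close> by (intro exI[of _ "D + e'"]) (auto intro!: derivative_eq_intros)
  qed (intro continuous_intros cont)
  also have "e' * b \<le> e' * a + e"
  proof -
    have "e' * (b - a) \<le> e' * (b - a + 1)" using \<open>e' > 0\<close> by simp
    also have "\<dots> = e" using \<open>a \<le> b\<close> by (simp add: e'_def)
    finally show ?thesis by (simp add: algebra_simps)
  qed
  finally show "f a \<le> f b + e" by simp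
qed

lemma constant_of_deriv_zero_countable:
  fixes f :: "real \<Rightarrow> 'a::euclidean_space"
  assumes "a \<le> b" and cont: "continuous_on {a..b} f" and "countable S"
    and deriv: "\<And>x. x \<in> {a<..<b} - S \<Longrightarrow> (f has_vector_derivative 0) (at x)"
  shows "f a = f b"
proof (rule euclidean_eqI)
  fix i :: 'a assume "i \<in> Basis"
  have d: "((\<lambda>x. f x \<bullet> i) has_real_derivative 0) (at x)" if "x \<in> {a<..<b} - S" for x
    using bounded_linear.has_vector_derivative[OF bounded_linear_inner_left deriv[OF that], of i]
    by (simp add: has_real_derivative_iff_has_vector_derivative)
  have "f a \<bullet> i \<le> f b \<bullet> i"
    by (rule mono_of_deriv_nonneg_countable[OF \<open>a \<le> b\<close> _ \<open>countable S\<close>])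
      (use d in \<open>auto intro!: continuous_intros cont\<close>)
  moreover have "- (f a \<bullet> i) \<le> - (f b \<bullet> i)"
    by (rule mono_of_deriv_nonneg_countable[OF \<open>a \<le> b\<close> _ \<open>countable S\<close>])
      (use DERIV_minus[OF d] in \<open>auto intro!: continuous_intros cont\<close>)
  ultimately show "f a \<bullet> i = f b \<bullet> i" by simp
qed

text \<open>The class of integrands that occur here. The exceptional set is a parameter so that sums
  and products can share it; nothing is asked about continuity at the end points.\<close>

definition piecewise_reg :: "real \<Rightarrow> real \<Rightarrow> real set \<Rightarrow> (real \<Rightarrow> 'a::euclidean_space) \<Rightarrow> bool" where
  "piecewise_reg a b S h \<longleftrightarrow> bounded (h ` {a..b}) \<and> (\<forall>x\<in>{a<..<b} - S. isCont h x)"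

text \<open>Off a countable, hence Borel and null, set the function is continuous; this gives
  measurability, and boundedness gives integrability.\<close>

lemma piecewise_reg_integrable:
  assumes "piecewise_reg a b S h" "countable S"
  shows "h absolutely_integrable_on {a..b}"
proof -
  define T where "T = {a,b} \<union> S"
  have "countable T" using assms by (simp add: T_def)
  have "continuous_on ({a..b} - T) h"
    using assms by (auto simp: piecewise_reg_def T_def intro!: continuous_at_imp_continuous_on)
  then have "h \<in> borel_measurable (restrict_space borel ({a..b} - T))"
    by (rule borel_measurable_continuous_on_restrict)
  moreover have T: "T \<in> sets borel" using \<open>countable T\<close> 
    by (rule sets.countable[rotated]) auto
  ultimately have "(\<lambda>x. indicator ({a..b} - T) x *\<^sub>R h x) \<in> borel_measurable borel"
    by (subst (asm) borel_measurable_restrict_space_iff) auto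
  then have m: "(\<lambda>x. indicator ({a..b} - T) x *\<^sub>R h x) \<in> borel_measurable lebesgue"
    by (intro measurable_completion) simp
  obtain B where B: "\<And>x. x \<in> {a..b} \<Longrightarrow> norm (h x) \<le> B"
    using assms unfolding piecewise_reg_def bounded_iff by blast
  have "(\<lambda>x. indicator ({a..b} - T) x *\<^sub>R h x) absolutely_integrable_on {a..b}"
  proof (rule measurable_bounded_by_integrable_imp_absolutely_integrable)
    show "(\<lambda>x. indicator ({a..b} - T) x *\<^sub>R h x) \<in> borel_measurable (lebesgue_on {a..b})"
      using m by (rule measurable_restrict_space1)
    show "(\<lambda>x. B) integrable_on {a..b}" by (rule integrable_const_ivl)
    show "norm (indicator ({a..b} - T) x *\<^sub>R h x) \<le> B" if "x \<in> {a..b}" for x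
      using B[OF that] order_trans[OF norm_ge_zero B[OF that]] by (auto simp: indicator_def)
  qed simp
  then show ?thesis
    by (rule absolutely_integrable_spike[of _ _ T])
      (use \<open>countable T\<close> in \<open>auto simp: negligible_iff_null_sets intro: null_sets_completionI countable_imp_null_set_lborel\<close>)
qed

lemma piecewise_reg_subset:
  "piecewise_reg a b S h \<Longrightarrow> a \<le> c \<Longrightarrow> d \<le> b \<Longrightarrow> piecewise_reg c d S h"
  unfolding piecewise_reg_def
  using bounded_subset[of "h ` {a..b}" "h ` {c..d}"] image_mono[of "{c..d}" "{a..b}" h] by auto

lemma piecewise_reg_continuous:
  "continuous_on {a..b} h \<Longrightarrow> piecewise_reg a b S h"
  unfolding piecewise_reg_def
  by (auto intro!: compact_imp_bounded compact_continuous_image simp: continuous_on_interior)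

lemma piecewise_reg_integral_derivative:
  fixes h :: "real \<Rightarrow> 'a::euclidean_space"
  assumes h: "piecewise_reg a b S h" and "countable S" and x: "x \<in> {a<..<b} - S"
  shows "((\<lambda>x. integral {a..x} h) has_vector_derivative h x) (at x)"
proof -
  have int: "h integrable_on {a..b}"
    using piecewise_reg_integrable[OF h \<open>countable S\<close>] by (rule set_lebesgue_integral_eq_integral)
  have "isCont h x" using h x by (auto simp: piecewise_reg_def)
  then have "((\<lambda>x. integral {a..x} h) has_vector_derivative h x) (at x within {a..b})"
    using x integral_has_vector_derivative_continuous_at[OF int, of x "{}"]
    by (simp add: continuous_at_imp_continuous_at_within)
  then show ?thesis using x by (simp add: at_within_Icc_at)
qed

text \<open>f minus the indefinite integral of h is continuous with derivative zero off S, hence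
  constant. Later this takes the place of absolute continuity.\<close>

lemma ftc_countable:
  fixes f :: "real \<Rightarrow> 'a::euclidean_space"
  assumes "a \<le> b" and cont: "continuous_on {a..b} f" and "countable S"
    and deriv: "\<And>x. x \<in> {a<..<b} - S \<Longrightarrow> (f has_vector_derivative h x) (at x)"
    and h: "piecewise_reg a b S h"
  shows "(h has_integral (f b - f a)) {a..b}"
proof -
  have int: "h integrable_on {a..b}"
    using piecewise_reg_integrable[OF h \<open>countable S\<close>] by (rule set_lebesgue_integral_eq_integral)
  define H where "H = (\<lambda>x. integral {a..x} h)"
  have "f a - H a = f b - H b"
  proof (rule constant_of_deriv_zero_countable[OF \<open>a \<le> b\<close> _ \<open>countable S\<close>])
    show "continuous_on {a..b} (\<lambda>x. f x - H x)"
      unfolding H_def by (intro continuous_intros cont indefinite_integral_continuous_1 int)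
    fix x assume x: "x \<in> {a<..<b} - S"
    show "((\<lambda>x. f x - H x) has_vector_derivative 0) (at x)"
      unfolding H_def
      using has_vector_derivative_diff[OF deriv[OF x] piecewise_reg_integral_derivative[OF h \<open>countable S\<close> x]] by simp
  qed
  then have "integral {a..b} h = f b - f a" by (simp add: H_def algebra_simps)
  then show ?thesis using int by (metis integrable_integral)
qed

section \<open>Functions of bounded variation\<close>

lemma piecewise_reg_add:
  "piecewise_reg a b S f \<Longrightarrow> piecewise_reg a b S g \<Longrightarrow> piecewise_reg a b S (\<lambda>x. f x + g x)"
  unfolding piecewise_reg_def by (auto intro: bounded_plus_comp)

lemma piecewise_reg_minus:
  "piecewise_reg a b S f \<Longrightarrow> piecewise_reg a b S (\<lambda>x. - f x)"
  unfolding piecewise_reg_def by (auto simp: bounded_iff)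

lemma piecewise_reg_diff:
  "piecewise_reg a b S f \<Longrightarrow> piecewise_reg a b S g \<Longrightarrow> piecewise_reg a b S (\<lambda>x. f x - g x)"
  using piecewise_reg_add[OF _ piecewise_reg_minus] by fastforce

lemma piecewise_reg_bound:
  assumes "piecewise_reg a b S f"
  obtains A where "\<And>x. x \<in> {a..b} \<Longrightarrow> norm (f x) \<le> A"
  using assms unfolding piecewise_reg_def bounded_iff by blast

lemma piecewise_reg_mult:
  fixes f g :: "real \<Rightarrow> complex"
  assumes "piecewise_reg a b S f" "piecewise_reg a b S g"
  shows "piecewise_reg a b S (\<lambda>x. f x * g x)"
proof -
  obtain A B where "\<And>x. x \<in> {a..b} \<Longrightarrow> norm (f x) \<le> A" "\<And>x. x \<in> {a..b} \<Longrightarrow> norm (g x) \<le> B"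
    using piecewise_reg_bound[OF assms(1)] piecewise_reg_bound[OF assms(2)] by metis
  then have "norm (f x * g x) \<le> A * B" if "x \<in> {a..b}" for x
    unfolding norm_mult using that by (intro mult_mono) (auto intro: order_trans[OF norm_ge_zero])
  then have "bounded ((\<lambda>x. f x * g x) ` {a..b})" unfolding bounded_iff by blast
  then show ?thesis using assms unfolding piecewise_reg_def by auto
qed

lemma piecewise_reg_Pair:
  fixes f g :: "real \<Rightarrow> complex"
  assumes "piecewise_reg a b S f" "piecewise_reg a b S g"
  shows "piecewise_reg a b S (\<lambda>x. (f x, g x))"
proof -
  obtain A B where "\<And>x. x \<in> {a..b} \<Longrightarrow> norm (f x) \<le> A" "\<And>x. x \<in> {a..b} \<Longrightarrow> norm (g x) \<le> B"
    using piecewise_reg_bound[OF assms(1)] piecewise_reg_bound[OF assms(2)] by metis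
  then have "norm (f x, g x) \<le> A + B" if "x \<in> {a..b}" for x
    using that by (intro order_trans[OF norm_Pair_le] add_mono)
  then have "bounded ((\<lambda>x. (f x, g x)) ` {a..b})" unfolding bounded_iff by blast
  then show ?thesis using assms unfolding piecewise_reg_def by (auto intro: continuous_Pair)
qed

lemmas piecewise_reg_intros = piecewise_reg_add piecewise_reg_minus piecewise_reg_diff
  piecewise_reg_mult piecewise_reg_Pair

text \<open>V is the variation of f over [a, x]: continuing a partition of [a, x] by x and y raises
  its sum by at least |f y - f x|. V is nondecreasing and yields the monotone decompositions
  below.\<close>

lemma bounded_variation_majorant:
  assumes bv: "bounded_variation_on f a b"
  obtains V where "\<And>x y. a \<le> x \<Longrightarrow> x \<le> y \<Longrightarrow> y \<le> b \<Longrightarrow> norm (f y - f x) \<le> V y - V x"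
proof
  define P where "P = (\<lambda>x (n::nat, xs::nat \<Rightarrow> real). (\<forall>i\<le>n. a \<le> xs i \<and> xs i \<le> x) \<and> (\<forall>i<n. xs i \<le> xs (Suc i)))"
  define var where "var = (\<lambda>(n::nat, xs::nat \<Rightarrow> real). \<Sum>i<n. norm (f (xs (Suc i)) - f (xs i)))"
  define V where "V = (\<lambda>x. SUP u\<in>Collect (P x). var u)"
  obtain M where M: "\<And>n x. (\<forall>i\<le>n. a \<le> x i \<and> x i \<le> b) \<Longrightarrow> (\<forall>i<n. x i \<le> x (Suc i)) \<Longrightarrow>
      (\<Sum>i<n. norm (f (x (Suc i)) - f (x i))) \<le> M"
    using bv unfolding bounded_variation_on_def by metis
  fix x y assume xy: "a \<le> x" "x \<le> y" "y \<le> b"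
  have bdd: "bdd_above (var ` Collect (P y))"
  proof (rule bdd_aboveI2)
    fix u assume "u \<in> Collect (P y)"
    then obtain n xs where u: "u = (n, xs)" and P: "P y (n, xs)" by (cases u) auto
    have "\<forall>i\<le>n. a \<le> xs i \<and> xs i \<le> b" "\<forall>i<n. xs i \<le> xs (Suc i)"
      using P xy unfolding P_def by auto
    then show "var u \<le> M" using M by (simp add: u var_def)
  qed
  have "V x \<le> V y - norm (f y - f x)"
    unfolding V_def
  proof (rule cSUP_least)
    show "Collect (P x) \<noteq> {}" using xy by (auto simp: P_def intro!: exI[of _ 0] exI[of _ "\<lambda>_. a"])
    fix u assume "u \<in> Collect (P x)"
    then obtain n xs where u: "u = (n, xs)" and nx: "\<And>i. i \<le> n \<Longrightarrow> a \<le> xs i \<and> xs i \<le> x"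
      "\<And>i. i < n \<Longrightarrow> xs i \<le> xs (Suc i)" by (cases u) (auto simp: P_def)
    \<comment> \<open>The given partition, continued by x at index n + 1 and by y at index n +
      2.\<close>
    define ys where "ys = (\<lambda>i. if i \<le> n then xs i else if i = Suc n then x else y)"
    have "P y (Suc (Suc n), ys)"
      unfolding P_def ys_def prod.case
    proof (intro conjI allI impI)
      fix i assume "i < Suc (Suc n)"
      then consider "i < n" | "i = n" | "i = Suc n" by linarith
      then show "(if i \<le> n then xs i else if i = Suc n then x else y)
        \<le> (if Suc i \<le> n then xs (Suc i) else if Suc i = Suc n then x else y)"
        using nx xy by cases auto
    qed (use nx xy in \<open>force+\<close>)
    then have "var (Suc (Suc n), ys) \<le> (SUP u\<in>Collect (P y). var u)"
      by (intro cSUP_upper bdd) auto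
    moreover have "var (Suc (Suc n), ys) = var (n, xs) + norm (f x - f (xs n)) + norm (f y - f x)"
      unfolding var_def by (simp add: ys_def)
    ultimately show "var u \<le> (SUP u\<in>Collect (P y). var u) - norm (f y - f x)"
      unfolding u using norm_ge_zero[of "f x - f (xs n)"] by linarith
  qed
  then show "norm (f y - f x) \<le> V y - V x" by simp
qed

text \<open>f is continuous wherever its monotone majorant V is, and V has only countably many
  discontinuities.\<close>

lemma bounded_variation_reg:
  assumes bv: "bounded_variation_on f a b" and "a \<le> b"
  shows "bounded (f ` {a..b})" "countable {x\<in>{a<..<b}. \<not> isCont f x}"
proof -
  obtain V where V: "\<And>x y. a \<le> x \<Longrightarrow> x \<le> y \<Longrightarrow> y \<le> b \<Longrightarrow> norm (f y - f x) \<le> V y - V x"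
    using bounded_variation_majorant[OF bv] by blast
  have mono: "V x \<le> V y" if "a \<le> x" "x \<le> y" "y \<le> b" for x y
    using V[OF that] norm_ge_zero[of "f y - f x"] by linarith
  have "norm (f x) \<le> norm (f a) + (V b - V a)" if "x \<in> {a..b}" for x
    using V[of a x] mono[of x b] that norm_triangle_sub[of "f x" "f a"] by auto
  then show "bounded (f ` {a..b})" unfolding bounded_iff by blast
  have "mono_on {a<..<b} V" using mono by (auto simp: mono_on_def)
  then have "countable {x\<in>{a<..<b}. \<not> isCont V x}" by (intro mono_on_ctble_discont_open) auto
  moreover have "isCont f x" if x: "x \<in> {a<..<b}" and c: "isCont V x" for x
  proof -
    have "((\<lambda>y. V y - V x) \<longlongrightarrow> V x - V x) (at x)" using c unfolding isCont_def by (intro tendsto_intros)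
    then have "((\<lambda>y. \<bar>V y - V x\<bar>) \<longlongrightarrow> 0) (at x)" by (intro tendsto_rabs_zero) simp
    moreover have "eventually (\<lambda>y. norm (f y - f x) \<le> \<bar>V y - V x\<bar>) (at x)"
    proof -
      have "eventually (\<lambda>y. y \<in> {a<..<b}) (at x)" using x by (intro eventually_at_in_open') auto
      then show ?thesis
      proof eventually_elim
        case (elim y)
        then show ?case using V[of x y] V[of y x] x by (cases "x \<le> y") (auto simp: norm_minus_commute)
      qed
    qed
    ultimately have "((\<lambda>y. f y - f x) \<longlongrightarrow> 0) (at x)" by (rule Lim_null_comparison[rotated])
    then show ?thesis unfolding isCont_def by (simp add: LIM_zero_iff)
  qed
  ultimately show "countable {x\<in>{a<..<b}. \<not> isCont f x}" by (rule_tac countable_subset) auto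
qed

text \<open>By the second mean value theorem the integral equals g a times an integral over [a, c]
  plus g b times one over [c, b]. The former integral is at most K and the latter, being a
  difference, at most 2 K; this gives 3 G K for the real and for the imaginary part.\<close>

lemma monotone_oscillation:
  fixes g :: "real \<Rightarrow> real" and k :: "real \<Rightarrow> complex"
  assumes "a \<le> b" and g: "\<And>x y. a \<le> x \<Longrightarrow> x \<le> y \<Longrightarrow> y \<le> b \<Longrightarrow> g x \<le> g y"
    and G: "\<And>x. x \<in> {a..b} \<Longrightarrow> \<bar>g x\<bar> \<le> G"
    and k: "continuous_on {a..b} k" and K: "\<And>c. c \<in> {a..b} \<Longrightarrow> norm (integral {a..c} k) \<le> K"
  shows "(\<lambda>x. of_real (g x) * k x) integrable_on {a..b}"
    and "norm (integral {a..b} (\<lambda>x. of_real (g x) * k x)) \<le> 6 * G * K"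
proof -
  have k_int: "k integrable_on {a..b}" using k by (rule integrable_continuous_real)
  have *: "\<exists>I. ((\<lambda>x. g x * L (k x)) has_integral I) {a..b} \<and> \<bar>I\<bar> \<le> 3 * G * K"
    if L: "bounded_linear L" "\<And>z. \<bar>L z\<bar> \<le> norm z" for L :: "complex \<Rightarrow> real"
  proof -
    have Li: "(\<lambda>x. L (k x)) integrable_on {a..b}"
      using integrable_linear[OF k_int L(1)] by (simp add: o_def)
    obtain c where c: "c \<in> {a..b}" "((\<lambda>x. g x * L (k x)) has_integral
        (g a * integral {a..c} (\<lambda>x. L (k x)) + g b * integral {c..b} (\<lambda>x. L (k x)))) {a..b}"
      using second_mean_value_theorem_full[OF Li \<open>a \<le> b\<close>, of g] g by blast
    have Lc: "\<bar>integral {a..c} (\<lambda>x. L (k x))\<bar> \<le> K" if "c \<in> {a..b}" for c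
    proof -
      have "k integrable_on {a..c}" using k_int that by (auto intro: integrable_subinterval_real)
      then have "integral {a..c} (\<lambda>x. L (k x)) = L (integral {a..c} k)"
        using integral_linear[of k "{a..c}" L] L by (simp add: o_def)
      then show ?thesis using L(2) K[OF that] by (metis order_trans)
    qed
    have "integral {a..c} (\<lambda>x. L (k x)) + integral {c..b} (\<lambda>x. L (k x)) = integral {a..b} (\<lambda>x. L (k x))"
      using Henstock_Kurzweil_Integration.integral_combine[of a c b "\<lambda>x. L (k x)"] c Li by auto
    then have cb: "\<bar>integral {c..b} (\<lambda>x. L (k x))\<bar> \<le> 2 * K"
      using Lc[OF c(1)] Lc[of b] \<open>a \<le> b\<close> by auto
    have G0: "0 \<le> G" "0 \<le> K" using G[of a] Lc[OF c(1)] \<open>a \<le> b\<close> by auto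
    have "\<bar>g a * integral {a..c} (\<lambda>x. L (k x)) + g b * integral {c..b} (\<lambda>x. L (k x))\<bar> \<le> G * K + G * (2 * K)"
      using G[of a] G[of b] \<open>a \<le> b\<close> Lc[OF c(1)] cb G0
      by (intro order_trans[OF abs_triangle_ineq] add_mono) (auto simp: abs_mult intro!: mult_mono)
    then show ?thesis using c(2) by (intro exI conjI) (auto simp: algebra_simps)
  qed
  obtain I1 I2 where I: "((\<lambda>x. g x * Re (k x)) has_integral I1) {a..b}" "\<bar>I1\<bar> \<le> 3 * G * K"
    "((\<lambda>x. g x * Im (k x)) has_integral I2) {a..b}" "\<bar>I2\<bar> \<le> 3 * G * K"
    using *[OF bounded_linear_Re abs_Re_le_cmod] *[OF bounded_linear_Im abs_Im_le_cmod] by blast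
  have "((\<lambda>x. of_real (g x * Re (k x)) + \<i> * of_real (g x * Im (k x))) has_integral
      (of_real I1 + \<i> * of_real I2)) {a..b}"
    using I by (intro has_integral_add has_integral_mult_right has_integral_of_real)
  moreover have "of_real (g x * Re (k x)) + \<i> * of_real (g x * Im (k x)) = of_real (g x) * k x" for x
    by (simp add: complex_eq_iff)
  moreover have "of_real I1 + \<i> * of_real I2 = Complex I1 I2" by (simp add: complex_eq_iff)
  ultimately have h: "((\<lambda>x. of_real (g x) * k x) has_integral Complex I1 I2) {a..b}" by simp
  then show "(\<lambda>x. of_real (g x) * k x) integrable_on {a..b}" by blast
  have "norm (integral {a..b} (\<lambda>x. of_real (g x) * k x)) = norm (Complex I1 I2)"
    using h by (simp add: integral_unique)
  also have "\<dots> \<le> \<bar>I1\<bar> + \<bar>I2\<bar>" using cmod_le[of "Complex I1 I2"] by simp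
  finally show "norm (integral {a..b} (\<lambda>x. of_real (g x) * k x)) \<le> 6 * G * K" using I by simp
qed

text \<open>The bound sees only the primitives of k, so oscillation of k makes it small. Real and
  imaginary part of f are the differences V - VR and V - VI of nondecreasing functions. The lower
  limit c is free because tails up to b are estimated later.\<close>

lemma bounded_variation_oscillation:
  assumes bv: "bounded_variation_on f a b"
  obtains C where "0 \<le> C" "\<And>c k K. c \<in> {a..b} \<Longrightarrow> continuous_on {c..b} k \<Longrightarrow>
      (\<And>d. d \<in> {c..b} \<Longrightarrow> norm (integral {c..d} k) \<le> K) \<Longrightarrow>
      norm (integral {c..b} (\<lambda>x. f x * k x)) \<le> C * K"
proof -
  obtain V where V: "\<And>x y. a \<le> x \<Longrightarrow> x \<le> y \<Longrightarrow> y \<le> b \<Longrightarrow> norm (f y - f x) \<le> V y - V x"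
    using bounded_variation_majorant[OF bv] by blast
  define G where "G = \<bar>V a\<bar> + \<bar>V b\<bar> + norm (f a) + (V b - V a)"
  define VR VI where "VR = (\<lambda>x. V x - Re (f x))" and "VI = (\<lambda>x. V x - Im (f x))"
  have m: "V x \<le> V y" "VR x \<le> VR y" "VI x \<le> VI y" if "a \<le> x" "x \<le> y" "y \<le> b" for x y
    using V[OF that] norm_ge_zero[of "f y - f x"] abs_Re_le_cmod[of "f y - f x"] abs_Im_le_cmod[of "f y - f x"]
    unfolding VR_def VI_def by auto
  have G: "\<bar>V x\<bar> \<le> G" "\<bar>VR x\<bar> \<le> 2 * G" "\<bar>VI x\<bar> \<le> 2 * G" if "x \<in> {a..b}" for x
  proof -
    have "norm (f x) \<le> norm (f a) + (V b - V a)"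
      using V[of a x] m[of x b] that norm_triangle_sub[of "f x" "f a"] by auto
    moreover have "V a \<le> V x" "V x \<le> V b" using m that by auto
    moreover from this have "\<bar>V x\<bar> \<le> \<bar>V a\<bar> + \<bar>V b\<bar>" by linarith
    moreover have "\<bar>VR x\<bar> \<le> \<bar>V x\<bar> + norm (f x)" "\<bar>VI x\<bar> \<le> \<bar>V x\<bar> + norm (f x)"
      using abs_Re_le_cmod[of "f x"] abs_Im_le_cmod[of "f x"] unfolding VR_def VI_def by linarith+
    ultimately have "\<bar>V x\<bar> + norm (f x) \<le> G" "\<bar>VR x\<bar> \<le> \<bar>V x\<bar> + norm (f x)" "\<bar>VI x\<bar> \<le> \<bar>V x\<bar> + norm (f x)"
      unfolding G_def by linarith+
    then show "\<bar>V x\<bar> \<le> G" "\<bar>VR x\<bar> \<le> 2 * G" "\<bar>VI x\<bar> \<le> 2 * G"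
      using norm_ge_zero[of "f x"] abs_ge_zero[of "V x"] by linarith+
  qed
  have "norm (integral {c..b} (\<lambda>x. f x * k x)) \<le> (36 * \<bar>G\<bar>) * K"
    if c: "c \<in> {a..b}" and k: "continuous_on {c..b} k" and K: "\<And>d. d \<in> {c..b} \<Longrightarrow> norm (integral {c..d} k) \<le> K"
    for c k K
  proof -
    have "c \<le> b" using c by simp
    have "0 \<le> G" "0 \<le> K" using G[OF c] order_trans[OF norm_ge_zero K[of c]] \<open>c \<le> b\<close> by auto
    note osc = monotone_oscillation[OF \<open>c \<le> b\<close> _ _ k K]
    have o1: "(\<lambda>x. of_real (V x) * k x) integrable_on {c..b}"
      "norm (integral {c..b} (\<lambda>x. of_real (V x) * k x)) \<le> 6 * G * K"
      using osc[of V G] m(1) G(1) c by auto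
    have o2: "(\<lambda>x. of_real (VR x) * k x) integrable_on {c..b}"
      "norm (integral {c..b} (\<lambda>x. of_real (VR x) * k x)) \<le> 6 * (2 * G) * K"
      using osc[of VR "2 * G"] m(2) G(2) c by auto
    have o3: "(\<lambda>x. of_real (VI x) * k x) integrable_on {c..b}"
      "norm (integral {c..b} (\<lambda>x. of_real (VI x) * k x)) \<le> 6 * (2 * G) * K"
      using osc[of VI "2 * G"] m(3) G(3) c by auto
    have f: "f x = (of_real (V x) - of_real (VR x)) + \<i> * (of_real (V x) - of_real (VI x))" for x
      unfolding VR_def VI_def by (simp add: complex_eq_iff)
    let ?IV = "integral {c..b} (\<lambda>x. of_real (V x) * k x)" and ?IR = "integral {c..b} (\<lambda>x. of_real (VR x) * k x)"
      and ?II = "integral {c..b} (\<lambda>x. of_real (VI x) * k x)"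
    have "((\<lambda>x. (of_real (V x) * k x - of_real (VR x) * k x) + \<i> * (of_real (V x) * k x - of_real (VI x) * k x))
       has_integral ((?IV - ?IR) + \<i> * (?IV - ?II))) {c..b}"
      using o1(1) o2(1) o3(1)
      by (intro has_integral_add has_integral_mult_right has_integral_diff integrable_integral)
    moreover have "(of_real (V x) * k x - of_real (VR x) * k x) + \<i> * (of_real (V x) * k x - of_real (VI x) * k x)
      = f x * k x" for x
      unfolding f by (simp add: algebra_simps)
    ultimately have "integral {c..b} (\<lambda>x. f x * k x) = (?IV - ?IR) + \<i> * (?IV - ?II)"
      by (simp add: integral_unique)
    also have "norm \<dots> \<le> (norm ?IV + norm ?IR) + (norm ?IV + norm ?II)"
      by (intro order_trans[OF norm_triangle_ineq] add_mono norm_triangle_ineq4) (simp add: norm_mult norm_triangle_ineq4)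
    \<comment> \<open>V contributes 6 G K twice, VR and VI contribute 12 G K each.\<close>
    also have "\<dots> \<le> 36 * G * K" using o1(2) o2(2) o3(2) by simp
    finally show ?thesis using \<open>0 \<le> G\<close> by simp
  qed
  then show thesis by (intro that[of "36 * \<bar>G\<bar>"]) auto
qed

section \<open>Solutions of the Dirac system\<close>

text \<open>Bilinear, without conjugation, so that pairings of solutions stay holomorphic in the
  spectral parameter. The conjugation in \<open>l2inner\<close> is absorbed by the adjoint
  eigenfunction.\<close>

definition dot :: "cvec \<Rightarrow> cvec \<Rightarrow> complex" where
  "dot v w = fst v * fst w + snd v * snd w"

definition wr :: "cvec \<Rightarrow> cvec \<Rightarrow> complex" where
  "wr v w = fst v * snd w - snd v * fst w"

lemma fst_cscale [simp]: "fst (cscale c v) = c * fst v"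
  and snd_cscale [simp]: "snd (cscale c v) = c * snd v"
  by (simp_all add: cscale_def)

lemma norm_cscale: "norm (cscale c v) = norm c * norm v"
proof -
  have "norm (cscale c v) = sqrt ((norm c)\<^sup>2 * ((norm (fst v))\<^sup>2 + (norm (snd v))\<^sup>2))"
    by (simp add: cscale_def norm_prod_def norm_mult power_mult_distrib distrib_left)
  then show ?thesis by (simp add: norm_prod_def real_sqrt_mult)
qed

lemma bounded_linear_cscale: "bounded_linear (cscale c)"
proof -
  have "bounded_linear (\<lambda>v::cvec. (c * fst v, c * snd v))"
    by (intro bounded_linear_Pair bounded_linear_const_mult bounded_linear_fst bounded_linear_snd)
  then show ?thesis by (simp add: cscale_def[abs_def])
qed

lemma continuous_on_cscale [continuous_intros]:
  "continuous_on A f \<Longrightarrow> continuous_on A g \<Longrightarrow> continuous_on A (\<lambda>x. cscale (f x) (g x))"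
  unfolding cscale_def by (intro continuous_intros)

lemma continuous_on_dot [continuous_intros]:
  "continuous_on A f \<Longrightarrow> continuous_on A g \<Longrightarrow> continuous_on A (\<lambda>x. dot (f x) (g x))"
  unfolding dot_def by (intro continuous_intros)

lemma continuous_on_wr [continuous_intros]:
  "continuous_on A f \<Longrightarrow> continuous_on A g \<Longrightarrow> continuous_on A (\<lambda>x. wr (f x) (g x))"
  unfolding wr_def by (intro continuous_intros)

lemma norm_fst_le_cvec: "norm (fst v) \<le> norm (v :: cvec)"
  and norm_snd_le_cvec: "norm (snd v) \<le> norm (v :: cvec)"
  by (cases v, simp add: norm_fst_le norm_snd_le)+

lemma norm_dot_le: "norm (dot v w) \<le> 2 * norm v * norm w"
proof -
  have "norm (dot v w) \<le> norm (fst v) * norm (fst w) + norm (snd v) * norm (snd w)"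
    unfolding dot_def by (intro order_trans[OF norm_triangle_ineq]) (simp add: norm_mult)
  also have "\<dots> \<le> norm v * norm w + norm v * norm w"
    by (intro add_mono mult_mono norm_fst_le_cvec norm_snd_le_cvec) auto
  finally show ?thesis by simp
qed

lemma norm_wr_le: "norm (wr v w) \<le> 2 * norm v * norm w"
proof -
  have "norm (wr v w) \<le> norm (fst v) * norm (snd w) + norm (snd v) * norm (fst w)"
    unfolding wr_def by (intro order_trans[OF norm_triangle_ineq4]) (simp add: norm_mult)
  also have "\<dots> \<le> norm v * norm w + norm v * norm w"
    by (intro add_mono mult_mono norm_fst_le_cvec norm_snd_le_cvec) auto
  finally show ?thesis by simp
qed

lemma wr_eq_0_iff_cscale:
  assumes "v \<noteq> 0"
  shows "wr v w = 0 \<longleftrightarrow> (\<exists>c. w = cscale c v)"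
proof
  assume w: "wr v w = 0"
  show "\<exists>c. w = cscale c v"
  proof (cases "fst v = 0")
    case True
    then have "snd v \<noteq> 0" using assms by (auto simp: prod_eq_iff)
    then show ?thesis using w True
      by (intro exI[of _ "snd w / snd v"]) (auto simp: prod_eq_iff wr_def)
  next
    case False
    then show ?thesis using w
      by (intro exI[of _ "fst w / fst v"]) (auto simp: prod_eq_iff wr_def field_simps)
  qed
next
  assume "\<exists>c. w = cscale c v"
  then obtain c where "w = cscale c v" by blast
  then show "wr v w = 0" by (simp add: wr_def mult.left_commute mult.commute)
qed

lemma norm_Jinv [simp]: "norm (Jinv v) = norm v"
  by (simp add: Jinv_def norm_prod_def add.commute)

lemma dirac_rhs_linear:
  "dirac_rhs p q z (\<lambda>x. cscale a (f x) + cscale b (g x)) (\<lambda>x. cscale a (y x) + cscale b (w x)) x =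
   cscale a (dirac_rhs p q z f y x) + cscale b (dirac_rhs p q z g w x)"
  by (simp add: dirac_rhs_def Jinv_def Qapp_def cscale_def prod_eq_iff algebra_simps)

text \<open>A solution at one spectral parameter is an inhomogeneous solution at any other. All
  comparisons between two parameters come from this.\<close>

lemma dirac_rhs_shift:
  "dirac_rhs p q z' (\<lambda>x. f x + cscale (z - z') (y x)) y x = dirac_rhs p q z f y x"
  by (simp add: dirac_rhs_def Jinv_def Qapp_def cscale_def prod_eq_iff algebra_simps)

locale dirac =
  fixes p q :: "real \<Rightarrow> complex"
  assumes bv_p: "bounded_variation_on p 0 pi" and bv_q: "bounded_variation_on q 0 pi"
begin

definition discont :: "real set" where
  "discont = {x\<in>{0<..<pi}. \<not> isCont p x \<or> \<not> isCont q x}"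

lemma countable_discont: "countable discont"
proof -
  have "discont = {x\<in>{0<..<pi}. \<not> isCont p x} \<union> {x\<in>{0<..<pi}. \<not> isCont q x}"
    by (auto simp: discont_def)
  then show ?thesis
    using bounded_variation_reg(2)[OF bv_p] bounded_variation_reg(2)[OF bv_q] by simp
qed

lemma reg_p: "piecewise_reg 0 pi discont p" and reg_q: "piecewise_reg 0 pi discont q"
  using bounded_variation_reg(1)[OF bv_p] bounded_variation_reg(1)[OF bv_q]
  by (auto simp: piecewise_reg_def discont_def)

text \<open>Coefficients of bounded variation are continuous off the countable set \<open>discont\<close>, so there the
  integrated equation holds classically and products of solutions can be
  differentiated pointwise.\<close>

definition dsol :: "complex \<Rightarrow> (real \<Rightarrow> cvec) \<Rightarrow> (real \<Rightarrow> cvec) \<Rightarrow> bool" where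
  "dsol z f y \<longleftrightarrow> continuous_on {0..pi} y \<and>
     (\<forall>x\<in>{0<..<pi} - discont. (y has_vector_derivative dirac_rhs p q z f y x) (at x))"

abbreviation hom :: "complex \<Rightarrow> (real \<Rightarrow> cvec) \<Rightarrow> bool" where
  "hom z y \<equiv> dsol z (\<lambda>_. (0,0)) y"

lemma reg_rhs:
  assumes f: "continuous_on {0..pi} f" and y: "continuous_on {0..pi} y"
  shows "piecewise_reg 0 pi discont (dirac_rhs p q z f y)"
proof -
  have "piecewise_reg 0 pi discont (\<lambda>x. fst (f x))" "piecewise_reg 0 pi discont (\<lambda>x. snd (f x))"
    "piecewise_reg 0 pi discont (\<lambda>x. fst (y x))" "piecewise_reg 0 pi discont (\<lambda>x. snd (y x))"
    "piecewise_reg 0 pi discont (\<lambda>x. z)"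
    by (intro piecewise_reg_continuous continuous_intros f y)+
  moreover have "dirac_rhs p q z f y = (\<lambda>x. (- (snd (f x) + z * snd (y x) - (q x * fst (y x) - p x * snd (y x))),
      fst (f x) + z * fst (y x) - (p x * fst (y x) + q x * snd (y x))))"
    by (simp add: dirac_rhs_def Jinv_def Qapp_def fun_eq_iff)
  ultimately show ?thesis
    using reg_p reg_q by (simp only:) (intro piecewise_reg_intros)
qed

lemma rhs_integrable:
  assumes "continuous_on {0..pi} f" "continuous_on {0..pi} y" "0 \<le> a" "b \<le> pi"
  shows "dirac_rhs p q z f y integrable_on {a..b}"
proof -
  have "dirac_rhs p q z f y integrable_on {0..pi}"
    using piecewise_reg_integrable[OF reg_rhs countable_discont] assms
    by (intro set_lebesgue_integral_eq_integral(1)) auto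
  then show ?thesis by (rule integrable_subinterval_real) (use assms in auto)
qed

text \<open>Continuous right-hand sides cover both uses: root functions in a chain at a simple
  eigenvalue, and test functions for the resolvent that solve the equation at another
  parameter.\<close>

lemma dirac_eq_iff_dsol:
  assumes f: "continuous_on {0..pi} f"
  shows "dirac_eq p q z f y \<longleftrightarrow> dsol z f y"
proof
  assume y: "dirac_eq p q z f y"
  then have cont: "continuous_on {0..pi} y" by (simp add: dirac_eq_def)
  let ?h = "dirac_rhs p q z f y"
  show "dsol z f y"
    unfolding dsol_def
  proof (intro conjI cont ballI)
    fix x assume x: "x \<in> {0<..<pi} - discont"
    have d: "((\<lambda>x. integral {0..x} ?h) has_vector_derivative ?h x) (at x)"
      by (rule piecewise_reg_integral_derivative[OF reg_rhs[OF f cont] countable_discont x])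
    have "((\<lambda>x. y 0 + integral {0..x} ?h) has_vector_derivative 0 + ?h x) (at x)"
      by (rule has_vector_derivative_add[OF has_vector_derivative_const d])
    then have "((\<lambda>x. y 0 + integral {0..x} ?h) has_vector_derivative ?h x) (at x)" by simp
    then show "(y has_vector_derivative ?h x) (at x)"
    proof (rule has_vector_derivative_transform_within_open[of _ _ _ "{0<..<pi}"])
      fix x assume "x \<in> {0<..<pi}"
      then have "x \<in> {0..pi}" by simp
      then show "y 0 + integral {0..x} ?h = y x" using y unfolding dirac_eq_def by metis
    qed (use x in auto)
  qed
next
  assume y: "dsol z f y"
  then have cont: "continuous_on {0..pi} y" by (simp add: dsol_def)
  let ?h = "dirac_rhs p q z f y"
  have h: "(?h has_integral (y x - y 0)) {0..x}" if x: "x \<in> {0..pi}" for x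
  proof (rule ftc_countable[OF _ _ countable_discont])
    show "0 \<le> x" using x by simp
    show "continuous_on {0..x} y" using x by (intro continuous_on_subset[OF cont]) auto
    show "piecewise_reg 0 x discont ?h"
      by (rule piecewise_reg_subset[OF reg_rhs[OF f cont]]) (use x in auto)
    show "(y has_vector_derivative ?h s) (at s)" if "s \<in> {0<..<x} - discont" for s
      using that x y by (simp add: dsol_def)
  qed
  show "dirac_eq p q z f y"
    unfolding dirac_eq_def
  proof (intro conjI cont ballI)
    fix x assume x: "x \<in> {0..pi}"
    show "?h integrable_on {0..x}" using h[OF x] by (rule has_integral_integrable)
    show "y x = y 0 + integral {0..x} ?h" using integral_unique[OF h[OF x]] by simp
  qed
qed

lemma dsol_continuous: "dsol z f y \<Longrightarrow> continuous_on {0..pi} y"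
  by (simp add: dsol_def)

lemma dsol_linear:
  assumes "dsol z f y" "dsol z g w"
  shows "dsol z (\<lambda>x. cscale a (f x) + cscale b (g x)) (\<lambda>x. cscale a (y x) + cscale b (w x))"
  unfolding dsol_def dirac_rhs_linear
proof (intro conjI ballI)
  show "continuous_on {0..pi} (\<lambda>x. cscale a (y x) + cscale b (w x))"
    using assms by (intro continuous_intros) (simp_all add: dsol_def)
  fix x assume "x \<in> {0<..<pi} - discont"
  then have "(y has_vector_derivative dirac_rhs p q z f y x) (at x)"
    "(w has_vector_derivative dirac_rhs p q z g w x) (at x)"
    using assms by (simp_all add: dsol_def)
  then show "((\<lambda>x. cscale a (y x) + cscale b (w x)) has_vector_derivative
      cscale a (dirac_rhs p q z f y x) + cscale b (dirac_rhs p q z g w x)) (at x)"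
    by (intro has_vector_derivative_add bounded_linear.has_vector_derivative[OF bounded_linear_cscale])
qed

lemma dsol_cong:
  assumes y: "dsol z f y" and "\<And>x. x \<in> {0..pi} \<Longrightarrow> f x = g x" "\<And>x. x \<in> {0..pi} \<Longrightarrow> y x = w x"
  shows "dsol z g w"
  unfolding dsol_def
proof (intro conjI ballI)
  show "continuous_on {0..pi} w"
    using dsol_continuous[OF y] assms(3) by (subst continuous_on_cong[of _ _ _ y]) auto
  fix x assume x: "x \<in> {0<..<pi} - discont"
  have "(y has_vector_derivative dirac_rhs p q z f y x) (at x)" using y x by (simp add: dsol_def)
  then have "(w has_vector_derivative dirac_rhs p q z f y x) (at x)"
    by (rule has_vector_derivative_transform_within_open[of _ _ _ "{0<..<pi}"]) (use x assms in auto)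
  moreover have "dirac_rhs p q z f y x = dirac_rhs p q z g w x"
    using assms x by (simp add: dirac_rhs_def)
  ultimately show "(w has_vector_derivative dirac_rhs p q z g w x) (at x)" by simp
qed

lemma hom_linear: "hom z y \<Longrightarrow> hom z w \<Longrightarrow> hom z (\<lambda>x. cscale a (y x) + cscale b (w x))"
  using dsol_linear[of z "\<lambda>_. (0,0)" y "\<lambda>_. (0,0)" w a b] by (simp add: cscale_def)

lemma dsol_shift: "dsol z f y \<Longrightarrow> dsol z' (\<lambda>x. f x + cscale (z - z') (y x)) y"
  unfolding dsol_def dirac_rhs_shift .

text \<open>J is antisymmetric and Q symmetric, so in the derivative of the Wronskian everything
  cancels except the pairing of w with f.\<close>

lemma lagrange_identity:
  assumes w: "hom z w" and y: "dsol z f y" and f: "continuous_on {0..pi} f"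
    and "0 \<le> a" "a \<le> b" "b \<le> pi"
  shows "((\<lambda>x. dot (w x) (f x)) has_integral (wr (w b) (y b) - wr (w a) (y a))) {a..b}"
proof -
  have sub: "{a..b} \<subseteq> {0..pi}" using assms by auto
  note cont = continuous_on_subset[OF dsol_continuous[OF w] sub]
    continuous_on_subset[OF dsol_continuous[OF y] sub] continuous_on_subset[OF f sub]
  show ?thesis
  proof (rule ftc_countable[OF \<open>a \<le> b\<close> _ countable_discont])
    show "continuous_on {a..b} (\<lambda>x. wr (w x) (y x))" by (intro continuous_intros cont)
    show "piecewise_reg a b discont (\<lambda>x. dot (w x) (f x))"
      by (intro piecewise_reg_continuous continuous_intros cont)
    fix x assume "x \<in> {a<..<b} - discont"
    then have "x \<in> {0<..<pi} - discont" using assms by auto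
    then have d: "(w has_vector_derivative dirac_rhs p q z (\<lambda>_. (0,0)) w x) (at x)"
      "(y has_vector_derivative dirac_rhs p q z f y x) (at x)"
      using w y by (auto simp: dsol_def)
    note df = d[THEN bounded_linear.has_vector_derivative[OF bounded_linear_fst]]
      and ds = d[THEN bounded_linear.has_vector_derivative[OF bounded_linear_snd]]
    have "((\<lambda>x. wr (w x) (y x)) has_vector_derivative
       (fst (w x) * snd (dirac_rhs p q z f y x) + fst (dirac_rhs p q z (\<lambda>_. (0,0)) w x) * snd (y x) -
       (snd (w x) * fst (dirac_rhs p q z f y x) + snd (dirac_rhs p q z (\<lambda>_. (0,0)) w x) * fst (y x)))) (at x)"
      unfolding wr_def by (intro has_vector_derivative_diff has_vector_derivative_mult df ds)
    then show "((\<lambda>x. wr (w x) (y x)) has_vector_derivative dot (w x) (f x)) (at x)"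
      by (rule has_vector_derivative_eq_rhs)
        (simp add: dirac_rhs_def Jinv_def Qapp_def cscale_def dot_def algebra_simps)
  qed
qed

lemma wr_hom_const:
  assumes w: "hom z w" and y: "hom z y" and x: "x \<in> {0..pi}"
  shows "wr (w x) (y x) = wr (w 0) (y 0)"
proof -
  have "((\<lambda>_. 0) has_integral (wr (w x) (y x) - wr (w 0) (y 0))) {0..x}"
    using lagrange_identity[OF w y, of 0 x] x by (simp add: dot_def)
  then show ?thesis by (simp add: has_integral_0_eq)
qed

definition qbd :: real where
  "qbd = (SOME B. B \<ge> 0 \<and> (\<forall>x\<in>{0..pi}. norm (p x) \<le> B \<and> norm (q x) \<le> B))"

lemma qbd:
  shows qbd_nonneg: "qbd \<ge> 0"
    and norm_p_le: "x \<in> {0..pi} \<Longrightarrow> norm (p x) \<le> qbd"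
    and norm_q_le: "x \<in> {0..pi} \<Longrightarrow> norm (q x) \<le> qbd"
proof -
  obtain A where A: "\<And>x. x \<in> {0..pi} \<Longrightarrow> norm (p x) \<le> A" using piecewise_reg_bound[OF reg_p] by blast
  obtain B where B: "\<And>x. x \<in> {0..pi} \<Longrightarrow> norm (q x) \<le> B" using piecewise_reg_bound[OF reg_q] by blast
  have "norm (p x) \<le> \<bar>A\<bar> + \<bar>B\<bar> \<and> norm (q x) \<le> \<bar>A\<bar> + \<bar>B\<bar>" if "x \<in> {0..pi}" for x
    using A[OF that] B[OF that] by linarith
  then have "\<exists>B. B \<ge> 0 \<and> (\<forall>x\<in>{0..pi}. norm (p x) \<le> B \<and> norm (q x) \<le> B)"
    by (intro exI[of _ "\<bar>A\<bar> + \<bar>B\<bar>"]) simp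
  then have *: "qbd \<ge> 0 \<and> (\<forall>x\<in>{0..pi}. norm (p x) \<le> qbd \<and> norm (q x) \<le> qbd)"
    unfolding qbd_def by (rule someI_ex)
  then show "qbd \<ge> 0" by (rule conjunct1)
  show "norm (p x) \<le> qbd" if "x \<in> {0..pi}" using * that by simp
  show "norm (q x) \<le> qbd" if "x \<in> {0..pi}" using * that by simp
qed

lemma norm_Qapp_le:
  assumes "x \<in> {0..pi}"
  shows "norm (Qapp p q x v) \<le> 4 * qbd * norm v"
proof -
  have m: "norm (c * d) \<le> qbd * norm v" if "norm c \<le> qbd" "norm d \<le> norm v" for c d :: complex
    unfolding norm_mult by (rule mult_mono[OF that qbd_nonneg norm_ge_zero])
  note pq = norm_p_le[OF assms] norm_q_le[OF assms] and v = norm_fst_le_cvec[of v] norm_snd_le_cvec[of v]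
  have "norm (Qapp p q x v) \<le> norm (p x * fst v + q x * snd v) + norm (q x * fst v - p x * snd v)"
    unfolding Qapp_def by (rule norm_Pair_le)
  also have "\<dots> \<le> (norm (p x * fst v) + norm (q x * snd v)) + (norm (q x * fst v) + norm (p x * snd v))"
    by (rule add_mono[OF norm_triangle_ineq norm_triangle_ineq4])
  also have "\<dots> \<le> 4 * qbd * norm v"
    using m[OF pq(1) v(1)] m[OF pq(2) v(2)] m[OF pq(2) v(1)] m[OF pq(1) v(2)] by simp
  finally show ?thesis .
qed

end

text \<open>For real z the map v \<mapsto> \<open>Jinv (cscale z v)\<close> is skew for the real
  inner product, so only Im z can change the norm of a solution. This keeps the growth rate at |Im
  z| instead of |z|, as the asymptotics require.\<close>

lemma inner_Jinv_cscale_le: "\<bar>v \<bullet> Jinv (cscale z v)\<bar> \<le> \<bar>Im z\<bar> * (v \<bullet> v)"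
proof -
  obtain a b c d where v: "v = (Complex a b, Complex c d)" by (metis complex.exhaust prod.exhaust)
  have "v \<bullet> Jinv (cscale z v) = 2 * Im z * (a * d - b * c)"
    by (simp add: v Jinv_def cscale_def inner_complex_def algebra_simps)
  moreover have "2 * \<bar>a * d - b * c\<bar> \<le> a^2 + b^2 + c^2 + d^2"
    using zero_le_power2[of "a - d"] zero_le_power2[of "a + d"] zero_le_power2[of "b - c"] zero_le_power2[of "b + c"]
    by (simp add: power2_eq_square algebra_simps abs_if)
  then have "\<bar>Im z\<bar> * (2 * \<bar>a * d - b * c\<bar>) \<le> \<bar>Im z\<bar> * (a^2 + b^2 + c^2 + d^2)"
    by (rule mult_left_mono) simp
  moreover have "v \<bullet> v = a^2 + b^2 + c^2 + d^2"
    by (simp add: v inner_complex_def power2_eq_square)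
  moreover have "\<bar>2 * Im z * (a * d - b * c)\<bar> = \<bar>Im z\<bar> * (2 * \<bar>a * d - b * c\<bar>)"
    by (simp add: abs_mult)
  ultimately show ?thesis by presburger
qed

section \<open>Growth, existence and uniqueness of solutions\<close>

context dirac
begin

lemma hom_rhs: "dirac_rhs p q z (\<lambda>_. (0,0)) y x = Jinv (cscale z (y x)) - Jinv (Qapp p q x (y x))"
  by (simp add: dirac_rhs_def Jinv_def prod_eq_iff)

lemma norm_hom_rhs_le:
  assumes "x \<in> {0..pi}"
  shows "norm (dirac_rhs p q z (\<lambda>_. (0,0)) y x) \<le> (norm z + 4 * qbd) * norm (y x)"
proof -
  have "norm (dirac_rhs p q z (\<lambda>_. (0,0)) y x) \<le> norm z * norm (y x) + norm (Qapp p q x (y x))"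
    unfolding hom_rhs by (rule order_trans[OF norm_triangle_ineq4]) (simp add: norm_cscale)
  also have "\<dots> \<le> norm z * norm (y x) + 4 * qbd * norm (y x)"
    using norm_Qapp_le[OF assms, of "y x"] by simp
  finally show ?thesis by (simp add: algebra_simps)
qed

text \<open>Gronwall in energy form: with K = |Im z| + 4 \<open>qbd\<close> the function exp(-2 K s)
  |y s|^2 is nonincreasing.\<close>

lemma hom_growth:
  assumes y: "hom z y" and x: "x \<in> {0..pi}"
  shows "norm (y x) \<le> norm (y 0) * exp ((\<bar>Im z\<bar> + 4 * qbd) * x)"
proof -
  define K where "K = \<bar>Im z\<bar> + 4 * qbd"
  define E where "E = (\<lambda>s. - (exp (- (2 * K) * s) * (y s \<bullet> y s)))"
  note cont = dsol_continuous[OF y]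
  have "E 0 \<le> E x"
  proof (rule mono_of_deriv_nonneg_countable[where f = E and a = 0 and b = x, OF _ _ countable_discont])
    show "0 \<le> x" using x by simp
  next
    have "continuous_on {0..x} y" using x by (intro continuous_on_subset[OF cont]) auto
    then show "continuous_on {0..x} E" unfolding E_def by (intro continuous_intros)
  next
    fix s assume s: "s \<in> {0<..<x} - discont"
    then have s': "s \<in> {0..pi}" using x by auto
    define D where "D = dirac_rhs p q z (\<lambda>_. (0,0)) y s"
    have d: "(y has_vector_derivative D) (at s)"
      using y s x by (auto simp: dsol_def D_def)
    have "((\<lambda>s. y s \<bullet> y s) has_vector_derivative (y s \<bullet> D + D \<bullet> y s)) (at s)"
      by (rule bounded_bilinear.has_vector_derivative[OF bounded_bilinear_inner d d])
    then have "((\<lambda>s. y s \<bullet> y s) has_real_derivative 2 * (y s \<bullet> D)) (at s)"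
      by (simp add: has_real_derivative_iff_has_vector_derivative inner_commute)
    then have dE: "(E has_real_derivative - (exp (- (2 * K) * s) * (2 * (y s \<bullet> D)) + 
        exp (- (2 * K) * s) * (- (2 * K)) * (y s \<bullet> y s))) (at s)"
      unfolding E_def by (auto intro!: derivative_eq_intros)
    have "y s \<bullet> D \<le> \<bar>Im z\<bar> * (y s \<bullet> y s) + 4 * qbd * (y s \<bullet> y s)"
    proof -
      have "y s \<bullet> D = y s \<bullet> Jinv (cscale z (y s)) - y s \<bullet> Jinv (Qapp p q s (y s))"
        unfolding D_def hom_rhs by (simp add: inner_diff_right)
      also have "\<dots> \<le> \<bar>Im z\<bar> * (y s \<bullet> y s) + norm (y s) * norm (Jinv (Qapp p q s (y s)))"
        using inner_Jinv_cscale_le[of "y s" z] Cauchy_Schwarz_ineq2[of "y s" "Jinv (Qapp p q s (y s))"] by linarith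
      also have "norm (y s) * norm (Jinv (Qapp p q s (y s))) \<le> norm (y s) * (4 * qbd * norm (y s))"
        using norm_Qapp_le[OF s', of "y s"] by (intro mult_left_mono) auto
      also have "\<dots> = 4 * qbd * (y s \<bullet> y s)" by (simp add: power2_norm_eq_inner[symmetric] power2_eq_square)
      finally show ?thesis by simp
    qed
    then have "exp (- (2 * K) * s) * (2 * (y s \<bullet> D)) \<le> exp (- (2 * K) * s) * (2 * K * (y s \<bullet> y s))"
      by (intro mult_left_mono) (auto simp: K_def algebra_simps)
    then have "0 \<le> - (exp (- (2 * K) * s) * (2 * (y s \<bullet> D)) + 
        exp (- (2 * K) * s) * (- (2 * K)) * (y s \<bullet> y s))"
      by (simp add: algebra_simps)
    then show "\<exists>D\<ge>0. (E has_real_derivative D) (at s)" using dE by blast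
  qed
  then have "exp (- (2 * K) * x) * (y x \<bullet> y x) \<le> y 0 \<bullet> y 0" by (simp add: E_def)
  then have "exp (2 * K * x) * (exp (- (2 * K) * x) * (y x \<bullet> y x)) \<le> exp (2 * K * x) * (y 0 \<bullet> y 0)"
    by (intro mult_left_mono) auto
  then have "y x \<bullet> y x \<le> exp (2 * K * x) * (y 0 \<bullet> y 0)"
    by (simp add: mult.assoc[symmetric] exp_add[symmetric])
  then have "(norm (y x))\<^sup>2 \<le> (norm (y 0) * exp (K * x))\<^sup>2"
    by (simp add: power2_norm_eq_inner power_mult_distrib exp_double[symmetric] mult_ac)
  then show ?thesis unfolding K_def by (rule power2_le_imp_le) simp
qed

text \<open>The increments of the Picard iteration; the iterates themselves are the partial sums
  \<open>P\<close> in \<open>hom_exists\<close>.\<close>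

primrec picard :: "complex \<Rightarrow> cvec \<Rightarrow> nat \<Rightarrow> real \<Rightarrow> cvec" where
  "picard z v 0 = (\<lambda>_. v)"
| "picard z v (Suc n) = (\<lambda>x. integral {0..x} (dirac_rhs p q z (\<lambda>_. (0,0)) (picard z v n)))"

lemma picard_bound:
  "continuous_on {0..pi} (picard z v n) \<and>
   (\<forall>x\<in>{0..pi}. norm (picard z v n x) \<le> norm v * ((norm z + 4 * qbd) * x) ^ n / fact n)"
proof (induction n)
  case 0
  then show ?case by simp
next
  case (Suc n)
  let ?h = "dirac_rhs p q z (\<lambda>_. (0,0)) (picard z v n)" and ?K = "norm z + 4 * qbd"
  have K: "?K \<ge> 0" using qbd_nonneg by simp
  have int: "?h integrable_on {0..x}" if "x \<le> pi" for x
    using Suc that by (intro rhs_integrable) auto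
  have "continuous_on {0..pi} (picard z v (Suc n))"
    using indefinite_integral_continuous_1[OF int[OF order_refl]] by simp
  moreover have "norm (picard z v (Suc n) x) \<le> norm v * (?K * x) ^ Suc n / fact (Suc n)" if x: "x \<in> {0..pi}" for x
  proof -
    have "((\<lambda>s. s ^ n) has_integral (x ^ Suc n / Suc n - 0 ^ Suc n / Suc n)) {0..x}"
      using x by (intro fundamental_theorem_of_calculus)
        (auto intro!: derivative_eq_intros simp: has_real_derivative_iff_has_vector_derivative[symmetric] simp del: power_Suc)
    from has_integral_mult_right[OF this, of "?K * (norm v * ?K ^ n / fact n)"]
    have I: "((\<lambda>s. ?K * (norm v * (?K * s) ^ n / fact n)) has_integral norm v * (?K * x) ^ Suc n / fact (Suc n)) {0..x}"
      by (simp add: power_mult_distrib mult_ac)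
    have "norm (integral {0..x} ?h) \<le> integral {0..x} (\<lambda>s. ?K * (norm v * (?K * s) ^ n / fact n))"
    proof (rule integral_norm_bound_integral)
      fix s assume s: "s \<in> {0..x}"
      then have s': "s \<in> {0..pi}" using x by auto
      have "norm (?h s) \<le> ?K * norm (picard z v n s)" by (rule norm_hom_rhs_le[OF s'])
      also have "\<dots> \<le> ?K * (norm v * (?K * s) ^ n / fact n)"
        using Suc s' K by (intro mult_left_mono) auto
      finally show "norm (?h s) \<le> ?K * (norm v * (?K * s) ^ n / fact n)" .
    qed (use int x I in auto)
    then show ?thesis using integral_unique[OF I] by simp
  qed
  ultimately show ?case by blast
qed

lemma hom_exists: "\<exists>y. hom z y \<and> y 0 = v"
proof -
  let ?Y = "picard z v" and ?K = "norm z + 4 * qbd" and ?h = "dirac_rhs p q z (\<lambda>_. (0,0))"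
  have K: "?K \<ge> 0" using qbd_nonneg by simp
  define P where "P = (\<lambda>n x. \<Sum>i<n. ?Y i x)"
  define y where "y = (\<lambda>x. suminf (\<lambda>i. ?Y i x))"
  have cY: "continuous_on {0..pi} (?Y n)" for n using picard_bound by blast
  have cP: "continuous_on {0..pi} (P n)" for n unfolding P_def by (intro continuous_intros cY)
  have ul: "uniform_limit {0..pi} P y sequentially"
    unfolding P_def y_def
  proof (rule Weierstrass_m_test)
    fix n x assume x: "x \<in> {0..pi}"
    have "norm (?Y n x) \<le> norm v * (?K * x) ^ n / fact n" using picard_bound x by blast
    also have "\<dots> \<le> norm v * ((?K * pi) ^ n / fact n)"
      using x K by (auto intro!: mult_left_mono divide_right_mono power_mono)
    finally show "norm (?Y n x) \<le> norm v * ((?K * pi) ^ n / fact n)" .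
  next
    have "summable (\<lambda>n. (?K * pi) ^ n / fact n)"
      using summable_exp[of "?K * pi"] by (simp add: field_simps)
    then show "summable (\<lambda>n. norm v * ((?K * pi) ^ n / fact n))" by (rule summable_mult)
  qed
  have cy: "continuous_on {0..pi} y"
    by (rule uniform_limit_theorem[OF _ ul]) (simp_all add: cP)
  have P_Suc: "P (Suc n) x = v + integral {0..x} (?h (P n))" if x: "x \<in> {0..pi}" for n x
  proof (induction n)
    case 0
    have "?h (P 0) = (\<lambda>_. 0)" by (simp add: P_def hom_rhs Jinv_def cscale_def Qapp_def fun_eq_iff prod_eq_iff)
    then show ?case by (simp add: P_def)
  next
    case (Suc n)
    have eq: "?h (P (Suc n)) s = ?h (P n) s + ?h (?Y n) s" for s
      by (simp add: P_def hom_rhs Jinv_def cscale_def Qapp_def prod_eq_iff algebra_simps)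
    have "integral {0..x} (?h (P (Suc n))) = integral {0..x} (?h (P n)) + integral {0..x} (?h (?Y n))"
      unfolding eq using x by (intro Henstock_Kurzweil_Integration.integral_add rhs_integrable cP cY continuous_intros) auto
    also have "v + \<dots> = P (Suc n) x + ?Y (Suc n) x" using Suc by simp
    also have "\<dots> = P (Suc (Suc n)) x" by (simp add: P_def)
    finally show ?case by simp
  qed
  have y_eq: "y x = v + integral {0..x} (?h y)" if x: "x \<in> {0..pi}" for x
  proof -
    have "(\<lambda>n. integral {0..x} (?h (P n)) - integral {0..x} (?h y)) \<longlonglongrightarrow> 0"
    proof (rule LIMSEQ_I)
      fix r :: real assume "r > 0"
      \<comment> \<open>The summands 1 keep the quotient meaningful for K = 0 and make the final
        inequality strict.\<close>
      define e where "e = r / ((?K + 1) * (pi + 1))"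
      have "e > 0" using \<open>r > 0\<close> K by (simp add: e_def add_pos_nonneg)
      obtain N where N: "\<And>n s. n \<ge> N \<Longrightarrow> s \<in> {0..pi} \<Longrightarrow> norm (P n s - y s) < e"
        using uniform_limitD[OF ul \<open>e > 0\<close>] unfolding eventually_sequentially dist_norm by blast
      have "norm (integral {0..x} (?h (P n)) - integral {0..x} (?h y) - 0) < r" if "n \<ge> N" for n
      proof -
        have eq: "?h (P n) s - ?h y s = ?h (\<lambda>s. P n s - y s) s" for s
          by (simp add: hom_rhs Jinv_def cscale_def Qapp_def prod_eq_iff algebra_simps)
        have "integral {0..x} (?h (P n)) - integral {0..x} (?h y) = integral {0..x} (\<lambda>s. ?h (P n) s - ?h y s)"
          using x by (intro Henstock_Kurzweil_Integration.integral_diff[symmetric] rhs_integrable cP cy continuous_intros) auto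
        also have "norm \<dots> \<le> integral {0..x} (\<lambda>_. ?K * e)"
        proof (rule integral_norm_bound_integral)
          show "(\<lambda>s. ?h (P n) s - ?h y s) integrable_on {0..x}"
            using x by (intro integrable_diff rhs_integrable cP cy continuous_intros) auto
          fix s assume s: "s \<in> {0..x}"
          have "norm (?h (\<lambda>s. P n s - y s) s) \<le> ?K * norm (P n s - y s)"
            using s x by (intro norm_hom_rhs_le) auto
          also have "\<dots> \<le> ?K * e" using N[OF that, of s] s x K by (intro mult_left_mono) auto
          finally show "norm (?h (P n) s - ?h y s) \<le> ?K * e" unfolding eq .
        qed auto
        also have "\<dots> = ?K * e * x" using x by simp
        also have "\<dots> \<le> ?K * e * pi" using x K \<open>e > 0\<close> by (intro mult_left_mono) auto
        also have "\<dots> < (?K + 1) * e * (pi + 1)"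
        proof -
          have "0 \<le> ?K * e" "0 < e * pi" using K \<open>e > 0\<close> by simp_all
          then have "?K * e * pi < ?K * e * pi + ?K * e + e * pi + e" using \<open>e > 0\<close> by linarith
          then show ?thesis by (simp add: algebra_simps)
        qed
        also have "\<dots> = e * ((?K + 1) * (pi + 1))" by (simp only: mult_ac)
        also have "\<dots> = r"
        proof -
          have "?K + 1 > 0" "pi + 1 > 0" using K pi_gt_zero by linarith+
          then have "(?K + 1) * (pi + 1) \<noteq> 0" by simp
          then show ?thesis unfolding e_def by (rule nonzero_eq_divide_eq[THEN iffD1, OF _ refl])
        qed
        finally show ?thesis by simp
      qed
      then show "\<exists>no. \<forall>n\<ge>no. norm (integral {0..x} (?h (P n)) - integral {0..x} (?h y) - 0) < r" by blast
    qed
    then have "(\<lambda>n. v + integral {0..x} (?h (P n))) \<longlonglongrightarrow> v + integral {0..x} (?h y)"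
      by (intro tendsto_add tendsto_const) (simp add: LIM_zero_iff)
    then have "(\<lambda>n. P (Suc n) x) \<longlonglongrightarrow> v + integral {0..x} (?h y)" using P_Suc[OF x] by simp
    moreover have "(\<lambda>n. P n x) \<longlonglongrightarrow> y x" by (rule tendsto_uniform_limitI[OF ul x])
    then have "(\<lambda>n. P (Suc n) x) \<longlonglongrightarrow> y x" by (rule LIMSEQ_Suc)
    ultimately show ?thesis by (metis LIMSEQ_unique)
  qed
  have y0: "y 0 = v" using y_eq[of 0] by simp
  have "dirac_eq p q z (\<lambda>_. (0,0)) y"
    unfolding dirac_eq_def
  proof (intro conjI cy ballI)
    fix x assume x: "x \<in> {0..pi}"
    show "?h y integrable_on {0..x}" using x by (intro rhs_integrable cy continuous_intros) auto
    show "y x = y 0 + integral {0..x} (?h y)" using y_eq[OF x] y0 by metis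
  qed
  then show ?thesis using y0 dirac_eq_iff_dsol[of "\<lambda>_. (0,0)"] by auto
qed

definition Y1 :: "complex \<Rightarrow> real \<Rightarrow> cvec" where
  "Y1 z = (SOME y. hom z y \<and> y 0 = (1,0))"
definition Y2 :: "complex \<Rightarrow> real \<Rightarrow> cvec" where
  "Y2 z = (SOME y. hom z y \<and> y 0 = (0,1))"

lemma hom_Y1: "hom z (Y1 z)" and Y1_0: "Y1 z 0 = (1,0)"
  using someI_ex[OF hom_exists[of z "(1,0)"]] unfolding Y1_def by blast+
lemma hom_Y2: "hom z (Y2 z)" and Y2_0: "Y2 z 0 = (0,1)"
  using someI_ex[OF hom_exists[of z "(0,1)"]] unfolding Y2_def by blast+

text \<open>The solution with initial value v. Building it from the fixed pair \<open>Y1\<close>,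
  \<open>Y2\<close> makes it linear in v by construction.\<close>

definition fsol :: "complex \<Rightarrow> cvec \<Rightarrow> real \<Rightarrow> cvec" where
  "fsol z v x = cscale (fst v) (Y1 z x) + cscale (snd v) (Y2 z x)"

lemma hom_fsol: "hom z (fsol z v)"
  unfolding fsol_def[abs_def] by (rule hom_linear[OF hom_Y1 hom_Y2])

lemma fsol_0 [simp]: "fsol z v 0 = v"
  by (simp add: fsol_def Y1_0 Y2_0 cscale_def)

lemma wr_Y1_Y2: "x \<in> {0..pi} \<Longrightarrow> wr (Y1 z x) (Y2 z x) = 1"
  using wr_hom_const[OF hom_Y1 hom_Y2, of x] by (simp add: Y1_0 Y2_0 wr_def)

lemma basis_expansion:
  assumes "wr a b = 1"
  shows "v = cscale (wr v b) a + cscale (wr a v) b"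
proof -
  have e: "fst a * snd b = 1 + snd a * fst b" using assms by (simp add: wr_def algebra_simps)
  show ?thesis
    unfolding prod_eq_iff wr_def by (simp add: ring_distribs) (simp add: mult_ac e ring_distribs, use e in algebra)
qed

text \<open>The coordinates of y x in the basis \<open>Y1\<close>, \<open>Y2\<close> are Wronskians,
  and the Lagrange identity evaluates these. With f = 0 this becomes uniqueness.\<close>

lemma variation_of_constants:
  assumes y: "dsol z f y" and f: "continuous_on {0..pi} f" and x: "x \<in> {0..pi}"
  shows "y x = fsol z (y 0) x +
     (cscale (- integral {0..x} (\<lambda>s. dot (Y2 z s) (f s))) (Y1 z x) +
      cscale (integral {0..x} (\<lambda>s. dot (Y1 z s) (f s))) (Y2 z x))"
proof -
  have 1: "wr (Y1 z x) (y x) = snd (y 0) + integral {0..x} (\<lambda>s. dot (Y1 z s) (f s))"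
    using integral_unique[OF lagrange_identity[OF hom_Y1 y f, of 0 x]] x by (simp add: Y1_0 wr_def)
  have 2: "wr (Y2 z x) (y x) = - fst (y 0) + integral {0..x} (\<lambda>s. dot (Y2 z s) (f s))"
    using integral_unique[OF lagrange_identity[OF hom_Y2 y f, of 0 x]] x by (simp add: Y2_0 wr_def)
  have 3: "wr (y x) (Y2 z x) = fst (y 0) - integral {0..x} (\<lambda>s. dot (Y2 z s) (f s))"
    using 2 by (simp add: wr_def algebra_simps)
  show ?thesis
    by (subst basis_expansion[OF wr_Y1_Y2[OF x], of "y x" z])
      (simp add: 1 3 fsol_def cscale_def prod_eq_iff algebra_simps)
qed

lemma hom_unique:
  assumes "hom z y" "x \<in> {0..pi}"
  shows "y x = fsol z (y 0) x"
  using variation_of_constants[OF assms(1) _ assms(2)] by (simp add: dot_def cscale_def flip: zero_prod_def)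

section \<open>Monodromy matrix and discriminant\<close>


lemma fsol_scale: "fsol z (cscale c v) x = cscale c (fsol z v x)"
  by (simp add: fsol_def cscale_def prod_eq_iff algebra_simps)

lemma fsol_add: "fsol z (v + w) x = fsol z v x + fsol z w x"
  by (simp add: fsol_def cscale_def prod_eq_iff algebra_simps)

lemma continuous_fsol: "continuous_on {0..pi} (fsol z v)"
  by (rule dsol_continuous[OF hom_fsol])

lemma norm_fsol_le:
  assumes "x \<in> {0..pi}"
  shows "norm (fsol z v x) \<le> norm v * exp ((\<bar>Im z\<bar> + 4 * qbd) * pi)"
proof -
  have "norm (fsol z v x) \<le> norm v * exp ((\<bar>Im z\<bar> + 4 * qbd) * x)"
    using hom_growth[OF hom_fsol assms, of z v] by simp
  also have "\<dots> \<le> norm v * exp ((\<bar>Im z\<bar> + 4 * qbd) * pi)"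
    using assms qbd_nonneg by (intro mult_left_mono) (auto intro!: mult_left_mono)
  finally show ?thesis .
qed

section \<open>Dependence of solutions on the spectral parameter\<close>

lemma dsol_fsol_shift: "dsol z (\<lambda>x. cscale (\<zeta> - z) (fsol \<zeta> v x)) (fsol \<zeta> v)"
  using dsol_shift[OF hom_fsol[of \<zeta> v], of z] by (simp flip: zero_prod_def)

text \<open>The solution at \<zeta> solves the equation at z with right-hand side (\<zeta> - z)
  times itself, so variation of constants applies. The formula is implicit, but the growth bound
  controls the solution under the integral, and the factor \<zeta> - z stands in front.\<close>

lemma fsol_diff:
  assumes x: "x \<in> {0..pi}"
  shows "fsol \<zeta> v x = fsol z v x + cscale (\<zeta> - z)
     (cscale (- integral {0..x} (\<lambda>s. dot (Y2 z s) (fsol \<zeta> v s))) (Y1 z x) +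
      cscale (integral {0..x} (\<lambda>s. dot (Y1 z s) (fsol \<zeta> v s))) (Y2 z x))"
proof -
  have e: "dot w (cscale c u) = c * dot w u" for c u w by (simp add: dot_def algebra_simps)
  have s: "cscale c (cscale a v + cscale b w) = cscale (c * a) v + cscale (c * b) w" for a b c v w
    by (simp add: prod_eq_iff algebra_simps)
  show ?thesis
    by (subst variation_of_constants[OF dsol_fsol_shift[of z \<zeta> v] _ x])
      (auto simp: e s intro!: continuous_intros continuous_fsol)
qed

lemma norm_integral_dot_le:
  assumes x: "x \<in> {0..pi}" and c: "continuous_on {0..pi} f" "continuous_on {0..pi} g"
    and b: "\<And>s. s \<in> {0..pi} \<Longrightarrow> norm (f s) \<le> A" "\<And>s. s \<in> {0..pi} \<Longrightarrow> norm (g s) \<le> B"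
  shows "norm (integral {0..x} (\<lambda>s. dot (f s) (g s))) \<le> 2 * A * B * pi"
proof -
  have AB: "A \<ge> 0" "B \<ge> 0" using order_trans[OF norm_ge_zero b(1)[of 0]] order_trans[OF norm_ge_zero b(2)[of 0]] by auto
  have "{0..x} \<subseteq> {0..pi}" using x by auto
  note c' = c[THEN continuous_on_subset, OF this]
  have "norm (integral {0..x} (\<lambda>s. dot (f s) (g s))) \<le> integral {0..x} (\<lambda>_. 2 * A * B)"
  proof (rule integral_norm_bound_integral)
    show "(\<lambda>s. dot (f s) (g s)) integrable_on {0..x}"
      by (intro integrable_continuous_real continuous_intros c')
    fix s assume "s \<in> {0..x}"
    then have "s \<in> {0..pi}" using x by auto
    then have "2 * norm (f s) * norm (g s) \<le> 2 * A * B"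
      using b AB by (intro mult_mono) auto
    then show "norm (dot (f s) (g s)) \<le> 2 * A * B" using norm_dot_le order_trans by blast
  qed auto
  also have "\<dots> = 2 * A * B * x" using x by simp
  also have "\<dots> \<le> 2 * A * B * pi" using x AB by (intro mult_left_mono) auto
  finally show ?thesis .
qed

lemma Y1_fsol: "Y1 z x = fsol z (1,0) x" and Y2_fsol: "Y2 z x = fsol z (0,1) x"
  by (simp_all add: fsol_def prod_eq_iff)

lemma fsol_lipschitz:
  obtains C where "\<And>\<zeta> x. norm (\<zeta> - z) < 1 \<Longrightarrow> x \<in> {0..pi} \<Longrightarrow>
    norm (fsol \<zeta> v x - fsol z v x) \<le> C * norm (\<zeta> - z)"
proof -
  \<comment> \<open>One bound for all parameters in the unit disc around z; hence the summand
    1.\<close>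
  define G where "G = exp ((\<bar>Im z\<bar> + 1 + 4 * qbd) * pi)"
  have G: "norm (fsol \<zeta> u x) \<le> norm u * G" if "norm (\<zeta> - z) < 1" "x \<in> {0..pi}" for \<zeta> u x
  proof -
    have "\<bar>Im \<zeta>\<bar> \<le> \<bar>Im z\<bar> + 1" using abs_Im_le_cmod[of "\<zeta> - z"] that by simp
    then have "norm u * exp ((\<bar>Im \<zeta>\<bar> + 4 * qbd) * pi) \<le> norm u * G"
      unfolding G_def by (intro mult_left_mono) auto
    then show ?thesis using norm_fsol_le[OF that(2), of \<zeta> u] by linarith
  qed
  have "norm (fsol \<zeta> v x - fsol z v x) \<le> (4 * G * (norm v * G) * pi * G) * norm (\<zeta> - z)"
    if z: "norm (\<zeta> - z) < 1" and x: "x \<in> {0..pi}" for \<zeta> x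
  proof -
    have G0: "0 \<le> G" by (simp add: G_def)
    have n1: "norm (1::complex, 0::complex) = 1" "norm (0::complex, 1::complex) = 1"
      by (simp_all add: norm_prod_def)
    have Y: "norm (Y1 z s) \<le> G" "norm (Y2 z s) \<le> G" if "s \<in> {0..pi}" for s
      using G[of z s "(1,0)"] G[of z s "(0,1)"] that unfolding Y1_fsol Y2_fsol n1 by simp_all
    have c: "continuous_on {0..pi} (Y1 z)" "continuous_on {0..pi} (Y2 z)"
      using dsol_continuous hom_Y1 hom_Y2 by blast+
    let ?I1 = "integral {0..x} (\<lambda>s. dot (Y1 z s) (fsol \<zeta> v s))" and ?I2 = "integral {0..x} (\<lambda>s. dot (Y2 z s) (fsol \<zeta> v s))"
    have I: "norm ?I1 \<le> 2 * G * (norm v * G) * pi" "norm ?I2 \<le> 2 * G * (norm v * G) * pi"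
      using norm_integral_dot_le[OF x c(1) continuous_fsol Y(1) G[OF z]]
        norm_integral_dot_le[OF x c(2) continuous_fsol Y(2) G[OF z]] by blast+
    have e: "fsol \<zeta> v x - fsol z v x = cscale (\<zeta> - z) (cscale (- ?I2) (Y1 z x) + cscale ?I1 (Y2 z x))"
      by (subst fsol_diff[OF x, of \<zeta> v z]) (rule add_diff_cancel_left')
    have "norm (cscale (- ?I2) (Y1 z x) + cscale ?I1 (Y2 z x)) \<le> norm ?I2 * norm (Y1 z x) + norm ?I1 * norm (Y2 z x)"
      by (rule order_trans[OF norm_triangle_ineq]) (simp only: norm_cscale norm_minus_cancel order_refl)
    also have "\<dots> \<le> 2 * G * (norm v * G) * pi * G + 2 * G * (norm v * G) * pi * G"
      by (rule add_mono[OF mult_mono[OF I(2) Y(1)[OF x]] mult_mono[OF I(1) Y(2)[OF x]]]) (simp_all add: G0)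
    also have "\<dots> = 4 * G * (norm v * G) * pi * G" by simp
    finally show ?thesis
      unfolding e norm_cscale by (subst mult.commute) (rule mult_right_mono, simp_all)
  qed
  then show thesis by (rule that)
qed

text \<open>Continuity in x at fixed z is combined with the Lipschitz bound in z, which is uniform
  in x.\<close>

lemma continuous_fsol_joint: "continuous_on (UNIV \<times> {0..pi}) (\<lambda>(z, x). fsol z v x)"
  unfolding continuous_on_def
proof
  fix w :: "complex \<times> real" assume "w \<in> UNIV \<times> {0..pi}"
  then obtain z x where w: "w = (z, x)" and x: "x \<in> {0..pi}" by auto
  let ?F = "at w within UNIV \<times> {0..pi}"
  obtain C where C: "\<And>\<zeta> x. norm (\<zeta> - z) < 1 \<Longrightarrow> x \<in> {0..pi} \<Longrightarrow>
    norm (fsol \<zeta> v x - fsol z v x) \<le> C * norm (\<zeta> - z)" using fsol_lipschitz by blast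
  have "continuous_on (UNIV \<times> {0..pi}) (\<lambda>u. fsol z v (snd u))"
    by (rule continuous_on_compose2[OF continuous_fsol]) (auto intro: continuous_intros)
  then have "((\<lambda>u. fsol z v (snd u)) \<longlongrightarrow> fsol z v (snd w)) ?F"
    using \<open>w \<in> UNIV \<times> {0..pi}\<close> unfolding continuous_on_def by blast
  then have 1: "((\<lambda>u. fsol z v (snd u)) \<longlongrightarrow> fsol z v x) ?F" by (simp add: w)
  have t: "((\<lambda>u. fst u - z) \<longlongrightarrow> 0) ?F"
    using tendsto_diff[OF tendsto_fst[OF tendsto_ident_at[of w "UNIV \<times> {0..pi}"]] tendsto_const[of z]] w by simp
  then have "((\<lambda>u. C * norm (fst u - z)) \<longlongrightarrow> 0) ?F"
    by (intro tendsto_mult_right_zero tendsto_norm_zero)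
  moreover have "\<forall>\<^sub>F u in ?F. norm (fsol (fst u) v (snd u) - fsol z v (snd u)) \<le> C * norm (fst u - z)"
  proof -
    have "\<forall>\<^sub>F u in ?F. norm (fst u - z) < 1"
      using tendstoD[OF t, of 1] by (simp add: dist_norm)
    moreover have "\<forall>\<^sub>F u in ?F. u \<in> UNIV \<times> {0..pi}" by (simp add: eventually_at_filter)
    ultimately show ?thesis
    proof eventually_elim
      case (elim u)
      then show ?case by (intro C) auto
    qed
  qed
  ultimately have 2: "((\<lambda>u. fsol (fst u) v (snd u) - fsol z v (snd u)) \<longlongrightarrow> 0) ?F"
    by (rule Lim_null_comparison[rotated])
  from tendsto_add[OF 2 1] show "((\<lambda>(z, x). fsol z v x) \<longlongrightarrow> (case w of (z, x) \<Rightarrow> fsol z v x)) ?F"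
    by (simp add: w case_prod_unfold)
qed

lemma continuous_on_fsol [continuous_intros]:
  assumes "continuous_on A f" "continuous_on A g" "continuous_on A h" "\<And>s. s \<in> A \<Longrightarrow> h s \<in> {0..pi}"
  shows "continuous_on A (\<lambda>s. fsol (f s) (g s) (h s))"
proof -
  have 1: "continuous_on A (\<lambda>s. (f s, h s))" by (intro continuous_intros assms)
  have 2: "(\<lambda>s. (f s, h s)) ` A \<subseteq> UNIV \<times> {0..pi}" using assms by auto
  have "continuous_on A (\<lambda>s. fsol (f s) v (h s))" for v
    using continuous_on_compose2[OF continuous_fsol_joint 1 2, of v] by simp
  then show ?thesis
    unfolding fsol_def[of _ "g _"] Y1_fsol Y2_fsol by (intro continuous_intros assms)
qed

lemma isCont_integral_fsol:
  assumes x: "x \<in> {0..pi}" and w: "continuous_on {0..pi} w"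
  shows "isCont (\<lambda>\<zeta>. integral {0..x} (\<lambda>s. dot (w s) (fsol \<zeta> v s))) z"
proof -
  have "continuous_on (UNIV \<times> cbox 0 x) (\<lambda>u. dot (w (snd u)) (fsol (fst u) v (snd u)))"
    by (intro continuous_intros continuous_on_compose2[OF w]) (use x in auto)
  then have "continuous_on UNIV (\<lambda>\<zeta>. integral (cbox 0 x) (\<lambda>s. dot (w s) (fsol \<zeta> v s)))"
    by (intro integral_continuous_on_param) (simp add: case_prod_unfold)
  then show ?thesis by (simp add: continuous_on_eq_continuous_at)
qed

text \<open>\<open>fsol_diff\<close> writes the difference as \<zeta> - z times a factor that is
  continuous in \<zeta>, which is Caratheodory's form of differentiability.\<close>

lemma holomorphic_fsol:
  assumes x: "x \<in> {0..pi}"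
  shows "(\<lambda>z. fst (fsol z v x)) holomorphic_on S" "(\<lambda>z. snd (fsol z v x)) holomorphic_on S"
proof -
  have c: "continuous_on {0..pi} (Y1 z)" "continuous_on {0..pi} (Y2 z)" for z
    using dsol_continuous hom_Y1 hom_Y2 by blast+
  have "\<exists>D. ((\<lambda>\<zeta>. fst (fsol \<zeta> v x)) has_field_derivative D) (at z)" for z
    unfolding CARAT_DERIV
  proof (intro exI conjI allI)
    let ?g = "\<lambda>\<zeta>. - integral {0..x} (\<lambda>s. dot (Y2 z s) (fsol \<zeta> v s)) * fst (Y1 z x) +
      integral {0..x} (\<lambda>s. dot (Y1 z s) (fsol \<zeta> v s)) * fst (Y2 z x)"
    show "fst (fsol \<zeta> v x) - fst (fsol z v x) = ?g \<zeta> * (\<zeta> - z)" for \<zeta>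
      by (subst fsol_diff[OF x, of \<zeta> v z]) (simp add: mult.commute)
    show "isCont ?g z" by (intro continuous_intros isCont_integral_fsol x c)
  qed (rule refl)
  then show "(\<lambda>z. fst (fsol z v x)) holomorphic_on S"
    unfolding holomorphic_on_def field_differentiable_def using has_field_derivative_at_within by blast
  have "\<exists>D. ((\<lambda>\<zeta>. snd (fsol \<zeta> v x)) has_field_derivative D) (at z)" for z
    unfolding CARAT_DERIV
  proof (intro exI conjI allI)
    let ?g = "\<lambda>\<zeta>. - integral {0..x} (\<lambda>s. dot (Y2 z s) (fsol \<zeta> v s)) * snd (Y1 z x) +
      integral {0..x} (\<lambda>s. dot (Y1 z s) (fsol \<zeta> v s)) * snd (Y2 z x)"
    show "snd (fsol \<zeta> v x) - snd (fsol z v x) = ?g \<zeta> * (\<zeta> - z)" for \<zeta>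
      by (subst fsol_diff[OF x, of \<zeta> v z]) (simp add: mult.commute)
    show "isCont ?g z" by (intro continuous_intros isCont_integral_fsol x c)
  qed (rule refl)
  then show "(\<lambda>z. snd (fsol z v x)) holomorphic_on S"
    unfolding holomorphic_on_def field_differentiable_def using has_field_derivative_at_within by blast
qed

section \<open>Entries, determinant and eigenvectors of the monodromy matrix\<close>

definition m11 :: "complex \<Rightarrow> complex" where "m11 z = fst (Y1 z pi)"
definition m12 :: "complex \<Rightarrow> complex" where "m12 z = fst (Y2 z pi)"
definition m21 :: "complex \<Rightarrow> complex" where "m21 z = snd (Y1 z pi)"
definition m22 :: "complex \<Rightarrow> complex" where "m22 z = snd (Y2 z pi)"

definition hill :: "complex \<Rightarrow> complex" where "hill z = m11 z + m22 z"

lemma fsol_pi: "fsol z v pi = (m11 z * fst v + m12 z * snd v, m21 z * fst v + m22 z * snd v)"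
  by (simp add: fsol_def cscale_def m11_def m12_def m21_def m22_def mult.commute)

lemma det_monodromy: "m11 z * m22 z - m12 z * m21 z = 1"
  using wr_Y1_Y2[of pi z] by (simp add: wr_def m11_def m12_def m21_def m22_def mult.commute)

lemma holomorphic_monodromy [holomorphic_intros]:
  "m11 holomorphic_on S" "m12 holomorphic_on S" "m21 holomorphic_on S" "m22 holomorphic_on S"
  "hill holomorphic_on S"
proof -
  show h: "m11 holomorphic_on S" "m12 holomorphic_on S" "m21 holomorphic_on S" "m22 holomorphic_on S"
    using holomorphic_fsol[of pi "(1,0)" S] holomorphic_fsol[of pi "(0,1)" S]
    by (simp_all add: m11_def[abs_def] m12_def[abs_def] m21_def[abs_def] m22_def[abs_def] Y1_fsol Y2_fsol)
  show "hill holomorphic_on S" unfolding hill_def[abs_def] by (intro holomorphic_intros h)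
qed

text \<open>As the determinant is 1, the characteristic equation divided by \<rho> says that the
  trace is \<rho> + 1/\<rho>.\<close>

lemma monodromy_eigenvector:
  assumes "\<rho> \<noteq> 0"
  shows "(\<exists>v\<noteq>0. fsol z v pi = cscale \<rho> v) \<longleftrightarrow> hill z = \<rho> + inverse \<rho>"
proof -
  define a b c d where "a = m11 z" and "b = m12 z" and "c = m21 z" and "d = m22 z"
  have det: "a * d - b * c = 1" using det_monodromy[of z] by (simp add: a_def b_def c_def d_def)
  have "hill z = \<rho> + inverse \<rho> \<longleftrightarrow> (a - \<rho>) * (d - \<rho>) = b * c"
  proof -
    have "hill z = \<rho> + inverse \<rho> \<longleftrightarrow> \<rho> * (a + d) = \<rho> * (\<rho> + inverse \<rho>)"
      using assms by (simp add: hill_def a_def d_def)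
    also have "\<dots> \<longleftrightarrow> \<rho> * (a + d) = \<rho> * \<rho> + 1" using assms by (simp add: algebra_simps)
    also have "\<dots> \<longleftrightarrow> (a - \<rho>) * (d - \<rho>) = b * c"
      unfolding det[symmetric] by algebra
    finally show ?thesis .
  qed
  moreover have "fsol z v pi = cscale \<rho> v \<longleftrightarrow> (a - \<rho>) * fst v + b * snd v = 0 \<and> c * fst v + (d - \<rho>) * snd v = 0" for v
    unfolding fsol_pi cscale_def a_def b_def c_def d_def by (simp add: algebra_simps)
  moreover have "(\<exists>v\<noteq>0. (a - \<rho>) * fst v + b * snd v = 0 \<and> c * fst v + (d - \<rho>) * snd v = 0) \<longleftrightarrow> (a - \<rho>) * (d - \<rho>) = b * c"
  proof
    assume "\<exists>v\<noteq>0. (a - \<rho>) * fst v + b * snd v = 0 \<and> c * fst v + (d - \<rho>) * snd v = 0"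
    then obtain v1 v2 where v: "v1 \<noteq> 0 \<or> v2 \<noteq> 0" "(a - \<rho>) * v1 + b * v2 = 0" "c * v1 + (d - \<rho>) * v2 = 0"
      by (auto simp: prod_eq_iff)
    have "((a - \<rho>) * (d - \<rho>) - b * c) * v1 = 0" "((a - \<rho>) * (d - \<rho>) - b * c) * v2 = 0"
      using v(2,3) by algebra+
    then show "(a - \<rho>) * (d - \<rho>) = b * c" using v(1) by auto
  next
    assume e: "(a - \<rho>) * (d - \<rho>) = b * c"
    show "\<exists>v\<noteq>0. (a - \<rho>) * fst v + b * snd v = 0 \<and> c * fst v + (d - \<rho>) * snd v = 0"
    \<comment> \<open>A kernel vector is read off the first row of M - \<rho> if that row is
      nonzero, else off the second; if both vanish, any vector serves.\<close>
    proof (cases "b = 0 \<and> a = \<rho>")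
      case False
      then show ?thesis using e
        by (intro exI[of _ "(b, \<rho> - a)"]) (auto simp: zero_prod_def algebra_simps)
    next
      case True
      show ?thesis
      proof (cases "c = 0 \<and> d = \<rho>")
        case False
        then show ?thesis using True
          by (intro exI[of _ "(\<rho> - d, c)"]) (auto simp: zero_prod_def algebra_simps)
      next
        case t: True
        then show ?thesis using True by (intro exI[of _ "(1, 0)"]) (auto simp: zero_prod_def)
      qed
    qed
  qed
  ultimately show ?thesis by simp
qed

text \<open>Differentiating the Wronskian of the solutions from u at z and from v at \<zeta> with
  respect to \<zeta> shows that the integral is \<open>wr u (D v)\<close> / \<rho>, with D the
  derivative of the monodromy matrix. With u and v exchanged it is \<rho> \<open>wr v (D u)\<close>.
  The difference \<open>wr u (D v) - wr v (D u)\<close> is the trace of D times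
  \<open>wr u v\<close>.\<close>

lemma pairing_identity:
  assumes "\<rho> \<noteq> 0" and v: "fsol z v pi = cscale \<rho> v" and u: "fsol z u pi = cscale (inverse \<rho>) u"
  shows "(\<rho> - inverse \<rho>) * integral {0..pi} (\<lambda>x. dot (fsol z u x) (fsol z v x)) = deriv hill z * wr u v"
proof -
  define D where "D = (\<lambda>v. (deriv m11 z * fst v + deriv m12 z * snd v, deriv m21 z * fst v + deriv m22 z * snd v))"
  have d: "(m11 has_field_derivative deriv m11 z) (at z)" "(m12 has_field_derivative deriv m12 z) (at z)"
    "(m21 has_field_derivative deriv m21 z) (at z)" "(m22 has_field_derivative deriv m22 z) (at z)"
    by (intro holomorphic_derivI[OF holomorphic_monodromy(1), of UNIV] holomorphic_derivI[OF holomorphic_monodromy(2), of UNIV]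
       holomorphic_derivI[OF holomorphic_monodromy(3), of UNIV] holomorphic_derivI[OF holomorphic_monodromy(4), of UNIV] open_UNIV UNIV_I)+
  have hill: "deriv hill z = deriv m11 z + deriv m22 z"
    unfolding hill_def[abs_def] using DERIV_add[OF d(1) d(4)] by (rule DERIV_imp_deriv)
  \<comment> \<open>Stated for an arbitrary multiplier \<kappa> of the first vector, because it is
    used for both orders of u and v.\<close>
  have key: "integral {0..pi} (\<lambda>x. dot (fsol z u x) (fsol z v x)) = \<kappa> * wr u (D v)"
    if u: "fsol z u pi = cscale \<kappa> u" for u v \<kappa>
  proof -
    have "((\<lambda>\<zeta>. wr (fsol z u pi) (fsol \<zeta> v pi)) has_field_derivative
       integral {0..pi} (\<lambda>x. dot (fsol z u x) (fsol z v x))) (at z)"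
      unfolding CARAT_DERIV
    proof (intro exI conjI allI)
      let ?g = "\<lambda>\<zeta>. integral {0..pi} (\<lambda>x. dot (fsol z u x) (fsol \<zeta> v x))"
      have L: "wr (fsol z u pi) (fsol \<zeta> v pi) - wr u v = (\<zeta> - z) * ?g \<zeta>" for \<zeta>
      proof -
        have e: "dot w (cscale c u) = c * dot w u" for c u w by (simp add: dot_def algebra_simps)
        have "((\<lambda>x. dot (fsol z u x) (cscale (\<zeta> - z) (fsol \<zeta> v x))) has_integral
            (wr (fsol z u pi) (fsol \<zeta> v pi) - wr (fsol z u 0) (fsol \<zeta> v 0))) {0..pi}"
          by (intro lagrange_identity[OF hom_fsol dsol_fsol_shift] continuous_intros continuous_fsol) auto
        from integral_unique[OF this] show ?thesis by (simp add: e)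
      qed
      show "wr (fsol z u pi) (fsol \<zeta> v pi) - wr (fsol z u pi) (fsol z v pi) = ?g \<zeta> * (\<zeta> - z)" for \<zeta>
        using L[of \<zeta>] L[of z] by (simp add: mult.commute)
      show "isCont ?g z" by (rule isCont_integral_fsol[OF _ continuous_fsol]) simp
    qed (rule refl)
    moreover have "((\<lambda>\<zeta>. wr (fsol z u pi) (fsol \<zeta> v pi)) has_field_derivative wr (fsol z u pi) (D v)) (at z)"
      unfolding fsol_pi[of _ v] wr_def D_def by (auto intro!: derivative_eq_intros d)
    ultimately have "integral {0..pi} (\<lambda>x. dot (fsol z u x) (fsol z v x)) = wr (fsol z u pi) (D v)"
      by (rule DERIV_unique)
    then show ?thesis unfolding u by (simp add: wr_def algebra_simps)
  qed
  let ?I = "integral {0..pi} (\<lambda>x. dot (fsol z u x) (fsol z v x))"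
  have 1: "?I = inverse \<rho> * wr u (D v)" by (rule key[OF u])
  have "integral {0..pi} (\<lambda>x. dot (fsol z v x) (fsol z u x)) = \<rho> * wr v (D u)" by (rule key[OF v])
  then have 2: "?I = \<rho> * wr v (D u)" by (simp add: dot_def mult.commute)
  have "\<rho> * ?I = wr u (D v)" using 1 assms(1) by (simp add: field_simps)
  moreover have "inverse \<rho> * ?I = wr v (D u)" using 2 assms(1) by (simp add: field_simps)
  ultimately have "\<rho> * ?I - inverse \<rho> * ?I = wr u (D v) - wr v (D u)" by simp
  also have "\<dots> = deriv hill z * wr u v" unfolding hill by (simp add: wr_def D_def algebra_simps)
  finally show ?thesis by (simp add: left_diff_distrib)
qed

lemma wr_eigenvectors_nonzero:
  assumes "\<rho> \<noteq> \<sigma>" "v \<noteq> 0" "u \<noteq> 0" "fsol z v pi = cscale \<rho> v" "fsol z u pi = cscale \<sigma> u"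
  shows "wr u v \<noteq> 0"
proof
  assume "wr u v = 0"
  then obtain c where c: "v = cscale c u" using wr_eq_0_iff_cscale[OF assms(3)] by blast
  have "cscale \<rho> v = cscale \<sigma> v"
    using assms(4,5) fsol_scale[of z c u pi] unfolding c by (simp add: cscale_def mult_ac)
  then show False using assms(1,2) by (auto simp: cscale_def prod_eq_iff)
qed

end

section \<open>Asymptotics of the discriminant\<close>

text \<open>The modulus of the exponential is exp(2 s Im z), monotone in s. Its maximum is taken
  over [c, b] rather than [c, d], so that the bound is uniform in d, as the oscillation estimate
  demands.\<close>

lemma norm_integral_exp_le:
  fixes z :: complex
  assumes "z \<noteq> 0" "c \<le> d" "d \<le> b"
  shows "norm (integral {c..d} (\<lambda>s. exp (- 2 * \<i> * z * of_real s))) \<le>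
    (if Im z \<ge> 0 then exp (2 * Im z * b) else exp (2 * Im z * c)) / norm z"
    (is "_ \<le> ?m / _")
proof -
  let ?k = "\<lambda>s. exp (- 2 * \<i> * z * of_real s)"
  have "(?k has_integral (?k d / (- 2 * \<i> * z) - ?k c / (- 2 * \<i> * z))) {c..d}"
  proof (rule fundamental_theorem_of_calculus[OF \<open>c \<le> d\<close>])
    fix s :: real
    have "((\<lambda>s. exp (- 2 * \<i> * z * s) / (- 2 * \<i> * z)) has_field_derivative exp (- 2 * \<i> * z * of_real s)) (at (of_real s))"
      using \<open>z \<noteq> 0\<close> by (auto intro!: derivative_eq_intros)
    then show "((\<lambda>s. ?k s / (- 2 * \<i> * z)) has_vector_derivative ?k s) (at s within {c..d})"
      by (rule has_vector_derivative_real_field[THEN has_vector_derivative_at_within])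
  qed
  then have "integral {c..d} ?k = (?k d - ?k c) / (- 2 * \<i> * z)"
    by (simp add: integral_unique diff_divide_distrib)
  then have "norm (integral {c..d} ?k) = norm (?k d - ?k c) / (2 * norm z)"
    by (simp add: norm_divide norm_mult)
  also have "\<dots> \<le> (norm (?k d) + norm (?k c)) / (2 * norm z)"
    by (intro divide_right_mono norm_triangle_ineq4) auto
  also have "\<dots> \<le> (?m + ?m) / (2 * norm z)"
  proof (intro divide_right_mono add_mono)
    have n: "norm (?k s) = exp (2 * Im z * s)" for s by (simp add: norm_exp_eq_Re)
    show "norm (?k d) \<le> ?m" "norm (?k c) \<le> ?m"
      unfolding n using assms by (auto intro: mult_left_mono mult_left_mono_neg)
  qed simp
  also have "\<dots> = ?m / norm z" by simp
  finally show ?thesis .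
qed

text \<open>Without the free phases, a = exp(-izx) w1 and b = exp(izx) w2 satisfy a' = f exp(-2izx)
  b and b' = g exp(izx) w1. Integration by parts with a primitive H of f exp(-2izx) gives (a - H b)'
  = - H g exp(izx) w1, and H carries the factor 1/|z| by the oscillation estimate.\<close>

lemma oscillating_system_asymptotics:
  fixes w1 w2 f g :: "real \<Rightarrow> complex" and z :: complex
  assumes S: "countable S" and f: "piecewise_reg 0 pi S f" and g: "piecewise_reg 0 pi S g"
    and c1: "continuous_on {0..pi} w1" and c2: "continuous_on {0..pi} w2"
    and d1: "\<And>x. x \<in> {0<..<pi} - S \<Longrightarrow> (w1 has_vector_derivative (\<i> * z * w1 x + f x * w2 x)) (at x)"
    and d2: "\<And>x. x \<in> {0<..<pi} - S \<Longrightarrow> (w2 has_vector_derivative (- \<i> * z * w2 x + g x * w1 x)) (at x)"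
    and init: "w1 0 = 1" "w2 0 = 0"
    and w1: "\<And>x. x \<in> {0..pi} \<Longrightarrow> norm (w1 x) \<le> K * exp (\<bar>Im z\<bar> * x)"
    and B: "\<And>x. x \<in> {0..pi} \<Longrightarrow> norm (g x) \<le> B"
    and osc: "\<And>c k K. c \<in> {0..pi} \<Longrightarrow> continuous_on {c..pi} k \<Longrightarrow>
      (\<And>d. d \<in> {c..pi} \<Longrightarrow> norm (integral {c..d} k) \<le> K) \<Longrightarrow>
      norm (integral {c..pi} (\<lambda>x. f x * k x)) \<le> C * K"
    and "z \<noteq> 0" "C \<ge> 0"
  shows "norm (w1 pi - exp (\<i> * z * pi)) \<le> pi * C * B * K * exp (pi * \<bar>Im z\<bar>) / norm z"
proof -
  let ?e = "\<lambda>c x. exp (of_int c * \<i> * z * of_real x)"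
  define y where "y = Im z"
  \<comment> \<open>The primitive that vanishes at pi: together with b 0 = 0 this removes both
    boundary terms, and H x is minus a tail integral, to which \<open>osc\<close> applies.\<close>
  define H where "H = (\<lambda>x. integral {0..x} (\<lambda>s. f s * ?e (-2) s) - integral {0..pi} (\<lambda>s. f s * ?e (-2) s))"
  have BK: "B \<ge> 0" "K \<ge> 0" using order_trans[OF norm_ge_zero B[of 0]] order_trans[OF norm_ge_zero w1[of 0]] by auto
  have ce: "continuous_on A (?e c)" for A c by (intro continuous_intros)
  have de: "(?e c has_vector_derivative (of_int c * \<i> * z) * ?e c x) (at x)" for c x
  proof -
    have "((\<lambda>s. exp (of_int c * \<i> * z * s)) has_field_derivative (of_int c * \<i> * z) * ?e c x) (at (of_real x))"
      by (auto intro!: derivative_eq_intros)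
    then show ?thesis by (rule has_vector_derivative_real_field)
  qed
  have ne: "norm (?e c x) = exp (- of_int c * y * x)" for c x
    by (simp add: norm_exp_eq_Re y_def)
  have reg: "piecewise_reg 0 pi S (\<lambda>s. f s * ?e (-2) s)"
    by (intro piecewise_reg_mult f piecewise_reg_continuous ce)
  have int: "(\<lambda>s. f s * ?e (-2) s) integrable_on {0..pi}"
    using piecewise_reg_integrable[OF reg S] by (rule set_lebesgue_integral_eq_integral)
  have cH: "continuous_on {0..pi} H"
    unfolding H_def by (intro continuous_intros indefinite_integral_continuous_1 int)
  have dH: "(H has_vector_derivative f x * ?e (-2) x) (at x)" if "x \<in> {0<..<pi} - S" for x
    unfolding H_def
    using has_vector_derivative_diff[OF piecewise_reg_integral_derivative[OF reg S that] has_vector_derivative_const]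
    by simp
  define m where "m = (\<lambda>x. if y \<ge> 0 then exp (2 * y * pi) else exp (2 * y * x))"
  have nH: "norm (H x) \<le> C * (m x / norm z)" if x: "x \<in> {0..pi}" for x
  proof -
    have "H x = - integral {x..pi} (\<lambda>s. f s * ?e (-2) s)"
      using Henstock_Kurzweil_Integration.integral_combine[OF _ _ int, of x] x unfolding H_def
      by (simp add: algebra_simps)
    moreover have "norm (integral {x..pi} (\<lambda>s. f s * ?e (-2) s)) \<le> C * (m x / norm z)"
    proof (rule osc[OF x ce])
      fix d assume "d \<in> {x..pi}"
      then show "norm (integral {x..d} (?e (-2))) \<le> m x / norm z"
        using norm_integral_exp_le[OF \<open>z \<noteq> 0\<close>, of x d pi] by (simp add: m_def y_def split: if_splits)
    qed
    ultimately show ?thesis by simp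
  qed
  define a b where "a = (\<lambda>x. ?e (-1) x * w1 x)" and "b = (\<lambda>x. ?e 1 x * w2 x)"
  have ca: "continuous_on {0..pi} a" "continuous_on {0..pi} b"
    unfolding a_def b_def by (intro continuous_intros c1 c2)+
  have ee: "?e 1 x * ?e 1 x = ?e 2 x" "?e (-1) x * ?e (-1) x = ?e (-2) x" "?e (-1) x * ?e 1 x = 1" for x
    by (simp_all add: exp_add[symmetric] algebra_simps)
  have da: "(a has_vector_derivative f x * ?e (-2) x * b x) (at x)"
    and db: "(b has_vector_derivative g x * ?e 1 x * w1 x) (at x)" if x: "x \<in> {0<..<pi} - S" for x
  proof -
    have "(a has_vector_derivative (?e (-1) x * (\<i> * z * w1 x + f x * w2 x) + of_int (-1) * \<i> * z * ?e (-1) x * w1 x)) (at x)"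
      unfolding a_def by (rule has_vector_derivative_mult[OF de d1[OF x]])
    moreover have "?e (-1) x * w2 x = ?e (-2) x * b x"
    proof -
      have "e1 * w = e3 * (e2 * w)" if "e1 * e1 = e3" "e1 * e2 = 1" for e1 e2 e3 w :: complex
      proof -
        have "e3 * (e2 * w) = e1 * (e1 * e2) * w" unfolding that(1)[symmetric] by (simp only: mult_ac)
        then show ?thesis by (simp only: that(2) mult_1_right)
      qed
      from this[OF ee(2,3)] show ?thesis by (simp only: b_def)
    qed
    ultimately show "(a has_vector_derivative f x * ?e (-2) x * b x) (at x)"
      by (elim has_vector_derivative_eq_rhs) (simp add: algebra_simps)
    have "(b has_vector_derivative (?e 1 x * (- \<i> * z * w2 x + g x * w1 x) + of_int 1 * \<i> * z * ?e 1 x * w2 x)) (at x)"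
      unfolding b_def by (rule has_vector_derivative_mult[OF de d2[OF x]])
    then show "(b has_vector_derivative g x * ?e 1 x * w1 x) (at x)"
      by (elim has_vector_derivative_eq_rhs) (simp add: algebra_simps)
  qed
  let ?R = "\<lambda>x. - (H x * (g x * ?e 1 x * w1 x))"
  have "(?R has_integral ((a pi - H pi * b pi) - (a 0 - H 0 * b 0))) {0..pi}"
  proof (rule ftc_countable[OF _ _ S])
    show "continuous_on {0..pi} (\<lambda>x. a x - H x * b x)" by (intro continuous_intros ca cH)
    show "piecewise_reg 0 pi S ?R"
      by (intro piecewise_reg_minus piecewise_reg_mult g) (intro piecewise_reg_continuous cH c1 ce)+
    fix x assume x: "x \<in> {0<..<pi} - S"
    show "((\<lambda>x. a x - H x * b x) has_vector_derivative ?R x) (at x)"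
      by (rule has_vector_derivative_eq_rhs[OF has_vector_derivative_diff[OF da[OF x] has_vector_derivative_mult[OF dH[OF x] db[OF x]]]])
        simp
  qed simp
  moreover have "H pi = 0" "a 0 = 1" "b 0 = 0" by (simp_all add: H_def a_def b_def init)
  ultimately have I: "(?R has_integral (a pi - 1)) {0..pi}" by simp
  \<comment> \<open>The exponentials in the integrand multiply to exp(2 y pi) for y \<ge> 0 and to 1
    for y < 0; the maximum covers both signs.\<close>
  define M where "M = C / norm z * B * K * max 1 (exp (2 * y * pi))"
  have "norm (a pi - 1) \<le> M * measure lborel (cbox 0 pi)"
  proof (rule has_integral_bound[OF _ I[unfolded interval_cbox]])
    show "0 \<le> M" using BK \<open>C \<ge> 0\<close> by (simp add: M_def)
    fix x assume "x \<in> cbox 0 pi"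
    then have x: "x \<in> {0..pi}" by simp
    have "norm (?R x) = norm (H x) * (norm (g x) * exp (- y * x) * norm (w1 x))"
      using ne[of 1 x] by (simp add: norm_mult)
    also have "\<dots> \<le> (C * (m x / norm z)) * (B * exp (- y * x) * (K * exp (\<bar>y\<bar> * x)))"
      using BK \<open>C \<ge> 0\<close> w1[OF x] by (intro mult_mono nH[OF x] B[OF x] mult_nonneg_nonneg) (auto simp: m_def y_def)
    also have "\<dots> = C / norm z * B * K * (m x * (exp (- y * x) * exp (\<bar>y\<bar> * x)))" by simp
    also have "m x * (exp (- y * x) * exp (\<bar>y\<bar> * x)) \<le> max 1 (exp (2 * y * pi))"
      by (auto simp: m_def exp_add[symmetric] abs_if)
    then have "C / norm z * B * K * (m x * (exp (- y * x) * exp (\<bar>y\<bar> * x))) \<le> M"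
      unfolding M_def using BK \<open>C \<ge> 0\<close> by (intro mult_left_mono) auto
    finally show "norm (?R x) \<le> M" .
  qed
  then have a: "norm (a pi - 1) \<le> M * pi" by simp
  have "w1 pi - exp (\<i> * z * pi) = ?e 1 pi * (a pi - 1)"
    using ee(3)[of pi] by (simp add: a_def algebra_simps)
  then have "norm (w1 pi - exp (\<i> * z * pi)) = exp (- y * pi) * norm (a pi - 1)"
    using ne[of 1 pi] by (simp add: norm_mult)
  also have "\<dots> \<le> exp (- y * pi) * (M * pi)" by (intro mult_left_mono a) simp
  also have "\<dots> = pi * C * B * K * (exp (- y * pi) * max 1 (exp (2 * y * pi))) / norm z"
    by (simp add: M_def)
  also have "exp (- y * pi) * max 1 (exp (2 * y * pi)) = exp (pi * \<bar>y\<bar>)"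
    using pi_gt_zero[unfolded not_le[symmetric]] by (auto simp: max_def exp_add[symmetric] abs_if algebra_simps mult_le_0_iff zero_le_mult_iff)
  finally show ?thesis by (simp add: y_def)
qed

context dirac
begin

text \<open>The combinations y1 + s i y2 and y1 - s i y2 diagonalise J, leaving p and q off the
  diagonal. The initial value is the one with components 1 and 0 in these coordinates. Replacing z
  by s z treats both signs at once.\<close>

lemma scattering_asymptotics:
  fixes s :: complex
  assumes s: "s = 1 \<or> s = -1"
  obtains C where "C \<ge> 0" "\<And>z. z \<noteq> 0 \<Longrightarrow>
    norm (fst (fsol z (1/2, - s * \<i> / 2) pi) + s * \<i> * snd (fsol z (1/2, - s * \<i> / 2) pi) - exp (s * \<i> * z * pi))
     \<le> C * exp (pi * \<bar>Im z\<bar>) / norm z"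
proof -
  obtain Cp where Cp: "0 \<le> Cp" "\<And>c k K. c \<in> {0..pi} \<Longrightarrow> continuous_on {c..pi} k \<Longrightarrow>
      (\<And>d. d \<in> {c..pi} \<Longrightarrow> norm (integral {c..d} k) \<le> K) \<Longrightarrow>
      norm (integral {c..pi} (\<lambda>x. p x * k x)) \<le> Cp * K" using bounded_variation_oscillation[OF bv_p] by blast
  obtain Cq where Cq: "0 \<le> Cq" "\<And>c k K. c \<in> {0..pi} \<Longrightarrow> continuous_on {c..pi} k \<Longrightarrow>
      (\<And>d. d \<in> {c..pi} \<Longrightarrow> norm (integral {c..d} k) \<le> K) \<Longrightarrow>
      norm (integral {c..pi} (\<lambda>x. q x * k x)) \<le> Cq * K" using bounded_variation_oscillation[OF bv_q] by blast
  define K where "K = 2 * exp (4 * qbd * pi)"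
  define f g where "f = (\<lambda>x. - (s * \<i>) * p x + q x)" and "g = (\<lambda>x. s * \<i> * p x + q x)"
  have ss: "s * s = 1" "norm s = 1" "s \<noteq> 0" using s by auto
  have "norm (fst (fsol z (1/2, - s * \<i> / 2) pi) + s * \<i> * snd (fsol z (1/2, - s * \<i> / 2) pi) - exp (s * \<i> * z * pi))
     \<le> (pi * (Cp + Cq) * (2 * qbd) * K) * exp (pi * \<bar>Im z\<bar>) / norm z" if "z \<noteq> 0" for z
  proof -
    let ?y = "fsol z (1/2, - s * \<i> / 2)"
    have "norm (fst (?y pi) + s * \<i> * snd (?y pi) - exp (\<i> * (s * z) * pi))
      \<le> pi * (Cp + Cq) * (2 * qbd) * K * exp (pi * \<bar>Im (s * z)\<bar>) / norm (s * z)"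
    proof (rule oscillating_system_asymptotics[OF countable_discont, of f g "\<lambda>x. fst (?y x) + s * \<i> * snd (?y x)"
          "\<lambda>x. fst (?y x) - s * \<i> * snd (?y x)" "s * z" K "2 * qbd" "Cp + Cq"])
      have cr: "piecewise_reg 0 pi discont (\<lambda>x. c)" for c :: complex
        by (intro piecewise_reg_continuous continuous_intros)
      show "piecewise_reg 0 pi discont f" "piecewise_reg 0 pi discont g"
        unfolding f_def g_def by (intro piecewise_reg_add piecewise_reg_mult cr reg_p reg_q)+
      show "continuous_on {0..pi} (\<lambda>x. fst (?y x) + s * \<i> * snd (?y x))"
        "continuous_on {0..pi} (\<lambda>x. fst (?y x) - s * \<i> * snd (?y x))"
        by (intro continuous_intros continuous_fsol)+
      show "fst (?y 0) + s * \<i> * snd (?y 0) = 1" "fst (?y 0) - s * \<i> * snd (?y 0) = 0"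
        using s by auto
      show "s * z \<noteq> 0" using ss that by simp
      show "0 \<le> Cp + Cq" using Cp Cq by simp
      fix x assume x: "x \<in> {0<..<pi} - discont"
      let ?D = "dirac_rhs p q z (\<lambda>_. (0,0)) ?y x"
      have "(?y has_vector_derivative ?D) (at x)"
        using hom_fsol x unfolding dsol_def by blast
      note df = this[THEN bounded_linear.has_vector_derivative[OF bounded_linear_fst]]
        and ds = this[THEN bounded_linear.has_vector_derivative[OF bounded_linear_snd]]
      have D: "fst ?D = - (z * snd (?y x)) + q x * fst (?y x) - p x * snd (?y x)"
        "snd ?D = z * fst (?y x) - p x * fst (?y x) - q x * snd (?y x)"
        by (simp_all add: dirac_rhs_def Jinv_def Qapp_def)
      show "((\<lambda>x. fst (?y x) + s * \<i> * snd (?y x)) has_vector_derivative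
         \<i> * (s * z) * (fst (?y x) + s * \<i> * snd (?y x)) + f x * (fst (?y x) - s * \<i> * snd (?y x))) (at x)"
        by (rule has_vector_derivative_eq_rhs[OF has_vector_derivative_add[OF df has_vector_derivative_mult_right[OF ds]]])
          (simp only: D f_def, use s in \<open>auto simp: algebra_simps\<close>)
      show "((\<lambda>x. fst (?y x) - s * \<i> * snd (?y x)) has_vector_derivative
         - \<i> * (s * z) * (fst (?y x) - s * \<i> * snd (?y x)) + g x * (fst (?y x) + s * \<i> * snd (?y x))) (at x)"
        by (rule has_vector_derivative_eq_rhs[OF has_vector_derivative_diff[OF df has_vector_derivative_mult_right[OF ds]]])
          (simp only: D g_def, use s in \<open>auto simp: algebra_simps\<close>)
    next
      fix x assume x: "x \<in> {0..pi}"
      have "norm (fst (?y x) + s * \<i> * snd (?y x)) \<le> norm (fst (?y x)) + norm (snd (?y x))"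
        using ss by (intro order_trans[OF norm_triangle_ineq]) (simp add: norm_mult)
      also have "\<dots> \<le> 2 * norm (?y x)"
        using norm_fst_le_cvec[of "?y x"] norm_snd_le_cvec[of "?y x"] by simp
      also have "\<dots> \<le> 2 * (norm (?y 0) * exp ((\<bar>Im z\<bar> + 4 * qbd) * x))"
        using hom_growth[OF hom_fsol x] by simp
      also have "\<dots> \<le> 2 * (1 * exp ((\<bar>Im z\<bar> + 4 * qbd) * x))"
      proof -
        have "norm (?y 0) \<le> norm (1/2::complex) + norm (- s * \<i> / 2)" by (simp only: fsol_0 norm_Pair_le)
        then have "norm (?y 0) \<le> 1" using ss by (simp add: norm_mult norm_divide)
        then show ?thesis by (intro mult_left_mono mult_right_mono) auto
      qed
      also have "\<dots> = 2 * exp (4 * qbd * x) * exp (\<bar>Im z\<bar> * x)" by (simp add: exp_add distrib_right)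
      also have "\<dots> \<le> K * exp (\<bar>Im z\<bar> * x)"
        using x qbd_nonneg by (auto simp: K_def intro!: mult_left_mono)
      finally show "norm (fst (?y x) + s * \<i> * snd (?y x)) \<le> K * exp (\<bar>Im (s * z)\<bar> * x)"
        using s by auto
      have "norm (g x) \<le> norm (p x) + norm (q x)"
        unfolding g_def using ss by (intro order_trans[OF norm_triangle_ineq]) (simp add: norm_mult)
      then show "norm (g x) \<le> 2 * qbd" using norm_p_le[OF x] norm_q_le[OF x] by simp
    next
      fix c :: real and k :: "real \<Rightarrow> complex" and K :: real assume c: "c \<in> {0..pi}" "continuous_on {c..pi} k"
        "\<And>d. d \<in> {c..pi} \<Longrightarrow> norm (integral {c..d} k) \<le> K"
      have k: "piecewise_reg c pi discont k" by (rule piecewise_reg_continuous[OF c(2)])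
      have "piecewise_reg c pi discont (\<lambda>x. p x * k x)" "piecewise_reg c pi discont (\<lambda>x. q x * k x)"
        using c by (auto intro!: piecewise_reg_mult k piecewise_reg_subset[OF reg_p] piecewise_reg_subset[OF reg_q])
      note i = this[THEN piecewise_reg_integrable[OF _ countable_discont], THEN set_lebesgue_integral_eq_integral(1)]
      have "((\<lambda>x. - (s * \<i>) * (p x * k x) + q x * k x) has_integral
         (- (s * \<i>) * integral {c..pi} (\<lambda>x. p x * k x) + integral {c..pi} (\<lambda>x. q x * k x))) {c..pi}"
        by (intro has_integral_add has_integral_mult_right integrable_integral i)
      then have "integral {c..pi} (\<lambda>x. f x * k x) =
        - (s * \<i>) * integral {c..pi} (\<lambda>x. p x * k x) + integral {c..pi} (\<lambda>x. q x * k x)"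
        unfolding f_def by (simp add: integral_unique algebra_simps)
      also have "norm \<dots> \<le> norm (integral {c..pi} (\<lambda>x. p x * k x)) + norm (integral {c..pi} (\<lambda>x. q x * k x))"
        using ss by (intro order_trans[OF norm_triangle_ineq]) (simp add: norm_mult)
      also have "\<dots> \<le> Cp * K + Cq * K" by (intro add_mono Cp(2)[OF c] Cq(2)[OF c])
      finally show "norm (integral {c..pi} (\<lambda>x. f x * k x)) \<le> (Cp + Cq) * K" by (simp add: distrib_right)
    qed
    moreover have "exp (\<i> * (s * z) * pi) = exp (s * \<i> * z * pi)" by (simp add: mult_ac)
    moreover have "\<bar>Im (s * z)\<bar> = \<bar>Im z\<bar>" "norm (s * z) = norm z" using s by auto
    ultimately show ?thesis by metis
  qed
  moreover have "0 \<le> pi * (Cp + Cq) * (2 * qbd) * K" using Cp(1) Cq(1) qbd_nonneg by (simp add: K_def)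
  ultimately show thesis using that by blast
qed

text \<open>The trace is computed in the eigenbasis of J, where the diagonal entries are asymptotic
  to exp(i \<pi> z) and exp(-i \<pi> z).\<close>

lemma hill_asymptotics:
  obtains C where "C \<ge> 0" "\<And>z. z \<noteq> 0 \<Longrightarrow> norm (hill z - 2 * cos (of_real pi * z)) \<le> C * exp (pi * \<bar>Im z\<bar>) / norm z"
proof -
  let ?w = "\<lambda>s z. fst (fsol z (1/2, - s * \<i> / 2) pi) + s * \<i> * snd (fsol z (1/2, - s * \<i> / 2) pi)"
  obtain C1 where C1: "C1 \<ge> 0" "\<And>z. z \<noteq> 0 \<Longrightarrow> norm (?w 1 z - exp (1 * \<i> * z * pi)) \<le> C1 * exp (pi * \<bar>Im z\<bar>) / norm z"
    using scattering_asymptotics[of 1] by blast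
  obtain C2 where C2: "C2 \<ge> 0" "\<And>z. z \<noteq> 0 \<Longrightarrow> norm (?w (-1) z - exp (-1 * \<i> * z * pi)) \<le> C2 * exp (pi * \<bar>Im z\<bar>) / norm z"
    using scattering_asymptotics[of "-1"] by blast
  have "norm (hill z - 2 * cos (of_real pi * z)) \<le> (C1 + C2) * exp (pi * \<bar>Im z\<bar>) / norm z" if "z \<noteq> 0" for z
  proof -
    have "hill z = ?w 1 z + ?w (-1) z"
      unfolding fsol_pi hill_def by (simp add: field_simps)
    moreover have "2 * cos (of_real pi * z) = exp (1 * \<i> * z * pi) + exp (-1 * \<i> * z * pi)"
      by (simp add: cos_exp_eq mult_ac)
    ultimately have "hill z - 2 * cos (of_real pi * z) = (?w 1 z - exp (1 * \<i> * z * pi)) + (?w (-1) z - exp (-1 * \<i> * z * pi))"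
      by (simp only:) (simp add: algebra_simps)
    then have "norm (hill z - 2 * cos (of_real pi * z)) \<le> norm (?w 1 z - exp (1 * \<i> * z * pi)) + norm (?w (-1) z - exp (-1 * \<i> * z * pi))"
      by (simp only: norm_triangle_ineq)
    also have "\<dots> \<le> C1 * exp (pi * \<bar>Im z\<bar>) / norm z + C2 * exp (pi * \<bar>Im z\<bar>) / norm z"
      by (intro add_mono C1(2)[OF that] C2(2)[OF that])
    also have "\<dots> = (C1 + C2) * exp (pi * \<bar>Im z\<bar>) / norm z" by (simp add: distrib_right add_divide_distrib)
    finally show ?thesis .
  qed
  then show thesis using C1(1) C2(1) by (intro that[of "C1 + C2"]) auto
qed

end

section \<open>Multiplicity of eigenvalues\<close>

lemma lin_indep_onD:
  assumes "lin_indep_on m fs" "\<forall>x\<in>{0..pi}. (\<Sum>i<m. cscale (c i) (fs i x)) = (0,0)" "i < m"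
  shows "c i = 0"
  using assms unfolding lin_indep_on_def by (metis (no_types))

lemma dirac_eq_cong:
  assumes "\<And>x. x \<in> {0..pi} \<Longrightarrow> f x = g x"
  shows "dirac_eq p q z f y \<longleftrightarrow> dirac_eq p q z g y"
proof -
  have eq: "dirac_rhs p q z f y s = dirac_rhs p q z g y s" if "s \<in> {0..pi}" for s
    using assms[OF that] by (simp add: dirac_rhs_def)
  have "dirac_rhs p q z f y integrable_on {0..x} \<longleftrightarrow> dirac_rhs p q z g y integrable_on {0..x}"
    "integral {0..x} (dirac_rhs p q z f y) = integral {0..x} (dirac_rhs p q z g y)" if "x \<in> {0..pi}" for x
    using that by (auto intro!: integrable_cong Henstock_Kurzweil_Integration.integral_cong eq)
  then show ?thesis by (simp add: dirac_eq_def)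
qed

lemma sq_int_continuous:
  assumes "continuous_on {0..pi} f"
  shows "sq_int f"
  unfolding sq_int_def
proof
  show "f \<in> borel_measurable (lebesgue_on {0..pi})"
    by (rule continuous_imp_measurable_on_sets_lebesgue[OF assms]) simp
  show "integrable (lebesgue_on {0..pi}) (\<lambda>x. (norm (f x))\<^sup>2)"
    by (intro continuous_imp_integrable_real continuous_intros assms)
qed

definition floquet :: "complex \<Rightarrow> complex" where
  "floquet t = exp (\<i> * of_real pi * t)"

lemma floquet_nonzero [simp]: "floquet t \<noteq> 0"
  by (simp add: floquet_def)

lemma bc_floquet: "bc t y \<longleftrightarrow> y pi = cscale (floquet t) (y 0)"
  by (simp add: bc_def floquet_def)

lemma inverse_floquet: "inverse (floquet t) = floquet (- t)"
  by (simp add: floquet_def exp_minus)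

lemma floquet_sum: "floquet t + inverse (floquet t) = 2 * cos (of_real pi * t)"
  by (simp add: floquet_def cos_exp_eq exp_minus mult_ac)

lemma floquet_diff: "floquet t - inverse (floquet t) = 2 * \<i> * sin (of_real pi * t)"
  by (simp add: floquet_def sin_exp_eq exp_minus mult_ac)

context dirac
begin

lemma opeq_iff_dsol:
  assumes "continuous_on {0..pi} f"
  shows "opeq p q t z f y \<longleftrightarrow> dsol z f y \<and> bc t y"
  using sq_int_continuous[OF assms] by (simp add: opeq_def dirac_eq_iff_dsol[OF assms])

text \<open>Right-hand sides in a root chain are known only on [0, pi]; this replaces them by a
  solution formula.\<close>

lemma opeq_cong:
  assumes "opeq p q t z f y" "\<And>x. x \<in> {0..pi} \<Longrightarrow> f x = g x" "continuous_on {0..pi} g"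
  shows "dsol z g y \<and> bc t y"
  using assms(1) dirac_eq_cong[of f g p q z y] assms(2) unfolding opeq_def
  by (simp add: dirac_eq_iff_dsol[OF assms(3)])

lemma opeq_hom_iff: "opeq p q t z (\<lambda>_. (0,0)) y \<longleftrightarrow> hom z y \<and> bc t y"
  by (rule opeq_iff_dsol) (rule continuous_on_const)

lemma eigfun_expansion:
  assumes "eigfun p q t z y"
  obtains v where "v \<noteq> 0" "fsol z v pi = cscale (floquet t) v" "\<And>x. x \<in> {0..pi} \<Longrightarrow> y x = fsol z v x"
proof -
  have y: "hom z y" "bc t y" "\<exists>x\<in>{0..pi}. y x \<noteq> 0"
    using assms unfolding eigfun_def opeq_hom_iff zero_prod_def by auto
  have e: "y x = fsol z (y 0) x" if "x \<in> {0..pi}" for x by (rule hom_unique[OF y(1) that])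
  have "y 0 \<noteq> 0"
  proof
    assume "y 0 = 0"
    then have "y x = 0" if "x \<in> {0..pi}" for x
      using e[OF that] by (simp add: fsol_def prod_eq_iff)
    then show False using y(3) by blast
  qed
  moreover have "fsol z (y 0) pi = cscale (floquet t) (y 0)"
    using e[of pi] y(2) by (simp add: bc_floquet)
  ultimately show thesis using e that by blast
qed

lemma eigfun_fsol:
  assumes "v \<noteq> 0" "fsol z v pi = cscale (floquet t) v"
  shows "eigfun p q t z (fsol z v)"
  unfolding eigfun_def opeq_hom_iff
  using assms hom_fsol[of z v] by (auto simp: bc_floquet zero_prod_def intro!: bexI[of _ 0])

lemma eigenvalue_iff_hill: "eigenvalue p q t z \<longleftrightarrow> hill z = 2 * cos (of_real pi * t)"
proof -
  have "eigenvalue p q t z \<longleftrightarrow> (\<exists>v\<noteq>0. fsol z v pi = cscale (floquet t) v)"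
    unfolding eigenvalue_def using eigfun_expansion eigfun_fsol by metis
  then show ?thesis using monodromy_eigenvector[of "floquet t" z] floquet_sum[of t] by simp
qed

lemma floquet_eigenvectors:
  assumes "hill z = 2 * cos (of_real pi * t)"
  obtains v u where "v \<noteq> 0" "fsol z v pi = cscale (floquet t) v"
    "u \<noteq> 0" "fsol z u pi = cscale (inverse (floquet t)) u"
  using assms monodromy_eigenvector[of "floquet t" z] monodromy_eigenvector[of "inverse (floquet t)" z]
    floquet_sum[of t] by (auto simp: add.commute)

text \<open>The Wronskian of two solutions with multiplier \<rho> is constant, yet it is multiplied
  by \<rho>^2 over a period; as \<rho>^2 \<noteq> 1, it vanishes.\<close>

lemma floquet_eigenvector_unique:
  assumes "sin (of_real pi * t) \<noteq> 0" "v \<noteq> 0" "fsol z v pi = cscale (floquet t) v" "fsol z w pi = cscale (floquet t) w"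
  obtains c where "w = cscale c v"
proof -
  have "wr (fsol z v pi) (fsol z w pi) = wr v w"
    using wr_hom_const[OF hom_fsol hom_fsol, of pi z v w] by simp
  then have "floquet t * floquet t * wr v w = wr v w"
    unfolding assms(3,4) by (simp add: wr_def algebra_simps)
  moreover have "floquet t * floquet t \<noteq> 1"
  proof
    assume "floquet t * floquet t = 1"
    then have "floquet t = inverse (floquet t)" by (metis inverse_unique)
    then show False using floquet_diff[of t] assms(1) by simp
  qed
  ultimately have "wr v w = 0" by (metis mult_cancel_right1)
  then show thesis using wr_eq_0_iff_cscale[OF assms(2)] that by blast
qed

text \<open>A solvability condition: if the image of y is c times the eigenfunction of v, pairing
  with the solution of u to the inverse multiplier leaves c times the pairing integral equal to
  zero. That integral is nonzero by \<open>pairing_identity\<close>, so c = 0 and y is an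
  eigenfunction itself.\<close>

lemma root_space_simple:
  assumes sin: "sin (of_real pi * t) \<noteq> 0" and hill: "hill z = 2 * cos (of_real pi * t)" and d: "deriv hill z \<noteq> 0"
    and v: "v \<noteq> 0" "fsol z v pi = cscale (floquet t) v"
  shows "in_ker_pow p q t z k y \<Longrightarrow> \<exists>c. \<forall>x\<in>{0..pi}. y x = cscale c (fsol z v x)"
proof (induction k arbitrary: y)
  case 0
  then show ?case by (intro exI[of _ 0]) (auto simp: cscale_def)
next
  case (Suc k)
  from Suc.prems obtain g where g: "opeq p q t z g y" and gk: "in_ker_pow p q t z k g" by auto
  from Suc.IH[OF gk] obtain c where c: "\<And>x. x \<in> {0..pi} \<Longrightarrow> g x = cscale c (fsol z v x)" by blast
  obtain u where u: "u \<noteq> 0" "fsol z u pi = cscale (inverse (floquet t)) u"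
    using floquet_eigenvectors[OF hill] by blast
  have ne: "floquet t \<noteq> inverse (floquet t)" using floquet_diff[of t] sin by auto
  have cont: "continuous_on {0..pi} (\<lambda>x. cscale c (fsol z v x))" by (intro continuous_intros continuous_fsol)
  have y: "dsol z (\<lambda>x. cscale c (fsol z v x)) y" "bc t y" using opeq_cong[OF g c cont] by blast+
  have e: "dot w (cscale c s) = c * dot w s" for s w by (simp add: dot_def algebra_simps)
  \<comment> \<open>The multipliers of u and y are inverse to each other, so the boundary terms of
    the Lagrange identity cancel.\<close>
  have "wr (fsol z u pi) (y pi) = (inverse (floquet t) * floquet t) * wr u (y 0)"
  proof -
    have "wr (cscale a u) (cscale b w) = (a * b) * wr u w" for a b w
      by (simp add: wr_def algebra_simps)
    then show ?thesis using y(2) unfolding u(2) bc_floquet by simp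
  qed
  then have "wr (fsol z u pi) (y pi) - wr (fsol z u 0) (y 0) = 0" by simp
  moreover have "((\<lambda>x. dot (fsol z u x) (cscale c (fsol z v x))) has_integral
      (wr (fsol z u pi) (y pi) - wr (fsol z u 0) (y 0))) {0..pi}"
    by (rule lagrange_identity[OF hom_fsol y(1) cont]) auto
  ultimately have "((\<lambda>x. c * dot (fsol z u x) (fsol z v x)) has_integral 0) {0..pi}"
    by (simp only: e)
  then have "integral {0..pi} (\<lambda>x. c * dot (fsol z u x) (fsol z v x)) = 0" by (rule integral_unique)
  then have "c * integral {0..pi} (\<lambda>x. dot (fsol z u x) (fsol z v x)) = 0" by simp
  moreover have "integral {0..pi} (\<lambda>x. dot (fsol z u x) (fsol z v x)) \<noteq> 0"
  proof
    assume I: "integral {0..pi} (\<lambda>x. dot (fsol z u x) (fsol z v x)) = 0"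
    have "deriv hill z * wr u v = 0"
      using pairing_identity[OF floquet_nonzero v(2) u(2)] unfolding I by simp
    then show False using d wr_eigenvectors_nonzero[OF ne v(1) u(1) v(2) u(2)] by simp
  qed
  ultimately have "c = 0" by simp
  then have "hom z y" using dsol_cong[OF y(1), of "\<lambda>_. (0,0)" y] by (simp add: cscale_def)
  then have e: "y x = fsol z (y 0) x" if "x \<in> {0..pi}" for x using that by (rule hom_unique)
  have "fsol z (y 0) pi = cscale (floquet t) (y 0)" using e[of pi] y(2) by (simp add: bc_floquet)
  then obtain a where a: "y 0 = cscale a v" using floquet_eigenvector_unique[OF sin v] by blast
  have "\<forall>x\<in>{0..pi}. y x = cscale a (fsol z v x)"
  proof
    fix x assume "x \<in> {0..pi}"
    from e[OF this] show "y x = cscale a (fsol z v x)" unfolding a fsol_scale .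
  qed
  then show ?case ..
qed

lemma alg_mult_simple:
  assumes sin: "sin (of_real pi * t) \<noteq> 0" and hill: "hill z = 2 * cos (of_real pi * t)" and d: "deriv hill z \<noteq> 0"
  shows "alg_mult p q t z = 1"
proof (rule antisym)
  obtain v where v: "v \<noteq> 0" "fsol z v pi = cscale (floquet t) v"
    using floquet_eigenvectors[OF hill] by blast
  let ?S = "{m. \<exists>fs. (\<forall>i<m. \<exists>k. in_ker_pow p q t z k (fs i)) \<and> lin_indep_on m fs}"
  show "alg_mult p q t z \<le> 1"
    unfolding alg_mult_def
  proof (rule SUP_least)
    fix m assume "m \<in> ?S"
    then obtain fs where fs: "\<And>i. i < m \<Longrightarrow> \<exists>k. in_ker_pow p q t z k (fs i)" and li: "lin_indep_on m fs" by blast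
    have "m \<le> 1"
    proof (rule ccontr)
      assume "\<not> m \<le> 1"
      then have m: "0 < m" "1 < m" by auto
      obtain a where a: "\<forall>x\<in>{0..pi}. fs 0 x = cscale a (fsol z v x)"
        using fs[OF m(1)] root_space_simple[OF sin hill d v] by blast
      obtain b where b: "\<forall>x\<in>{0..pi}. fs 1 x = cscale b (fsol z v x)"
        using fs[OF m(2)] root_space_simple[OF sin hill d v] by blast
      have key: "c0 = 0 \<and> c1 = 0" if "c0 * a + c1 * b = 0" for c0 c1
      proof -
        let ?c = "\<lambda>i::nat. if i = 0 then c0 else if i = 1 then c1 else 0"
        have "(\<Sum>i<m. cscale (?c i) (fs i x)) = (0,0)" if "x \<in> {0..pi}" for x
        proof -
          have "(\<Sum>i<m. cscale (?c i) (fs i x)) = (\<Sum>i\<in>{0,1}. cscale (?c i) (fs i x))"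
            using m by (intro sum.mono_neutral_right) (auto simp: cscale_def zero_prod_def)
          also have "\<dots> = cscale (c0 * a + c1 * b) (fsol z v x)"
            using a b that by (simp add: cscale_def algebra_simps)
          finally show ?thesis using \<open>c0 * a + c1 * b = 0\<close> by (simp add: cscale_def)
        qed
        then have *: "\<forall>x\<in>{0..pi}. (\<Sum>i<m. cscale (?c i) (fs i x)) = (0,0)" by blast
        show ?thesis using lin_indep_onD[OF li * m(1)] lin_indep_onD[OF li * m(2)] by simp
      qed
      \<comment> \<open>The relation with coefficients b and -a is trivially satisfied, so
        independence makes both vanish; then the function with index 0 is zero, a
        contradiction.\<close>
      have "b = 0" "a = 0" using key[of b "- a"] by (auto simp: mult.commute)
      then show False using key[of 1 0] by simp
    qed
    then show "enat m \<le> 1" by (simp add: one_enat_def)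
  qed
  have "in_ker_pow p q t z 1 (fsol z v)"
    using eigfun_fsol[OF v] by (auto simp: eigfun_def intro!: exI[of _ "\<lambda>_. (0,0)"])
  moreover have "lin_indep_on 1 (\<lambda>_. fsol z v)"
    unfolding lin_indep_on_def
  proof (intro allI impI)
    fix c :: "nat \<Rightarrow> complex" and i :: nat
    assume "\<forall>x\<in>{0..pi}. (\<Sum>i<1. cscale (c i) (fsol z v x)) = (0,0)" "i < 1"
    from bspec[OF this(1), of 0] this(2) show "c i = 0" using v(1) by (auto simp: cscale_def prod_eq_iff)
  qed
  ultimately have "(\<forall>i<(1::nat). \<exists>k. in_ker_pow p q t z k (fsol z v)) \<and> lin_indep_on 1 (\<lambda>_. fsol z v)" by blast
  then have "1 \<in> ?S" by (intro CollectI exI[of _ "\<lambda>_. fsol z v"])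
  then show "1 \<le> alg_mult p q t z"
    unfolding alg_mult_def by (rule SUP_upper2) (simp add: one_enat_def)
qed

text \<open>The last nonzero function in a root chain is an eigenfunction.\<close>

lemma ker_pow_eigenvalue:
  "in_ker_pow p q t z k y \<Longrightarrow> \<exists>x\<in>{0..pi}. y x \<noteq> (0,0) \<Longrightarrow> eigenvalue p q t z"
proof (induction k arbitrary: y)
  case (Suc k)
  then obtain g where g: "opeq p q t z g y" "in_ker_pow p q t z k g" by auto
  show ?case
  proof (cases "\<exists>x\<in>{0..pi}. g x \<noteq> (0,0)")
    case True
    then show ?thesis using Suc.IH g by blast
  next
    case False
    then have "hom z y \<and> bc t y" by (intro opeq_cong[OF g(1)]) auto
    then show ?thesis using Suc.prems(2) unfolding eigenvalue_def eigfun_def opeq_hom_iff by blast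
  qed
qed simp

lemma alg_mult_eigenvalue:
  assumes "alg_mult p q t z \<noteq> 0"
  shows "eigenvalue p q t z"
proof -
  obtain m fs where m: "m \<noteq> 0" and fs: "\<forall>i<m. \<exists>k. in_ker_pow p q t z k (fs i)" "lin_indep_on m fs"
  proof (rule ccontr)
    assume "\<not> thesis"
    then have "alg_mult p q t z \<le> 0"
      unfolding alg_mult_def using that by (intro SUP_least) (auto simp: zero_enat_def)
    then show False using assms by simp
  qed
  have "\<exists>x\<in>{0..pi}. fs 0 x \<noteq> (0,0)"
  proof (rule ccontr)
    assume z: "\<not> (\<exists>x\<in>{0..pi}. fs 0 x \<noteq> (0,0))"
    let ?c = "\<lambda>i::nat. if i = 0 then 1 else 0 :: complex"
    have "\<forall>x\<in>{0..pi}. (\<Sum>i<m. cscale (?c i) (fs i x)) = (0,0)"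
      using z unfolding zero_prod_def[symmetric]
      by (intro ballI sum.neutral) (auto simp: cscale_def zero_prod_def)
    then have "?c 0 = 0" by (rule lin_indep_onD[OF fs(2)]) (use m in simp)
    then show False by simp
  qed
  then show ?thesis using fs(1) m ker_pow_eigenvalue by blast
qed

lemma multiple_eigenvalue_deriv:
  assumes "sin (of_real pi * t) \<noteq> 0" "multiple_eigenvalue p q t z"
  shows "hill z = 2 * cos (of_real pi * t)" "deriv hill z = 0"
proof -
  show h: "hill z = 2 * cos (of_real pi * t)"
    using assms(2) by (simp add: multiple_eigenvalue_def eigenvalue_iff_hill)
  show "deriv hill z = 0"
  proof (rule ccontr)
    assume "deriv hill z \<noteq> 0"
    then have "alg_mult p q t z = 1" by (rule alg_mult_simple[OF assms(1) h])
    then show False using assms(2) by (simp add: multiple_eigenvalue_def one_enat_def numeral_eq_enat)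
  qed
qed

end

section \<open>Riesz integrals\<close>

text \<open>Dividing the zero out of k leaves a nonvanishing holomorphic factor with value k' a at
  a, and Cauchy's formula applies.\<close>

lemma contour_integral_simple_zero:
  assumes h: "h holomorphic_on ball a r" and k: "k holomorphic_on ball a r"
    and "k a = 0" "deriv k a \<noteq> 0" and nz: "\<And>z. z \<in> ball a r \<Longrightarrow> z \<noteq> a \<Longrightarrow> k z \<noteq> 0"
    and s: "0 < s" "s < r"
  shows "contour_integral (circlepath a s) (\<lambda>z. h z / k z) = of_real (2 * pi) * \<i> * (h a / deriv k a)"
proof -
  have ain: "a \<in> ball a r" using s by simp
  define k2 where "k2 = (\<lambda>z. if z = a then deriv k a else (k z - k a) / (z - a))"
  have k2: "k2 holomorphic_on ball a r" unfolding k2_def by (rule pole_lemma[OF k]) (use s in simp)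
  have k2nz: "k2 z \<noteq> 0" if "z \<in> ball a r" for z using assms that by (simp add: k2_def)
  have sub: "cball a s \<subseteq> ball a r" using s by auto
  have "(\<lambda>z. h z / k2 z) holomorphic_on ball a r" by (intro holomorphic_on_divide h k2 k2nz)
  then have "(\<lambda>z. h z / k2 z) holomorphic_on cball a s" using sub by (rule holomorphic_on_subset)
  then have "((\<lambda>z. (h z / k2 z) / (z - a)) has_contour_integral 2 * of_real pi * \<i> * (h a / k2 a)) (circlepath a s)"
    using s by (intro Cauchy_integral_circlepath_simple) auto
  moreover have "(h z / k2 z) / (z - a) = h z / k z" if "z \<in> path_image (circlepath a s)" for z
  proof -
    have "z \<noteq> a" using that s by (auto simp: path_image_circlepath)
    then show ?thesis using \<open>k a = 0\<close> by (simp add: k2_def)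
  qed
  ultimately have "((\<lambda>z. h z / k z) has_contour_integral 2 * of_real pi * \<i> * (h a / k2 a)) (circlepath a s)"
    by (rule has_contour_integral_eq)
  then show ?thesis by (simp add: contour_integral_unique k2_def)
qed

lemma l2norm_ge:
  assumes "0 \<le> a" and ge: "\<And>x. x \<in> {0..pi} \<Longrightarrow> a \<le> norm (g x)"
  shows "ennreal (a * sqrt pi) \<le> l2norm g"
proof (cases "l2sq g = \<infinity>")
  case False
  have "ennreal (a\<^sup>2) * ennreal pi = (\<integral>\<^sup>+x. ennreal (a\<^sup>2) \<partial>lebesgue_on {0..pi})"
    by (simp add: emeasure_restrict_space)
  also have "\<dots> \<le> l2sq g"
    unfolding l2sq_def
  proof (rule nn_integral_mono)
    fix x assume "x \<in> space (lebesgue_on {0..pi})"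
    then have "x \<in> {0..pi}" by simp
    from ge[OF this] show "ennreal (a\<^sup>2) \<le> ennreal ((norm (g x))\<^sup>2)"
      using assms(1) by (intro ennreal_leI power_mono)
  qed
  finally have "ennreal (a\<^sup>2 * pi) \<le> l2sq g" by (simp add: ennreal_mult)
  then have "a\<^sup>2 * pi \<le> enn2real (l2sq g)"
    using False by (metis enn2real_ennreal enn2real_mono infinity_ennreal_def less_top mult_nonneg_nonneg pi_ge_zero zero_le_power2)
  then have "sqrt (a\<^sup>2 * pi) \<le> sqrt (enn2real (l2sq g))" by (rule real_sqrt_le_mono)
  moreover have "sqrt (a\<^sup>2 * pi) = a * sqrt pi" using assms(1) by (simp add: real_sqrt_mult)
  ultimately show ?thesis using False by (simp add: l2norm_def)
qed (simp add: l2norm_def)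

lemma l2norm_le_1:
  assumes "0 \<le> a" "a\<^sup>2 * pi \<le> 1" and le: "\<And>x. x \<in> {0..pi} \<Longrightarrow> norm (g x) \<le> a"
  shows "l2norm g \<le> 1"
proof -
  have "l2sq g \<le> (\<integral>\<^sup>+x. ennreal (a\<^sup>2) \<partial>lebesgue_on {0..pi})"
    unfolding l2sq_def
  proof (rule nn_integral_mono)
    fix x assume "x \<in> space (lebesgue_on {0..pi})"
    then have "x \<in> {0..pi}" by simp
    from le[OF this] show "ennreal ((norm (g x))\<^sup>2) \<le> ennreal (a\<^sup>2)"
      using assms(1) by (intro ennreal_leI power_mono) auto
  qed
  also have "\<dots> = ennreal (a\<^sup>2 * pi)"
    by (simp add: emeasure_restrict_space ennreal_mult)
  also have "\<dots> \<le> 1" using assms(2) by (simp add: ennreal_le_1)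
  finally have l: "l2sq g \<le> 1" .
  then have "l2sq g \<noteq> \<infinity>" by (auto simp: top_unique)
  moreover have "enn2real (l2sq g) \<le> 1" using l enn2real_mono[of "l2sq g" 1] by simp
  ultimately show ?thesis by (simp add: l2norm_def ennreal_le_1)
qed

section \<open>Resolvent and Riesz integral on test functions\<close>

context dirac
begin

text \<open>The adjugate of \<rho> - M(z), applied to v. It acts as the inverse in the resolvent
  while staying entire in z; the pole sits in the determinant, which \<open>floquet_det\<close>
  factors.\<close>

definition adj :: "complex \<Rightarrow> complex \<Rightarrow> cvec \<Rightarrow> cvec" where
  "adj \<rho> z v = ((\<rho> - m22 z) * fst v + m12 z * snd v, m21 z * fst v + (\<rho> - m11 z) * snd v)"

lemma fsol_adj:
  "fsol z (adj \<rho> z b) pi = cscale \<rho> (adj \<rho> z b) - cscale (\<rho>\<^sup>2 - \<rho> * hill z + 1) b"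
proof -
  have e: "\<rho>\<^sup>2 - \<rho> * hill z + 1 = \<rho>\<^sup>2 - \<rho> * (m11 z + m22 z) + (m11 z * m22 z - m12 z * m21 z)"
    by (simp add: det_monodromy hill_def)
  show ?thesis
    unfolding e by (simp add: fsol_pi adj_def prod_eq_iff power2_eq_square algebra_simps)
qed

lemma adj_scale: "adj \<rho> z (cscale c v) = cscale c (adj \<rho> z v)"
  by (simp add: adj_def prod_eq_iff algebra_simps)

lemma floquet_det:
  "(floquet t)\<^sup>2 - floquet t * hill z + 1 = floquet t * (2 * cos (of_real pi * t) - hill z)"
  unfolding floquet_sum[symmetric] by (simp add: power2_eq_square algebra_simps)

text \<open>Constant Wronskians with the two basis solutions return the components of v, so the
  growth of the basis bounds every solution from below.\<close>

lemma norm_fsol_ge: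
  assumes "x \<in> {0..pi}"
  shows "norm v \<le> 4 * exp ((\<bar>Im z\<bar> + 4 * qbd) * pi) * norm (fsol z v x)"
proof -
  define G where "G = exp ((\<bar>Im z\<bar> + 4 * qbd) * pi)"
  have "fst v = wr (fsol z v x) (fsol z (0,1) x)" "snd v = wr (fsol z (1,0) x) (fsol z v x)"
    using wr_hom_const[OF hom_fsol hom_fsol assms] by (simp_all add: wr_def)
  moreover have "norm (fsol z (0,1) x) \<le> G" "norm (fsol z (1,0) x) \<le> G"
    using norm_fsol_le[OF assms, of z "(0,1)"] norm_fsol_le[OF assms, of z "(1,0)"]
    by (simp_all add: norm_prod_def G_def)
  then have "2 * norm (fsol z v x) * norm (fsol z (0,1) x) \<le> 2 * norm (fsol z v x) * G"
    "2 * norm (fsol z (1,0) x) * norm (fsol z v x) \<le> 2 * G * norm (fsol z v x)"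
    by (auto intro: mult_left_mono mult_right_mono)
  ultimately have "norm (fst v) \<le> 2 * G * norm (fsol z v x)" "norm (snd v) \<le> 2 * G * norm (fsol z v x)"
    using order_trans[OF norm_wr_le[of "fsol z v x" "fsol z (0,1) x"]] order_trans[OF norm_wr_le[of "fsol z (1,0) x" "fsol z v x"]]
    by (simp_all only: mult_ac)
  moreover have "norm v \<le> norm (fst v) + norm (snd v)" using norm_Pair_le[of "fst v" "snd v"] by simp
  ultimately show ?thesis unfolding G_def by linarith
qed

text \<open>The differential expression minus z multiplies \<open>fsol \<mu> w\<close> by \<mu> - z,
  so dividing by this number gives a particular solution. A homogeneous solution built with the
  adjugate repairs the boundary condition, and brings the determinant into the denominator.\<close>

lemma resolv_fsol:
  assumes ne: "hill z \<noteq> 2 * cos (of_real pi * t)" and "z \<noteq> \<mu>" and x: "x \<in> {0..pi}"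
  defines "\<rho> \<equiv> floquet t"
  shows "resolv p q t z (fsol \<mu> w) x = cscale (1 / (\<mu> - z)) (fsol \<mu> w x) +
    cscale (1 / ((\<mu> - z) * \<rho> * (2 * cos (of_real pi * t) - hill z))) (fsol z (adj \<rho> z (fsol \<mu> w pi - cscale \<rho> w)) x)"
proof -
  define \<delta> where "\<delta> = (\<mu> - z) * \<rho> * (2 * cos (of_real pi * t) - hill z)"
  have d0: "\<delta> \<noteq> 0" "\<mu> - z \<noteq> 0" using assms by (auto simp: \<delta>_def)
  define b where "b = fsol \<mu> w pi - cscale \<rho> w"
  define y where "y = (\<lambda>x. cscale (1 / (\<mu> - z)) (fsol \<mu> w x) + cscale (1 / \<delta>) (fsol z (adj \<rho> z b) x))"
  have "dsol z (\<lambda>x. cscale (1 / (\<mu> - z)) (cscale (\<mu> - z) (fsol \<mu> w x)) + cscale (1 / \<delta>) (0,0)) y"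
    unfolding y_def by (rule dsol_linear[OF dsol_fsol_shift hom_fsol])
  moreover have "cscale (1 / (\<mu> - z)) (cscale (\<mu> - z) v) + cscale (1 / \<delta>) (0,0) = v" for v
    using d0 by (simp add: prod_eq_iff)
  ultimately have y: "dsol z (fsol \<mu> w) y" by simp
  have "bc t y"
  proof -
    have e: "\<rho>\<^sup>2 - \<rho> * hill z + 1 = \<delta> / (\<mu> - z)"
      using d0 floquet_det[of t z] unfolding \<rho>_def[symmetric] by (simp add: \<delta>_def)
    have "y pi - cscale \<rho> (y 0) = cscale (1 / (\<mu> - z)) b - cscale (1 / \<delta> * (\<rho>\<^sup>2 - \<rho> * hill z + 1)) b"
      unfolding y_def fsol_adj fsol_0 by (simp add: fsol_adj b_def prod_eq_iff algebra_simps)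
    also have "\<dots> = 0" unfolding e using d0 by simp
    finally show ?thesis by (simp add: bc_floquet \<rho>_def)
  qed
  \<comment> \<open>\<open>resolv\<close> singles out the solution that is zero outside
    [0, pi].\<close>
  define y' where "y' = (\<lambda>x. if x \<in> {0..pi} then y x else (0,0))"
  have y': "dsol z (fsol \<mu> w) y'" by (rule dsol_cong[OF y]) (simp_all add: y'_def)
  have bc': "bc t y'" using \<open>bc t y\<close> by (simp add: bc_def y'_def)
  have "resolv p q t z (fsol \<mu> w) = y'"
    unfolding resolv_def opeq_iff_dsol[OF continuous_fsol]
  proof (rule the_equality)
    show "(dsol z (fsol \<mu> w) y' \<and> bc t y') \<and> (\<forall>x. x \<notin> {0..pi} \<longrightarrow> y' x = (0,0))"
      using y' bc' by (simp add: y'_def)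
    fix u assume u: "(dsol z (fsol \<mu> w) u \<and> bc t u) \<and> (\<forall>x. x \<notin> {0..pi} \<longrightarrow> u x = (0,0))"
    have "dsol z (\<lambda>x. cscale 1 (fsol \<mu> w x) + cscale (-1) (fsol \<mu> w x)) (\<lambda>x. cscale 1 (u x) + cscale (-1) (y' x))"
      using u y' by (intro dsol_linear) auto
    moreover have "cscale 1 a + cscale (-1) a = (0,0)" for a by (simp add: cscale_def prod_eq_iff)
    ultimately have "hom z (\<lambda>x. cscale 1 (u x) + cscale (-1) (y' x))" by (simp only:)
    moreover have "bc t (\<lambda>x. cscale 1 (u x) + cscale (-1) (y' x))"
      using u bc' by (simp add: bc_def cscale_def prod_eq_iff algebra_simps)
    ultimately have "opeq p q t z (\<lambda>_. (0,0)) (\<lambda>x. cscale 1 (u x) + cscale (-1) (y' x))"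
      by (simp add: opeq_hom_iff)
    moreover have "\<not> eigenvalue p q t z" using ne by (simp add: eigenvalue_iff_hill)
    ultimately have "cscale 1 (u x) + cscale (-1) (y' x) = (0,0)" if "x \<in> {0..pi}" for x
      using that unfolding eigenvalue_def eigfun_def by blast
    then have "u x = y' x" if "x \<in> {0..pi}" for x
      using that by (simp add: cscale_def prod_eq_iff)
    then show "u = y'" using u by (auto simp: fun_eq_iff y'_def)
  qed
  then show ?thesis using x by (simp add: y'_def y_def b_def \<delta>_def)
qed

lemma riesz_app_fsol:
  assumes hill: "hill \<kappa> = 2 * cos (of_real pi * t)" and d: "deriv hill \<kappa> \<noteq> 0"
    and nz: "\<And>z. z \<in> ball \<kappa> r \<Longrightarrow> z \<noteq> \<kappa> \<Longrightarrow> hill z \<noteq> 2 * cos (of_real pi * t)"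
    and \<mu>: "\<mu> \<notin> ball \<kappa> r" and s: "0 < s" "s < r" and x: "x \<in> {0..pi}"
  defines "\<rho> \<equiv> floquet t"
  shows "riesz_app p q t (circlepath \<kappa> s) (fsol \<mu> w) x =
    cscale (- (of_real (2 * pi) * \<i>) / ((\<mu> - \<kappa>) * \<rho> * deriv hill \<kappa>)) (fsol \<kappa> (adj \<rho> \<kappa> (fsol \<mu> w pi - cscale \<rho> w)) x)"
proof -
  define b where "b = fsol \<mu> w pi - cscale \<rho> w"
  define k where "k = (\<lambda>z. 2 * cos (of_real pi * t) - hill z)"
  let ?\<gamma> = "circlepath \<kappa> s"
  have k: "k holomorphic_on ball \<kappa> r" "k \<kappa> = 0" "\<And>z. z \<in> ball \<kappa> r \<Longrightarrow> z \<noteq> \<kappa> \<Longrightarrow> k z \<noteq> 0"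
  proof -
    show "k holomorphic_on ball \<kappa> r" unfolding k_def by (intro holomorphic_intros)
    show "k \<kappa> = 0" using hill by (simp add: k_def)
    show "k z \<noteq> 0" if "z \<in> ball \<kappa> r" "z \<noteq> \<kappa>" for z using nz[OF that] by (simp add: k_def)
  qed
  have dk: "deriv k \<kappa> = - deriv hill \<kappa>"
  proof -
    have "(hill has_field_derivative deriv hill \<kappa>) (at \<kappa>)"
      by (rule holomorphic_derivI[OF holomorphic_monodromy(5) open_UNIV UNIV_I])
    then have "(k has_field_derivative - deriv hill \<kappa>) (at \<kappa>)"
      unfolding k_def by (auto intro!: derivative_eq_intros)
    then show ?thesis by (rule DERIV_imp_deriv)
  qed
  have \<mu>z: "\<mu> - z \<noteq> 0" if "z \<in> ball \<kappa> r" for z using \<mu> that by auto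
  have im: "path_image ?\<gamma> \<subseteq> ball \<kappa> r - {\<kappa>}"
    using s by (auto simp: path_image_circlepath dist_norm norm_minus_commute)
  have hol: "(\<lambda>z. P (adj \<rho> z b)) holomorphic_on S" if "P = fst \<or> P = snd" for P :: "cvec \<Rightarrow> complex" and S
    using that by (auto simp: adj_def intro!: holomorphic_intros)
  have key: "contour_integral ?\<gamma> (\<lambda>z. P (resolv p q t z (fsol \<mu> w) x)) =
      - (of_real (2 * pi) * \<i>) / ((\<mu> - \<kappa>) * \<rho> * deriv hill \<kappa>) * P (fsol \<kappa> (adj \<rho> \<kappa> b) x)"
    if P: "P = fst \<or> P = snd" for P :: "cvec \<Rightarrow> complex"
  proof -
    have lin: "P (v + v') = P v + P v'" "P (cscale c v) = c * P v" for v v' c using P by auto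
    \<comment> \<open>The regular part of the resolvent is multiplied by k, so that the whole is h /
      k; this term drops out at \<kappa>, and only the adjugate term contributes to the residue. P
      stands for either component.\<close>
    define h where "h = (\<lambda>z. P (fsol \<mu> w x) / (\<mu> - z) * k z + P (fsol z (adj \<rho> z b) x) / ((\<mu> - z) * \<rho>))"
    have e: "P (fsol z v x) = fst v * P (fsol z (1,0) x) + snd v * P (fsol z (0,1) x)" for z v
      unfolding fsol_def[of z v] lin Y1_fsol Y2_fsol ..
    have hP: "(\<lambda>z. P (fsol z v x)) holomorphic_on S" for v S
      using P holomorphic_fsol[OF x, of v S] by (elim disjE) simp_all
    have h: "h holomorphic_on ball \<kappa> r"
      unfolding h_def e[of _ "adj _ _ _"] using \<mu>z
      by (intro holomorphic_intros k hP hol) (auto simp: \<rho>_def)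
    have "contour_integral ?\<gamma> (\<lambda>z. P (resolv p q t z (fsol \<mu> w) x)) = contour_integral ?\<gamma> (\<lambda>z. h z / k z)"
    proof (rule contour_integral_eq)
      fix z assume "z \<in> path_image ?\<gamma>"
      then have z: "z \<in> ball \<kappa> r" "z \<noteq> \<kappa>" using im by auto
      have kz: "k z \<noteq> 0" "\<mu> - z \<noteq> 0" using k(3)[OF z] \<mu>z[OF z(1)] by auto
      have "P (resolv p q t z (fsol \<mu> w) x) = 1 / (\<mu> - z) * P (fsol \<mu> w x) + 1 / ((\<mu> - z) * \<rho> * k z) * P (fsol z (adj \<rho> z b) x)"
        using resolv_fsol[OF nz[OF z] _ x, of \<mu> w] \<mu>z[OF z(1)] by (simp add: lin b_def \<rho>_def k_def)
      also have "\<dots> = h z / k z" using kz by (simp add: h_def add_divide_distrib)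
      finally show "P (resolv p q t z (fsol \<mu> w) x) = h z / k z" .
    qed
    also have "\<dots> = of_real (2 * pi) * \<i> * (h \<kappa> / deriv k \<kappa>)"
      by (rule contour_integral_simple_zero[OF h k(1,2) _ k(3) s]) (use d in \<open>simp add: dk\<close>)
    also have "\<dots> = - (of_real (2 * pi) * \<i>) / ((\<mu> - \<kappa>) * \<rho> * deriv hill \<kappa>) * P (fsol \<kappa> (adj \<rho> \<kappa> b) x)"
      unfolding dk h_def k(2) by simp
    finally show ?thesis .
  qed
  show ?thesis
    unfolding riesz_app_def key[of fst, simplified] key[of snd, simplified] b_def[symmetric] by (simp add: prod_eq_iff)
qed

lemma riesz_norm_ge:
  assumes hill: "hill \<kappa> = 2 * cos (of_real pi * of_real t)" and d: "deriv hill \<kappa> \<noteq> 0"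
    and nz: "\<And>z. z \<in> ball \<kappa> r \<Longrightarrow> z \<noteq> \<kappa> \<Longrightarrow> hill z \<noteq> 2 * cos (of_real pi * of_real t)"
    and \<mu>: "\<mu> \<notin> ball \<kappa> r" and s: "0 < s" "s < r" and w: "l2norm (fsol \<mu> w) \<le> 1"
    and G: "exp ((\<bar>Im \<kappa>\<bar> + 4 * qbd) * pi) \<le> G"
  defines "\<rho> \<equiv> floquet (of_real t)"
  shows "ennreal (norm (adj \<rho> \<kappa> (fsol \<mu> w pi - cscale \<rho> w)) / (4 * G * norm (\<mu> - \<kappa>) * norm (deriv hill \<kappa>)))
    \<le> riesz_norm p q (of_real t) (circlepath \<kappa> s)"
proof -
  define v where "v = adj \<rho> \<kappa> (fsol \<mu> w pi - cscale \<rho> w)"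
  define A where "A = 2 * pi / (norm (\<mu> - \<kappa>) * norm (deriv hill \<kappa>))"
  have "\<mu> \<noteq> \<kappa>" using \<mu> s by auto
  have \<rho>: "norm \<rho> = 1" by (simp add: \<rho>_def floquet_def norm_exp_eq_Re)
  have A: "A \<ge> 0" by (simp add: A_def)
  have "G > 0" using G by (meson exp_gt_zero less_le_trans)
  have ge: "A * (norm v / (4 * G)) \<le> norm (riesz_app p q (of_real t) (circlepath \<kappa> s) (fsol \<mu> w) x)"
    if x: "x \<in> {0..pi}" for x
  proof -
    have "norm v \<le> 4 * exp ((\<bar>Im \<kappa>\<bar> + 4 * qbd) * pi) * norm (fsol \<kappa> v x)" by (rule norm_fsol_ge[OF x])
    also have "\<dots> \<le> 4 * G * norm (fsol \<kappa> v x)" using G by (intro mult_right_mono) auto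
    finally have "norm v / (4 * G) \<le> norm (fsol \<kappa> v x)" using \<open>G > 0\<close> by (simp add: field_simps)
    then have "A * (norm v / (4 * G)) \<le> A * norm (fsol \<kappa> v x)" using A by (rule mult_left_mono)
    also have "\<dots> = norm (riesz_app p q (of_real t) (circlepath \<kappa> s) (fsol \<mu> w) x)"
    proof -
      have "riesz_app p q (of_real t) (circlepath \<kappa> s) (fsol \<mu> w) x =
        cscale (- (of_real (2 * pi) * \<i>) / ((\<mu> - \<kappa>) * \<rho> * deriv hill \<kappa>)) (fsol \<kappa> v x)"
        unfolding v_def \<rho>_def by (rule riesz_app_fsol[OF hill d nz \<mu> s x])
      then show ?thesis by (simp add: A_def norm_divide norm_mult norm_cscale \<rho>)
    qed
    finally show ?thesis .
  qed
  have "norm v / (4 * G * norm (\<mu> - \<kappa>) * norm (deriv hill \<kappa>)) \<le> A * (norm v / (4 * G)) * sqrt pi"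
  proof -
    \<comment> \<open>The factor 2 pi sqrt(pi) from the contour integral and the L2 norm is at least
      1 and is dropped.\<close>
    have "norm v / (4 * G * norm (\<mu> - \<kappa>) * norm (deriv hill \<kappa>)) * 1 \<le>
      norm v / (4 * G * norm (\<mu> - \<kappa>) * norm (deriv hill \<kappa>)) * (2 * pi * sqrt pi)"
    proof (rule mult_left_mono)
      have "1 \<le> pi" using pi_gt3 by simp
      moreover from this have "1 \<le> sqrt pi" by simp
      ultimately have "1 * 1 \<le> 2 * pi * sqrt pi" by (intro mult_mono) auto
      then show "1 \<le> 2 * pi * sqrt pi" by simp
    qed (use \<open>G > 0\<close> in simp)
    then show ?thesis by (simp add: A_def mult_ac)
  qed
  then have "ennreal (norm v / (4 * G * norm (\<mu> - \<kappa>) * norm (deriv hill \<kappa>))) \<le> ennreal (A * (norm v / (4 * G)) * sqrt pi)"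
    by (rule ennreal_leI)
  also have "\<dots> \<le> l2norm (riesz_app p q (of_real t) (circlepath \<kappa> s) (fsol \<mu> w))"
    using A \<open>G > 0\<close> by (intro l2norm_ge ge) auto
  also have "\<dots> \<le> riesz_norm p q (of_real t) (circlepath \<kappa> s)"
    unfolding riesz_norm_def
  proof (rule SUP_upper)
    have "fsol \<mu> w \<in> borel_measurable (lebesgue_on {0..pi})"
      using sq_int_continuous[OF continuous_fsol] by (simp add: sq_int_def)
    then show "fsol \<mu> w \<in> {f. f \<in> borel_measurable (lebesgue_on {0..pi}) \<and> l2norm f \<le> 1}" using w by simp
  qed
  finally show ?thesis unfolding v_def .
qed

end

section \<open>Spectral singularity\<close>

text \<open>On vertical lines through integers the modulus is a hyperbolic cosine, hence at least 2;
  off them the cosine may be smaller.\<close>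

lemma norm_2_cos_integer_Re:
  fixes z :: complex
  assumes "Re z \<in> \<int>"
  shows "norm (2 * cos (of_real pi * z)) = exp (pi * Im z) + exp (- (pi * Im z))"
proof -
  let ?w = "of_real pi * z" and ?e = "exp (pi * Im z)"
  have "(sin (pi * Re z))\<^sup>2 = 0" using assms by (auto elim!: Ints_cases simp: mult.commute)
  then have c: "(cos (pi * Re z))\<^sup>2 = 1" using sin_cos_squared_add[of "pi * Re z"] by simp
  have "(norm (2 * cos ?w))\<^sup>2 = 4 * (norm (cos ?w))\<^sup>2" by (simp add: norm_mult power_mult_distrib)
  also have "\<dots> = 4 + (?e - inverse ?e)\<^sup>2" by (simp add: norm_cos_squared c)
  also have "\<dots> = (?e + inverse ?e)\<^sup>2" by (simp add: power2_eq_square field_simps)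
  finally have "norm (2 * cos ?w) = ?e + inverse ?e"
    by (rule power2_eq_imp_eq) (simp_all add: add_nonneg_nonneg)
  then show ?thesis by (simp add: exp_minus)
qed

lemma norm_2_cos_ge:
  fixes z :: complex
  shows "exp (pi * \<bar>Im z\<bar>) - 1 \<le> norm (2 * cos (of_real pi * z))"
proof -
  let ?w = "of_real pi * z" and ?e = "exp (pi * Im z)"
  have "(?e - inverse ?e)\<^sup>2 \<le> 4 * (norm (cos ?w))\<^sup>2" by (simp add: norm_cos_squared)
  also have "\<dots> = (norm (2 * cos ?w))\<^sup>2" by (simp add: norm_mult power_mult_distrib)
  finally have "\<bar>?e - inverse ?e\<bar>\<^sup>2 \<le> (norm (2 * cos ?w))\<^sup>2" by simp
  then have "\<bar>?e - inverse ?e\<bar> \<le> norm (2 * cos ?w)" by (rule power2_le_imp_le) simp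
  moreover have "exp (pi * \<bar>Im z\<bar>) - 1 \<le> \<bar>?e - inverse ?e\<bar>"
  proof (cases "Im z \<ge> 0")
    case True
    then have "inverse ?e \<le> 1" by (simp add: exp_minus[symmetric])
    then show ?thesis using True by simp
  next
    case False
    then have "pi * Im z \<le> 0" "pi * \<bar>Im z\<bar> = - (pi * Im z)" by (simp_all add: mult_le_0_iff)
    then have "?e \<le> 1" "exp (pi * \<bar>Im z\<bar>) = inverse ?e" by (simp_all only: exp_le_one_iff exp_minus)
    then show ?thesis by linarith
  qed
  ultimately show ?thesis by simp
qed

section \<open>Lower bounds, zeros and critical points of the discriminant\<close>

context dirac
begin

text \<open>The first bound serves the horizontal sides of large squares, where |Im z| is large; the
  second serves the vertical sides, where Im z may be small and the comparison with numbers below 2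
  is tight.\<close>

lemma hill_lower_bounds:
  obtains R where "R > 0" "\<And>z. R \<le> norm z \<Longrightarrow> exp (pi * \<bar>Im z\<bar>) / 2 - 1 \<le> norm (hill z)"
    "\<And>c. c < 2 \<Longrightarrow> \<exists>N. \<forall>z. N \<le> norm z \<longrightarrow> Re z \<in> \<int> \<longrightarrow> c < norm (hill z)"
proof -
  obtain C where C: "C \<ge> 0" "\<And>z. z \<noteq> 0 \<Longrightarrow> norm (hill z - 2 * cos (of_real pi * z)) \<le> C * exp (pi * \<bar>Im z\<bar>) / norm z"
    using hill_asymptotics by blast
  have near: "norm (2 * cos (of_real pi * z)) - C * exp (pi * \<bar>Im z\<bar>) / norm z \<le> norm (hill z)" if "z \<noteq> 0" for z
    using C(2)[OF that] norm_triangle_ineq2[of "2 * cos (of_real pi * z)" "hill z"] by (simp add: norm_minus_commute)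
  show thesis
  proof (rule that[of "2 * C + 1"])
    show "2 * C + 1 > 0" using C(1) by simp
  next
    fix z :: complex assume z: "2 * C + 1 \<le> norm z"
    then have "z \<noteq> 0" using C(1) by auto
    have "C / norm z \<le> 1 / 2" using z \<open>z \<noteq> 0\<close> by (simp add: pos_divide_le_eq)
    then have "C / norm z * exp (pi * \<bar>Im z\<bar>) \<le> 1 / 2 * exp (pi * \<bar>Im z\<bar>)" by (rule mult_right_mono) simp
    then show "exp (pi * \<bar>Im z\<bar>) / 2 - 1 \<le> norm (hill z)"
      using near[OF \<open>z \<noteq> 0\<close>] norm_2_cos_ge[of z] by simp
  next
    fix c :: real assume "c < 2"
    \<comment> \<open>Beyond N both C / |z| < 1 and 2 (1 - C / |z|) > c hold.\<close>
    define N where "N = 2 * C / (2 - c) + C + 1"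
    have "c < norm (hill z)" if z: "N \<le> norm z" and i: "Re z \<in> \<int>" for z
    proof -
      have N: "0 \<le> 2 * C / (2 - c)" using C(1) \<open>c < 2\<close> by simp
      then have nz: "norm z > 0" "norm z > C" "norm z > 2 * C / (2 - c)" using z C(1) unfolding N_def by linarith+
      define X where "X = exp (pi * Im z) + exp (- (pi * Im z))"
      have X: "X \<ge> 2" "exp (pi * \<bar>Im z\<bar>) \<le> X"
      proof -
        define u where "u = exp (pi * Im z)"
        have u: "u > 0" "X = u + inverse u" by (simp_all add: u_def X_def exp_minus)
        have "X - 2 = (u - 1)\<^sup>2 / u" using u by (simp add: power2_eq_square field_simps)
        also have "\<dots> \<ge> 0" using u(1) by simp
        finally show "X \<ge> 2" by simp
        show "exp (pi * \<bar>Im z\<bar>) \<le> X"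
        proof (cases "Im z \<ge> 0")
          case True
          then show ?thesis by (simp add: X_def)
        next
          case False
          then show ?thesis by (simp add: X_def)
        qed
      qed
      have "C / norm z * exp (pi * \<bar>Im z\<bar>) \<le> C / norm z * X" using X C(1) by (intro mult_left_mono) auto
      moreover have "X - C / norm z * exp (pi * \<bar>Im z\<bar>) \<le> norm (hill z)"
        using near[of z] nz(1) unfolding norm_2_cos_integer_Re[OF i] X_def by simp
      ultimately have "X * (1 - C / norm z) \<le> norm (hill z)"
        unfolding right_diff_distrib by (simp only: mult.commute[of X] mult_1 mult_1_right)
      moreover have "C / norm z < 1" "2 * (C / norm z) < 2 - c" using nz C(1) \<open>c < 2\<close> by (simp_all add: field_simps)
      then have "2 * (1 - C / norm z) \<le> X * (1 - C / norm z)" "c < 2 * (1 - C / norm z)"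
        using mult_right_mono[OF X(1), of "1 - C / norm z"] by simp_all
      ultimately show ?thesis by linarith
    qed
    then show "\<exists>N. \<forall>z. N \<le> norm z \<longrightarrow> Re z \<in> \<int> \<longrightarrow> c < norm (hill z)" by blast
  qed
qed

lemma hill_not_constant: "\<exists>z. hill z \<noteq> c"
proof -
  obtain R where R: "R > 0" "\<And>z. R \<le> norm z \<Longrightarrow> exp (pi * \<bar>Im z\<bar>) / 2 - 1 \<le> norm (hill z)"
    by (rule hill_lower_bounds) (rule that)
  \<comment> \<open>Chosen so that exp(pi y) \<ge> 1 + y > 2 (|c| + 1), while i y lies beyond
    R.\<close>
  define y where "y = R + 2 * (norm c + 1)"
  have y: "y \<ge> R" "y \<ge> 0" using R(1) by (auto simp: y_def add_nonneg_nonneg)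
  have "2 * (norm c + 1) < 1 + y" using R(1) by (simp add: y_def)
  also have "\<dots> \<le> 1 + pi * y" using mult_right_mono[of 1 pi y] y(2) pi_gt3 by simp
  also have "\<dots> \<le> exp (pi * y)" by (rule exp_ge_add_one_self)
  finally have "norm c < exp (pi * y) / 2 - 1" by simp
  also have "\<dots> \<le> norm (hill (\<i> * of_real y))" using R(2)[of "\<i> * of_real y"] y by (simp add: norm_mult)
  finally show ?thesis by auto
qed

lemma deriv_hill_nonzero: "\<exists>z. deriv hill z \<noteq> 0"
proof (rule ccontr)
  assume "\<not> (\<exists>z. deriv hill z \<noteq> 0)"
  then have "(hill has_field_derivative 0) (at z)" for z
    using holomorphic_derivI[OF holomorphic_monodromy(5) open_UNIV UNIV_I, of z] by simp
  then have "\<exists>c. \<forall>z\<in>UNIV. hill z = c" by (intro has_field_derivative_zero_constant) auto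
  then show False using hill_not_constant by blast
qed

lemma hill_isolated:
  obtains r where "r > 0" "\<And>z. z \<in> ball z0 r \<Longrightarrow> z \<noteq> z0 \<Longrightarrow> hill z \<noteq> hill z0"
    "\<And>z. z \<in> ball z0 r \<Longrightarrow> z \<noteq> z0 \<Longrightarrow> deriv hill z \<noteq> 0"
proof -
  obtain b where b: "hill b \<noteq> hill z0" using hill_not_constant by blast
  have "(\<lambda>z. hill z - hill z0) holomorphic_on UNIV" by (intro holomorphic_intros)
  then obtain r1 where r1: "r1 > 0" "\<And>z. z \<in> ball z0 r1 - {z0} \<Longrightarrow> hill z - hill z0 \<noteq> 0"
    using isolated_zeros[of "\<lambda>z. hill z - hill z0" UNIV z0 b] b by auto
  obtain r2 where r2: "r2 > 0" "\<And>z. z \<in> ball z0 r2 - {z0} \<Longrightarrow> deriv hill z \<noteq> 0"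
  proof (cases "deriv hill z0 = 0")
    case True
    obtain b where "deriv hill b \<noteq> 0" using deriv_hill_nonzero by blast
    moreover have "deriv hill holomorphic_on UNIV" by (intro holomorphic_deriv holomorphic_monodromy open_UNIV)
    ultimately show ?thesis using isolated_zeros[of "deriv hill" UNIV z0 b] True that by auto
  next
    case False
    have "continuous_on UNIV (deriv hill)"
      by (intro holomorphic_on_imp_continuous_on holomorphic_deriv holomorphic_monodromy open_UNIV)
    then have "isCont (deriv hill) z0" by (simp add: continuous_on_eq_continuous_at)
    then obtain r where "r > 0" "\<forall>z. dist z0 z < r \<longrightarrow> deriv hill z \<noteq> 0"
      using continuous_at_avoid[of z0 "deriv hill" 0] False by auto
    then show ?thesis using that[of r] by auto
  qed
  show thesis
    by (rule that[of "min r1 r2"]) (use r1 r2 in auto)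
qed

text \<open>If the adjugate were zero, M(z) would be \<rho> times the identity, and its determinant
  1 would equal \<rho>^2.\<close>

lemma adj_nonzero:
  assumes "\<rho> * \<rho> \<noteq> 1"
  obtains b where "adj \<rho> z b \<noteq> 0"
proof (rule ccontr)
  assume "\<not> thesis"
  then have "adj \<rho> z (1,0) = 0" "adj \<rho> z (0,1) = 0" using that by blast+
  then have "m22 z = \<rho>" "m11 z = \<rho>" "m12 z = 0" by (simp_all add: adj_def zero_prod_def)
  then show False using det_monodromy[of z] assms by simp
qed

lemma floquet_square: "sin (of_real pi * t) \<noteq> 0 \<Longrightarrow> floquet t * floquet t \<noteq> 1"
  using floquet_diff[of t] by (metis cancel_comm_monoid_add_class.diff_cancel inverse_unique mult_eq_0_iff
    zero_neq_numeral complex_i_not_zero)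

lemma sin_nonzero_hill:
  assumes "hill z = 2 * cos (of_real pi * t)" "hill z \<noteq> 2" "hill z \<noteq> -2"
  shows "sin (of_real pi * t) \<noteq> 0"
proof
  assume "sin (of_real pi * t) = 0"
  then have "(cos (of_real pi * t))\<^sup>2 = 1" using sin_cos_squared_add[of "of_real pi * t"] by simp
  then show False using assms by (auto simp: power2_eq_1_iff)
qed

text \<open>For b outside the kernel of the adjugate at z, the vector M(\<mu>) w - \<rho> w should
  be a nonzero multiple of b. The adjugate at \<mu> provides w, since the determinant there is
  nonzero.\<close>

lemma test_function_exists:
  assumes sin: "sin (of_real pi * t) \<noteq> 0" and \<mu>: "hill \<mu> \<noteq> 2 * cos (of_real pi * t)"
  obtains w where "l2norm (fsol \<mu> w) \<le> 1" "adj (floquet t) z (fsol \<mu> w pi - cscale (floquet t) w) \<noteq> 0"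
proof -
  let ?\<rho> = "floquet t"
  obtain b where b: "adj ?\<rho> z b \<noteq> 0" using adj_nonzero[OF floquet_square[OF sin]] by blast
  define G where "G = norm (adj ?\<rho> \<mu> b) * exp ((\<bar>Im \<mu>\<bar> + 4 * qbd) * pi)"
  \<comment> \<open>This scaling keeps the function pointwise below 1/2, so its squared L2 norm is
    at most pi / 4 < 1.\<close>
  define c where "c = 1 / (2 * (G + 1))"
  define w where "w = cscale (of_real c) (adj ?\<rho> \<mu> b)"
  have G: "G \<ge> 0" by (simp add: G_def)
  then have c: "c > 0" by (simp add: c_def)
  have "l2norm (fsol \<mu> w) \<le> 1"
  proof (rule l2norm_le_1)
    show "0 \<le> 1/2 * (1::real)" "(1/2 * 1)\<^sup>2 * pi \<le> 1" using pi_less_4 by (simp_all add: power2_eq_square)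
    fix x assume x: "x \<in> {0..pi}"
    have "norm (fsol \<mu> w x) \<le> norm w * exp ((\<bar>Im \<mu>\<bar> + 4 * qbd) * pi)" by (rule norm_fsol_le[OF x])
    also have "\<dots> = c * G" using c by (simp add: w_def norm_cscale G_def)
    also have "\<dots> \<le> 1/2 * 1" using G by (simp add: c_def field_simps)
    finally show "norm (fsol \<mu> w x) \<le> 1/2 * 1" .
  qed
  moreover have "adj ?\<rho> z (fsol \<mu> w pi - cscale ?\<rho> w) \<noteq> 0"
  proof -
    let ?d = "?\<rho>\<^sup>2 - ?\<rho> * hill \<mu> + 1"
    have d: "?d \<noteq> 0" using \<mu> unfolding floquet_det by simp
    have "fsol \<mu> w pi - cscale ?\<rho> w = cscale (- of_real c * ?d) b"
      unfolding w_def fsol_scale fsol_adj by (simp add: prod_eq_iff algebra_simps)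
    then have "adj ?\<rho> z (fsol \<mu> w pi - cscale ?\<rho> w) = cscale (- of_real c * ?d) (adj ?\<rho> z b)"
      by (simp add: adj_scale)
    moreover have "- of_real c * ?d \<noteq> 0" using c d by simp
    ultimately show ?thesis using b by (metis norm_cscale mult_eq_0_iff norm_eq_zero)
  qed
  ultimately show thesis by (rule that)
qed

text \<open>The circle surrounds not \<open>z0\<close> but a nearby simple eigenvalue \<kappa> for
  another t, where |F'| is tiny. Being a bound for all parameters, the enclosure condition is met by
  taking a disc on which F is injective, has no critical point and avoids 2 and -2: whatever is
  enclosed for any t is then simple and alone.\<close>

lemma large_riesz_norm:
  assumes t0: "t0 \<in> {-1<..<1::real}" and sin: "sin (of_real pi * of_real t0 :: complex) \<noteq> 0"
    and hill: "hill z0 = 2 * cos (of_real pi * of_real t0)" and crit: "deriv hill z0 = 0" and "\<epsilon> > 0"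
  obtains \<gamma> where "valid_path \<gamma>" "simple_path \<gamma>" "pathfinish \<gamma> = pathstart \<gamma>"
    "path_image \<gamma> \<subseteq> ball z0 \<epsilon>" "encloses_at_most_one p q \<gamma>"
    "ennreal (real N) \<le> (SUP t \<in> {t\<in>{-1<..1::real}. \<forall>z\<in>path_image \<gamma>. \<not> eigenvalue p q (of_real t) z}.
                riesz_norm p q (of_real t) \<gamma>)"
proof -
  obtain \<mu> where \<mu>: "hill \<mu> \<noteq> 2 * cos (of_real pi * of_real t0)" using hill_not_constant by blast
  then have "\<mu> \<noteq> z0" using hill by auto
  obtain w where w: "l2norm (fsol \<mu> w) \<le> 1"
    "adj (floquet (of_real t0)) z0 (fsol \<mu> w pi - cscale (floquet (of_real t0)) w) \<noteq> 0"
    using test_function_exists[OF sin \<mu>] by blast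
  define \<Phi> where "\<Phi> = (\<lambda>u::complex \<times> real. adj (floquet (of_real (snd u))) (fst u)
     (fsol \<mu> w pi - cscale (floquet (of_real (snd u))) w))"
  define a where "a = norm (\<Phi> (z0, t0)) / 2"
  have "a > 0" using w(2) by (simp add: a_def \<Phi>_def)
  define G where "G = exp ((\<bar>Im z0\<bar> + 1 + 4 * qbd) * pi)"
  define D where "D = norm (\<mu> - z0) + 1"
  have GD: "G > 0" "D > 0" by (simp_all add: G_def D_def add_nonneg_pos)
  \<comment> \<open>With |F'| \<le> \<eta> the lower bound of \<open>riesz_norm_ge\<close> is at
    least a / (4 G D \<eta>) = N + 1.\<close>
  define \<eta> where "\<eta> = a / (4 * G * D * (real N + 1))"
  have "\<eta> > 0" using \<open>a > 0\<close> GD by (simp add: \<eta>_def)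
  have ch: "continuous_on UNIV hill" "continuous_on UNIV (deriv hill)"
    "continuous_on UNIV m11" "continuous_on UNIV m12" "continuous_on UNIV m21" "continuous_on UNIV m22"
    by (intro holomorphic_on_imp_continuous_on holomorphic_deriv holomorphic_monodromy open_UNIV)+
  have "continuous_on UNIV \<Phi>"
    unfolding \<Phi>_def adj_def floquet_def cscale_def
    by (intro continuous_intros continuous_on_compose2[OF ch(3)] continuous_on_compose2[OF ch(4)]
       continuous_on_compose2[OF ch(5)] continuous_on_compose2[OF ch(6)]) auto
  then have "open {u. a < norm (\<Phi> u)}" by (intro open_Collect_less continuous_intros)
  moreover have "(z0, t0) \<in> {u. a < norm (\<Phi> u)}" using \<open>a > 0\<close> by (simp add: a_def)
  ultimately obtain A B where AB: "open A" "open B" "(z0, t0) \<in> A \<times> B" "A \<times> B \<subseteq> {u. a < norm (\<Phi> u)}"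
    by (rule open_prod_elim)
  obtain r0 where r0: "r0 > 0" "\<And>z. z \<in> ball z0 r0 \<Longrightarrow> z \<noteq> z0 \<Longrightarrow> deriv hill z \<noteq> 0"
    using hill_isolated by blast
  \<comment> \<open>What \<kappa> and its disc require: the test vector stays longer than a on
    \<open>A \<times> B\<close>, \<open>z0\<close> is the only critical point, |F'| < \<eta>, and
    there are no periodic or antiperiodic eigenvalues.\<close>
  define U where "U = A \<inter> ball z0 r0 \<inter> ball z0 \<epsilon> \<inter> ball z0 1 \<inter> - {\<mu>} \<inter> {z. norm (deriv hill z) < \<eta>} \<inter>
    {z. hill z \<noteq> 2} \<inter> {z. hill z \<noteq> - 2}"
  have "open U"
    unfolding U_def using AB ch
    by (intro open_Int open_ball open_Collect_less open_Collect_neq continuous_intros) auto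
  have "z0 \<in> U"
  proof -
    have "hill z0 \<noteq> 2" "hill z0 \<noteq> - 2"
      using hill sin sin_cos_squared_add[of "of_real pi * of_real t0 :: complex"] by (auto simp: power2_eq_square)
    then show ?thesis using AB(3) r0(1) \<open>\<epsilon> > 0\<close> \<open>\<mu> \<noteq> z0\<close> \<open>\<eta> > 0\<close> crit by (simp add: U_def)
  qed
  \<comment> \<open>By the open mapping theorem the image of U contains 2 cos \<pi>t for all t near
    \<open>t0\<close>, so each of these operators has an eigenvalue in U.\<close>
  have "\<not> hill constant_on UNIV"
    unfolding constant_on_def using hill_not_constant by blast
  then have "open (hill ` U)"
    using \<open>open U\<close> by (intro open_mapping_thm[OF holomorphic_monodromy(5), of UNIV]) auto
  then have "open ((\<lambda>t. 2 * cos (of_real pi * of_real t)) -` (hill ` U) :: real set)"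
    by (rule open_vimage) (intro continuous_intros)
  then have "open (((\<lambda>t. 2 * cos (of_real pi * of_real t)) -` (hill ` U)) \<inter> B \<inter> {-1<..<1::real})"
    using AB(2) by (intro open_Int) auto
  moreover have "t0 \<in> ((\<lambda>t. 2 * cos (of_real pi * of_real t)) -` (hill ` U)) \<inter> B \<inter> {-1<..<1}"
    using \<open>z0 \<in> U\<close> hill AB(3) t0 by (auto simp: image_iff intro!: bexI[of _ z0])
  ultimately obtain e where e: "e > 0" "ball t0 e \<subseteq> ((\<lambda>t. 2 * cos (of_real pi * of_real t)) -` (hill ` U)) \<inter> B \<inter> {-1<..<1}"
    by (rule openE)
  \<comment> \<open>Of two distinct candidates other than \<open>t0\<close> at most one equals
    -\<open>t0\<close>. The condition on absolute values is what separates the cosines and forces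
    \<kappa> \<noteq> \<open>z0\<close>.\<close>
  obtain t where t: "t \<in> ball t0 e" "\<bar>t\<bar> \<noteq> \<bar>t0\<bar>"
  proof -
    define t1 t2 where "t1 = t0 + e / 2" and "t2 = t0 + e / 3"
    have "t1 \<in> ball t0 e" "t2 \<in> ball t0 e" "t1 \<noteq> t0" "t2 \<noteq> t0" "t1 \<noteq> t2"
      using e(1) by (auto simp: t1_def t2_def dist_norm)
    then show thesis using that[of t1] that[of t2] by (auto simp: abs_eq_iff)
  qed
  have tB: "t \<in> B" "t \<in> {-1<..<1}" "2 * cos (of_real pi * of_real t) \<in> hill ` U" using t(1) e(2) by auto
  then obtain \<kappa> where \<kappa>: "\<kappa> \<in> U" "hill \<kappa> = 2 * cos (of_real pi * of_real t)" by auto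
  have "\<kappa> \<noteq> z0"
  proof
    assume "\<kappa> = z0"
    then have "cos (of_real pi * of_real t :: complex) = cos (of_real pi * of_real t0)" using \<kappa>(2) hill by simp
    then have "cos (complex_of_real (pi * t)) = cos (complex_of_real (pi * t0))" by simp
    then have "cos (pi * t) = cos (pi * t0)" by (simp only: cos_of_real of_real_eq_iff)
    then have "cos \<bar>pi * t\<bar> = cos \<bar>pi * t0\<bar>" by (simp only: cos_abs_real)
    then have "cos (pi * \<bar>t\<bar>) = cos (pi * \<bar>t0\<bar>)" by (simp add: abs_mult)
    moreover have "pi * \<bar>t\<bar> \<le> pi" "pi * \<bar>t0\<bar> \<le> pi" using tB(2) t0 by (simp_all add: abs_le_iff)
    ultimately have "pi * \<bar>t\<bar> = pi * \<bar>t0\<bar>" using cos_inj_pi[of "pi * \<bar>t\<bar>" "pi * \<bar>t0\<bar>"] by simp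
    then show False using t(2) by simp
  qed
  have d: "deriv hill \<kappa> \<noteq> 0" using r0(2)[of \<kappa>] \<kappa>(1) \<open>\<kappa> \<noteq> z0\<close> by (simp add: U_def)
  obtain r1 where r1: "r1 > 0" "inj_on hill (ball \<kappa> r1)"
    using has_complex_derivative_locally_injective[OF holomorphic_monodromy(5) UNIV_I open_UNIV d] by blast
  have "open (U - {z0})" "\<kappa> \<in> U - {z0}" using \<open>open U\<close> \<kappa>(1) \<open>\<kappa> \<noteq> z0\<close> by auto
  then obtain r2 where r2: "r2 > 0" "ball \<kappa> r2 \<subseteq> U - {z0}" by (rule openE)
  define r where "r = min r1 r2"
  have r: "r > 0" "ball \<kappa> r \<subseteq> U - {z0}" "inj_on hill (ball \<kappa> r)"
  proof -
    have "ball \<kappa> r \<subseteq> ball \<kappa> r1" "ball \<kappa> r \<subseteq> ball \<kappa> r2" by (simp_all add: r_def subset_ball)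
    then show "ball \<kappa> r \<subseteq> U - {z0}" "inj_on hill (ball \<kappa> r)"
      using r2(2) inj_on_subset[OF r1(2)] by blast+
  qed (use r1 r2 in \<open>simp add: r_def\<close>)
  have inj: "hill z \<noteq> 2 * cos (of_real pi * of_real t)" if "z \<in> ball \<kappa> r" "z \<noteq> \<kappa>" for z
    using inj_onD[OF r(3), of z \<kappa>] that r(1) \<kappa>(2) by auto
  define s where "s = r / 2"
  have s: "0 < s" "s < r" using r(1) by (auto simp: s_def)
  define \<gamma> where "\<gamma> = circlepath \<kappa> s"
  have im: "path_image \<gamma> \<subseteq> ball \<kappa> r - {\<kappa>}"
    using s by (auto simp: \<gamma>_def path_image_circlepath dist_norm norm_minus_commute)
  have c1: "valid_path \<gamma>" "simple_path \<gamma>" "pathfinish \<gamma> = pathstart \<gamma>"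
    using s by (simp_all add: \<gamma>_def simple_path_circlepath)
  have c2: "path_image \<gamma> \<subseteq> ball z0 \<epsilon>" using im r(2) by (auto simp: U_def)
  have c3: "encloses_at_most_one p q \<gamma>"
    unfolding encloses_at_most_one_def
  proof (intro ballI allI impI conjI)
    fix t' :: real and m
    have inside: "m \<in> ball \<kappa> r" if "winding_number \<gamma> m \<noteq> 0" for m
    proof (rule ccontr)
      assume "m \<notin> ball \<kappa> r"
      then have "winding_number \<gamma> m = 0"
        using im by (intro winding_number_zero_outside[of _ "ball \<kappa> r"]) (auto simp: \<gamma>_def)
      then show False using that by simp
    qed
    assume m: "eigenvalue p q (of_real t') m \<and> m \<notin> path_image \<gamma> \<and> winding_number \<gamma> m \<noteq> 0"
    then have mb: "m \<in> ball \<kappa> r" and hm: "hill m = 2 * cos (of_real pi * of_real t')"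
      using inside by (auto simp: eigenvalue_iff_hill)
    then have mU: "m \<in> U" "m \<noteq> z0" using r(2) by auto
    show "alg_mult p q (of_real t') m = 1"
    proof (rule alg_mult_simple[OF _ hm])
      show "sin (of_real pi * of_real t' :: complex) \<noteq> 0"
        using mU(1) by (intro sin_nonzero_hill[OF hm]) (auto simp: U_def)
      show "deriv hill m \<noteq> 0" using mU r0(2)[of m] by (auto simp: U_def)
    qed
    fix n
    assume n: "eigenvalue p q (of_real t') n \<and> n \<notin> path_image \<gamma> \<and> winding_number \<gamma> n \<noteq> 0"
    then have "n \<in> ball \<kappa> r" "hill n = 2 * cos (of_real pi * of_real t')"
      using inside by (auto simp: eigenvalue_iff_hill)
    then show "n = m" using inj_onD[OF r(3), of n m] mb hm by simp
  qed
  have \<kappa>U: "\<bar>Im \<kappa>\<bar> \<le> \<bar>Im z0\<bar> + 1" "norm (\<mu> - \<kappa>) \<le> D" "norm (deriv hill \<kappa>) \<le> \<eta>"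
  proof -
    have "norm (\<kappa> - z0) < 1" using \<kappa>(1) by (simp add: U_def dist_norm norm_minus_commute)
    then show "\<bar>Im \<kappa>\<bar> \<le> \<bar>Im z0\<bar> + 1" "norm (\<mu> - \<kappa>) \<le> D"
      using abs_Im_le_cmod[of "\<kappa> - z0"] norm_triangle_ineq4[of "\<mu> - z0" "\<kappa> - z0"] by (auto simp: D_def)
    show "norm (deriv hill \<kappa>) \<le> \<eta>" using \<kappa>(1) by (simp add: U_def)
  qed
  have "exp ((\<bar>Im \<kappa>\<bar> + 4 * qbd) * pi) \<le> G" unfolding G_def using \<kappa>U(1) by simp
  moreover have "\<mu> \<notin> ball \<kappa> r" using r(2) by (auto simp: U_def)
  ultimately have "ennreal (norm (\<Phi> (\<kappa>, t)) / (4 * G * norm (\<mu> - \<kappa>) * norm (deriv hill \<kappa>)))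
     \<le> riesz_norm p q (of_real t) \<gamma>"
    unfolding \<Phi>_def \<gamma>_def fst_conv snd_conv by (intro riesz_norm_ge[OF \<kappa>(2) d inj _ s w(1)])
  moreover have "real N \<le> norm (\<Phi> (\<kappa>, t)) / (4 * G * norm (\<mu> - \<kappa>) * norm (deriv hill \<kappa>))"
  proof -
    have pos: "norm (\<mu> - \<kappa>) > 0" "norm (deriv hill \<kappa>) > 0" using \<kappa>(1) d by (auto simp: U_def)
    have "(\<kappa>, t) \<in> A \<times> B" using \<kappa>(1) tB by (simp add: U_def)
    then have "a \<le> norm (\<Phi> (\<kappa>, t))" using AB(4) by auto
    moreover have "real N * (4 * G * norm (\<mu> - \<kappa>) * norm (deriv hill \<kappa>)) \<le> (real N + 1) * (4 * G * D * \<eta>)"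
      using \<kappa>U GD \<open>\<eta> > 0\<close> by (intro mult_mono mult_nonneg_nonneg) auto
    moreover have "(real N + 1) * (4 * G * D * \<eta>) = a"
      using GD by (simp add: \<eta>_def)
    ultimately show ?thesis using pos GD by (simp add: pos_le_divide_eq)
  qed
  ultimately have "ennreal (real N) \<le> riesz_norm p q (of_real t) \<gamma>"
    by (meson ennreal_leI order_trans)
  also have "\<dots> \<le> (SUP t \<in> {t\<in>{-1<..1::real}. \<forall>z\<in>path_image \<gamma>. \<not> eigenvalue p q (of_real t) z}.
              riesz_norm p q (of_real t) \<gamma>)"
  proof (rule SUP_upper)
    show "t \<in> {t\<in>{-1<..1::real}. \<forall>z\<in>path_image \<gamma>. \<not> eigenvalue p q (of_real t) z}"
    proof (intro CollectI conjI ballI)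
      fix z assume "z \<in> path_image \<gamma>"
      then have "z \<in> ball \<kappa> r" "z \<noteq> \<kappa>" using im by auto
      then show "\<not> eigenvalue p q (of_real t) z" unfolding eigenvalue_iff_hill by (rule inj)
    qed (use tB(2) in simp)
  qed
  finally have c4: "ennreal (real N) \<le> (SUP t \<in> {t\<in>{-1<..1::real}. \<forall>z\<in>path_image \<gamma>. \<not> eigenvalue p q (of_real t) z}.
              riesz_norm p q (of_real t) \<gamma>)" .
  show thesis by (rule that[OF c1 c2 c3 c4])
qed

lemma spectral_singularity_of_critical:
  assumes t0: "t0 \<in> {-1<..<1::real}" and sin: "sin (of_real pi * of_real t0 :: complex) \<noteq> 0"
    and hill: "hill z0 = 2 * cos (of_real pi * of_real t0)" and crit: "deriv hill z0 = 0"
  shows "spectral_singularity p q z0"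
  unfolding spectral_singularity_def
proof (intro conjI allI impI)
  have "eigenvalue p q (of_real t0) z0" using hill by (simp add: eigenvalue_iff_hill)
  then show "z0 \<in> spec_L p q" using t0 unfolding spec_L_def by (intro UN_I[of t0]) auto
  fix \<epsilon> :: real assume "\<epsilon> > 0"
  let ?S = "\<lambda>\<gamma>. SUP t \<in> {t\<in>{-1<..1::real}. \<forall>z\<in>path_image \<gamma>. \<not> eigenvalue p q (of_real t) z}.
                riesz_norm p q (of_real t) \<gamma>"
  have "\<forall>N. \<exists>\<gamma>. (valid_path \<gamma> \<and> simple_path \<gamma> \<and> pathfinish \<gamma> = pathstart \<gamma> \<and>
    path_image \<gamma> \<subseteq> ball z0 \<epsilon> \<and> encloses_at_most_one p q \<gamma>) \<and> ennreal (real N) \<le> ?S \<gamma>"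
  proof
    fix N :: nat
    show "\<exists>\<gamma>. (valid_path \<gamma> \<and> simple_path \<gamma> \<and> pathfinish \<gamma> = pathstart \<gamma> \<and>
      path_image \<gamma> \<subseteq> ball z0 \<epsilon> \<and> encloses_at_most_one p q \<gamma>) \<and> ennreal (real N) \<le> ?S \<gamma>"
      by (rule large_riesz_norm[OF assms \<open>\<epsilon> > 0\<close>, of N]) (rule exI, intro conjI)
  qed
  from choice[OF this] obtain \<gamma> where g: "\<forall>N. (valid_path (\<gamma> N) \<and> simple_path (\<gamma> N) \<and> pathfinish (\<gamma> N) = pathstart (\<gamma> N) \<and>
    path_image (\<gamma> N) \<subseteq> ball z0 \<epsilon> \<and> encloses_at_most_one p q (\<gamma> N)) \<and> ennreal (real N) \<le> ?S (\<gamma> N)" ..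
  have \<gamma>: "\<forall>k. valid_path (\<gamma> k) \<and> simple_path (\<gamma> k) \<and> pathfinish (\<gamma> k) = pathstart (\<gamma> k) \<and>
    path_image (\<gamma> k) \<subseteq> ball z0 \<epsilon> \<and> encloses_at_most_one p q (\<gamma> k)"
  proof
    fix k from g[THEN spec, of k, THEN conjunct1] show "valid_path (\<gamma> k) \<and> simple_path (\<gamma> k) \<and> pathfinish (\<gamma> k) = pathstart (\<gamma> k) \<and>
    path_image (\<gamma> k) \<subseteq> ball z0 \<epsilon> \<and> encloses_at_most_one p q (\<gamma> k)" .
  qed
  have "(\<lambda>N. ?S (\<gamma> N)) \<longlonglongrightarrow> \<infinity>"
  proof (rule tendsto_sandwich)
    show "(\<lambda>N. ennreal (real N)) \<longlonglongrightarrow> \<infinity>"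
      using of_nat_tendsto_top_ennreal by (simp add: ennreal_of_nat_eq_real_of_nat)
    show "\<forall>\<^sub>F N in sequentially. ennreal (real N) \<le> ?S (\<gamma> N)"
      by (rule always_eventually) (rule allI, rule g[THEN spec, THEN conjunct2])
    show "\<forall>\<^sub>F N in sequentially. ?S (\<gamma> N) \<le> \<infinity>" by simp
    show "(\<lambda>N. \<infinity>) \<longlonglongrightarrow> (\<infinity>::ennreal)" by simp
  qed
  then show "\<exists>\<gamma>::nat \<Rightarrow> real \<Rightarrow> complex.
        (\<forall>k. valid_path (\<gamma> k) \<and> simple_path (\<gamma> k) \<and> pathfinish (\<gamma> k) = pathstart (\<gamma> k) \<and>
             path_image (\<gamma> k) \<subseteq> ball z0 \<epsilon> \<and> encloses_at_most_one p q (\<gamma> k)) \<and>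
        ((\<lambda>k. ?S (\<gamma> k)) \<longlonglongrightarrow> \<infinity>)"
    by (intro exI[of _ \<gamma>] conjI[OF \<gamma>])
qed

end

section \<open>The function alpha\<close>

definition cnj_vec :: "cvec \<Rightarrow> cvec" where
  "cnj_vec v = (cnj (fst v), cnj (snd v))"

lemma bounded_linear_cnj_vec: "bounded_linear cnj_vec"
proof -
  have "bounded_linear (\<lambda>v::cvec. (cnj (fst v), cnj (snd v)))"
    by (intro bounded_linear_Pair bounded_linear_compose[OF bounded_linear_cnj] bounded_linear_fst bounded_linear_snd)
  then show ?thesis by (simp add: cnj_vec_def[abs_def])
qed

lemma norm_cnj_vec [simp]: "norm (cnj_vec v) = norm v"
  by (simp add: cnj_vec_def norm_prod_def)

lemma cnj_vec_eq_0_iff: "cnj_vec v = (0,0) \<longleftrightarrow> v = (0,0)"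
  by (auto simp: cnj_vec_def prod_eq_iff)

lemma dirac_eq_cnj:
  assumes "dirac_eq p q z (\<lambda>_. (0,0)) y"
  shows "dirac_eq (cnj \<circ> p) (cnj \<circ> q) (cnj z) (\<lambda>_. (0,0)) (\<lambda>x. cnj_vec (y x))"
  unfolding dirac_eq_def
proof (intro conjI ballI)
  let ?h = "dirac_rhs p q z (\<lambda>_. (0,0)) y"
  let ?k = "dirac_rhs (cnj \<circ> p) (cnj \<circ> q) (cnj z) (\<lambda>_. (0,0)) (\<lambda>x. cnj_vec (y x))"
  have y: "continuous_on {0..pi} y" "\<And>x. x \<in> {0..pi} \<Longrightarrow> ?h integrable_on {0..x}"
    "\<And>x. x \<in> {0..pi} \<Longrightarrow> y x = y 0 + integral {0..x} ?h"
    using assms unfolding dirac_eq_def by blast+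
  show "continuous_on {0..pi} (\<lambda>x. cnj_vec (y x))"
    by (rule bounded_linear.continuous_on[OF bounded_linear_cnj_vec y(1)])
  have k: "?k = cnj_vec \<circ> ?h"
    by (simp add: fun_eq_iff dirac_rhs_def Jinv_def Qapp_def cnj_vec_def)
  fix x assume x: "x \<in> {0..pi}"
  show "?k integrable_on {0..x}"
    unfolding k by (rule integrable_linear[OF y(2)[OF x] bounded_linear_cnj_vec])
  have "cnj_vec (y x) = cnj_vec (y 0 + integral {0..x} ?h)" by (rule arg_cong[OF y(3)[OF x]])
  also have "\<dots> = cnj_vec (y 0) + cnj_vec (integral {0..x} ?h)"
    using bounded_linear_cnj_vec by (simp add: linear_simps)
  also have "cnj_vec (integral {0..x} ?h) = integral {0..x} ?k"
    unfolding k by (rule integral_linear[OF y(2)[OF x] bounded_linear_cnj_vec, symmetric])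
  finally show "cnj_vec (y x) = cnj_vec (y 0) + integral {0..x} ?k" .
qed

text \<open>For real t, conjugation turns eigenfunctions of the adjoint problem into solutions of
  the original equation with multiplier 1/\<rho>; these are the functions of u in the pairing
  identity.\<close>

lemma eigfun_cnj:
  assumes "eigfun p q t z y"
  shows "eigfun (cnj \<circ> p) (cnj \<circ> q) (- cnj t) (cnj z) (\<lambda>x. cnj_vec (y x))"
proof -
  have y: "sq_int (\<lambda>_. (0,0))" "dirac_eq p q z (\<lambda>_. (0,0)) y" "bc t y" "\<exists>x\<in>{0..pi}. y x \<noteq> (0,0)"
    using assms unfolding eigfun_def opeq_def by blast+
  have "bc (- cnj t) (\<lambda>x. cnj_vec (y x))"
    using y(3) by (simp add: bc_def cnj_vec_def cscale_def exp_cnj)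
  then show ?thesis
    using y(1,4) dirac_eq_cnj[OF y(2)] unfolding eigfun_def opeq_def cnj_vec_eq_0_iff by blast
qed

lemma l2norm_cong:
  assumes "\<And>x. x \<in> {0..pi} \<Longrightarrow> norm (f x) = norm (g x)"
  shows "l2norm f = l2norm g"
proof -
  have "l2sq f = l2sq g" unfolding l2sq_def by (rule nn_integral_cong) (simp add: assms)
  then show ?thesis by (simp add: l2norm_def)
qed

lemma wr_expansion: "cscale (wr u v) x = cscale (wr u x) v - cscale (wr v x) u"
  by (simp add: wr_def prod_eq_iff algebra_simps)

lemma norm_cvec_square: "(norm (v::cvec))\<^sup>2 = (norm (fst v))\<^sup>2 + (norm (snd v))\<^sup>2"
  by (simp add: norm_prod_def)

section \<open>Normalized eigenfunctions and the modulus of alpha\<close>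

context dirac
begin

definition energy :: "complex \<Rightarrow> cvec \<Rightarrow> real" where
  "energy z v = integral {0..pi} (\<lambda>x. (norm (fsol z v x))\<^sup>2)"

lemma energy_nonneg: "energy z v \<ge> 0"
  unfolding energy_def by (intro integral_nonneg integrable_continuous_real continuous_intros continuous_fsol) auto

lemma energy_scale: "energy z (cscale c v) = (norm c)\<^sup>2 * energy z v"
  unfolding energy_def fsol_scale norm_cscale power_mult_distrib by simp

lemma l2norm_fsol: "l2norm (fsol z v) = ennreal (sqrt (energy z v))"
proof -
  have c: "continuous_on {0..pi} (\<lambda>x. (norm (fsol z v x))\<^sup>2)"
    by (intro continuous_intros continuous_fsol)
  have "l2sq (fsol z v) = ennreal (integral\<^sup>L (lebesgue_on {0..pi}) (\<lambda>x. (norm (fsol z v x))\<^sup>2))"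
    unfolding l2sq_def by (rule nn_integral_eq_integral[OF continuous_imp_integrable_real[OF c]]) simp
  also have "\<dots> = ennreal (energy z v)"
    unfolding energy_def by (subst lebesgue_integral_eq_integral[OF continuous_imp_integrable_real[OF c]]) auto
  finally show ?thesis using energy_nonneg[of z v] by (simp add: l2norm_def)
qed

lemma energy_pos:
  assumes "v \<noteq> 0"
  shows "energy z v > 0"
proof (rule ccontr)
  assume "\<not> energy z v > 0"
  then have "energy z v = 0" using energy_nonneg[of z v] by simp
  then have "\<forall>x\<in>{0..pi}. (norm (fsol z v x))\<^sup>2 = 0"
    unfolding energy_def
    by (subst (asm) integral_eq_0_iff) (auto intro!: continuous_intros continuous_fsol)
  from bspec[OF this, of 0] show False using assms by simp
qed

lemma l2norm_fsol_eq_1_iff: "l2norm (fsol z v) = 1 \<longleftrightarrow> energy z v = 1"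
  unfolding l2norm_fsol using energy_nonneg[of z v] by (simp add: ennreal_eq_1)

lemma energy_le: "energy z v \<le> (norm v * exp ((\<bar>Im z\<bar> + 4 * qbd) * pi))\<^sup>2 * pi"
proof -
  have "energy z v \<le> integral {0..pi} (\<lambda>_. (norm v * exp ((\<bar>Im z\<bar> + 4 * qbd) * pi))\<^sup>2)"
    unfolding energy_def
    by (intro integral_le integrable_continuous_real continuous_intros continuous_fsol power_mono norm_fsol_le) auto
  then show ?thesis by (simp add: mult.commute)
qed

lemma continuous_on_energy [continuous_intros]:
  assumes "continuous_on A f" "continuous_on A g"
  shows "continuous_on A (\<lambda>s. energy (f s) (g s))"
proof -
  have "continuous_on (A \<times> cbox 0 pi) (\<lambda>u. (norm (fsol (f (fst u)) (g (fst u)) (snd u)))\<^sup>2)"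
    by (intro continuous_intros continuous_on_compose2[OF assms(1)] continuous_on_compose2[OF assms(2)]) auto
  then have "continuous_on A (\<lambda>s. integral (cbox 0 pi) (\<lambda>x. (norm (fsol (f s) (g s) x))\<^sup>2))"
    by (intro integral_continuous_on_param) (simp add: case_prod_unfold)
  then show ?thesis by (simp add: energy_def)
qed

lemma normalized_eigfun:
  assumes "hill z = 2 * cos (of_real pi * t)"
  shows "\<exists>y. eigfun p q t z y \<and> l2norm y = 1"
proof -
  obtain v where v: "v \<noteq> 0" "fsol z v pi = cscale (floquet t) v"
    using floquet_eigenvectors[OF assms] by blast
  define c where "c = complex_of_real (1 / sqrt (energy z v))"
  have c: "c \<noteq> 0" "(norm c)\<^sup>2 * energy z v = 1"
    using energy_pos[OF v(1), of z] by (simp_all add: c_def norm_divide power_divide)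
  have "cscale c v \<noteq> 0" using c(1) v(1) by (metis norm_cscale mult_eq_0_iff norm_eq_zero)
  moreover have "fsol z (cscale c v) pi = cscale (floquet t) (cscale c v)"
    unfolding fsol_scale v(2) by (simp add: cscale_def mult_ac)
  ultimately have "eigfun p q t z (fsol z (cscale c v))" by (rule eigfun_fsol)
  moreover have "l2norm (fsol z (cscale c v)) = 1"
    unfolding l2norm_fsol_eq_1_iff energy_scale by (rule c(2))
  ultimately show ?thesis by blast
qed

lemma normalized_eigfun_expansion:
  assumes "eigfun p q t z y" "l2norm y = 1"
  obtains v where "v \<noteq> 0" "fsol z v pi = cscale (floquet t) v" "\<And>x. x \<in> {0..pi} \<Longrightarrow> y x = fsol z v x" "energy z v = 1"
proof -
  obtain v where v: "v \<noteq> 0" "fsol z v pi = cscale (floquet t) v" "\<And>x. x \<in> {0..pi} \<Longrightarrow> y x = fsol z v x"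
    by (rule eigfun_expansion[OF assms(1)]) (rule that)
  have "l2norm (fsol z v) = l2norm y" by (rule l2norm_cong) (simp add: v(3))
  then have "energy z v = 1" using assms(2) l2norm_fsol_eq_1_iff by simp
  then show thesis using v that by blast
qed

text \<open>Whatever functions the choice operator picks, they come from eigenvectors of energy 1,
  the second after conjugation. The Hermitian inner product thereby becomes the bilinear integral of
  \<open>pairing_identity\<close>.\<close>

lemma alpha_abs_pairing:
  fixes t :: real
  assumes hill: "hill z = 2 * cos (of_real pi * of_real t)"
  obtains v u where "v \<noteq> 0" "fsol z v pi = cscale (floquet t) v" "energy z v = 1"
    "u \<noteq> 0" "fsol z u pi = cscale (inverse (floquet t)) u" "energy z u = 1"
    "alpha_abs p q (of_real t) z = norm (integral {0..pi} (\<lambda>x. dot (fsol z u x) (fsol z v x)))"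
proof -
  define \<Psi> where "\<Psi> = (SOME y. eigfun p q (of_real t) z y \<and> l2norm y = 1)"
  define \<Psi>s where "\<Psi>s = (SOME y. eigfun (cnj \<circ> p) (cnj \<circ> q) (cnj (of_real t)) (cnj z) y \<and> l2norm y = 1)"
  have \<Psi>: "eigfun p q (of_real t) z \<Psi> \<and> l2norm \<Psi> = 1"
    unfolding \<Psi>_def by (rule someI_ex[OF normalized_eigfun[OF hill]])
  have "hill z = 2 * cos (of_real pi * (- of_real t))" using hill by simp
  from normalized_eigfun[OF this] obtain y where y: "eigfun p q (- of_real t) z y" "l2norm y = 1" by blast
  have "eigfun (cnj \<circ> p) (cnj \<circ> q) (cnj (of_real t)) (cnj z) (\<lambda>x. cnj_vec (y x))"
    using eigfun_cnj[OF y(1)] by simp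
  moreover have "l2norm (\<lambda>x. cnj_vec (y x)) = 1" using y(2) l2norm_cong[of "\<lambda>x. cnj_vec (y x)" y] by simp
  ultimately have \<Psi>s: "eigfun (cnj \<circ> p) (cnj \<circ> q) (cnj (of_real t)) (cnj z) \<Psi>s \<and> l2norm \<Psi>s = 1"
    unfolding \<Psi>s_def by (intro someI_ex[of "\<lambda>y. eigfun (cnj \<circ> p) (cnj \<circ> q) (cnj (of_real t)) (cnj z) y \<and> l2norm y = 1"]) blast
  have cc: "cnj \<circ> (cnj \<circ> f) = f" for f :: "real \<Rightarrow> complex" by (simp add: fun_eq_iff)
  have "eigfun p q (- of_real t) z (\<lambda>x. cnj_vec (\<Psi>s x))"
    using eigfun_cnj[OF \<Psi>s[THEN conjunct1]] unfolding cc by simp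
  moreover have "l2norm (\<lambda>x. cnj_vec (\<Psi>s x)) = 1"
    using \<Psi>s l2norm_cong[of "\<lambda>x. cnj_vec (\<Psi>s x)" \<Psi>s] by simp
  ultimately obtain u where u: "u \<noteq> 0" "fsol z u pi = cscale (floquet (- of_real t)) u"
    "\<And>x. x \<in> {0..pi} \<Longrightarrow> cnj_vec (\<Psi>s x) = fsol z u x" "energy z u = 1"
    by (rule normalized_eigfun_expansion) (rule that)
  obtain v where v: "v \<noteq> 0" "fsol z v pi = cscale (floquet (of_real t)) v"
    "\<And>x. x \<in> {0..pi} \<Longrightarrow> \<Psi> x = fsol z v x" "energy z v = 1"
    by (rule normalized_eigfun_expansion[OF \<Psi>[THEN conjunct1] \<Psi>[THEN conjunct2]]) (rule that)
  have c: "continuous_on {0..pi} (\<lambda>x. dot (fsol z u x) (fsol z v x))"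
    by (intro continuous_intros continuous_fsol)
  have "l2inner \<Psi> \<Psi>s = integral\<^sup>L (lebesgue_on {0..pi}) (\<lambda>x. dot (fsol z u x) (fsol z v x))"
    unfolding l2inner_def
  proof (rule Bochner_Integration.integral_cong[OF refl])
    fix x assume "x \<in> space (lebesgue_on {0..pi})"
    then have x: "x \<in> {0..pi}" by simp
    show "fst (\<Psi> x) * cnj (fst (\<Psi>s x)) + snd (\<Psi> x) * cnj (snd (\<Psi>s x)) = dot (fsol z u x) (fsol z v x)"
      unfolding v(3)[OF x] u(3)[OF x, symmetric] by (simp add: dot_def cnj_vec_def mult.commute)
  qed
  also have "\<dots> = integral {0..pi} (\<lambda>x. dot (fsol z u x) (fsol z v x))"
    by (rule lebesgue_integral_eq_integral[OF continuous_imp_integrable_real[OF c]]) simp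
  finally have "alpha_abs p q (of_real t) z = norm (integral {0..pi} (\<lambda>x. dot (fsol z u x) (fsol z v x)))"
    unfolding alpha_abs_def Let_def \<Psi>_def[symmetric] \<Psi>s_def[symmetric] by simp
  then show thesis using that v(1,2,4) u(1,2,4) by (simp add: inverse_floquet)
qed

text \<open>For the multiplier \<open>\<rho>\<close>, eigenvectors v, u of the monodromy matrix M to \<open>\<rho>\<close>, \<open>1/\<rho>\<close> satisfy
  \<open>(M - 1/\<rho>) J\<^sup>-\<^sup>1 = k v u\<^sup>T\<close>, and \<open>1/\<bar>\<alpha>\<bar> = \<bar>k\<bar> / \<bar>F'\<bar>\<close> when v, u have energy 1. The energies of the columns
  and rows of this matrix give \<open>\<bar>k\<bar>\<close> as a measurable function, without choosing eigenvectors.\<close>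

definition proj_norm :: "complex \<Rightarrow> real \<Rightarrow> real" where
  "proj_norm z t = (let \<sigma> = inverse (floquet (of_real t)) in
     sqrt ((energy z (m12 z, m22 z - \<sigma>) + energy z (\<sigma> - m11 z, - m21 z)) *
       (energy z (m12 z, \<sigma> - m11 z) + energy z (m22 z - \<sigma>, - m21 z)) /
       ((norm (m12 z))\<^sup>2 + (norm (m22 z - \<sigma>))\<^sup>2 + (norm (\<sigma> - m11 z))\<^sup>2 + (norm (m21 z))\<^sup>2)))"

lemma inverse_alpha_abs:
  fixes t :: real
  assumes sin: "sin (of_real pi * of_real t :: complex) \<noteq> 0" and hill: "hill z = 2 * cos (of_real pi * of_real t)"
  shows "1 / alpha_abs p q (of_real t) z = proj_norm z t / norm (deriv hill z)"
    and "proj_norm z t \<le> pi * (exp ((\<bar>Im z\<bar> + 4 * qbd) * pi))\<^sup>2 *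
      sqrt ((norm (m12 z))\<^sup>2 + (norm (m22 z - inverse (floquet (of_real t))))\<^sup>2 +
        (norm (inverse (floquet (of_real t)) - m11 z))\<^sup>2 + (norm (m21 z))\<^sup>2)"
proof -
  define \<rho> \<sigma> where "\<rho> = floquet (of_real t)" and "\<sigma> = inverse \<rho>"
  have \<rho>\<sigma>: "\<rho> \<noteq> 0" "\<rho> \<noteq> \<sigma>" using floquet_diff[of "of_real t"] sin by (auto simp: \<rho>_def \<sigma>_def)
  obtain v u where v: "v \<noteq> 0" "fsol z v pi = cscale \<rho> v" "energy z v = 1"
    and u: "u \<noteq> 0" "fsol z u pi = cscale \<sigma> u" "energy z u = 1"
    and \<alpha>: "alpha_abs p q (of_real t) z = norm (integral {0..pi} (\<lambda>x. dot (fsol z u x) (fsol z v x)))"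
    by (rule alpha_abs_pairing[OF hill, folded \<rho>_def, folded \<sigma>_def]) (rule that)
  have wuv: "wr u v \<noteq> 0" by (rule wr_eigenvectors_nonzero[OF \<rho>\<sigma>(2) v(1) u(1) v(2) u(2)])
  \<comment> \<open>The number for which M(z) - \<sigma> is the rank-one map x \<mapsto> k
    \<open>wr u x\<close> v: it kills u and multiplies v by \<rho> - \<sigma>.\<close>
  define k where "k = (\<rho> - \<sigma>) / wr u v"
  have k0: "k \<noteq> 0" using \<rho>\<sigma> wuv by (simp add: k_def)
  have M: "fsol z x pi - cscale \<sigma> x = cscale (k * wr u x) v" for x
  proof -
    have "cscale (wr u v) (fsol z x pi - cscale \<sigma> x) = fsol z (cscale (wr u v) x) pi - cscale \<sigma> (cscale (wr u v) x)"
      unfolding fsol_scale by (simp add: prod_eq_iff algebra_simps)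
    also have "\<dots> = cscale (wr u x * (\<rho> - \<sigma>)) v"
    proof -
      have ex: "cscale (wr u v) x = cscale (wr u x) v + cscale (- wr v x) u"
        unfolding wr_expansion[of u v x] by (simp add: prod_eq_iff)
      show ?thesis
        unfolding ex unfolding fsol_add unfolding fsol_scale v(2) u(2)
        by (simp add: prod_eq_iff algebra_simps)
    qed
    finally have "cscale (wr u v) (fsol z x pi - cscale \<sigma> x) = cscale (wr u x * (\<rho> - \<sigma>)) v" .
    then have "cscale (1 / wr u v) (cscale (wr u v) (fsol z x pi - cscale \<sigma> x)) = cscale (1 / wr u v) (cscale (wr u x * (\<rho> - \<sigma>)) v)"
      by (rule arg_cong)
    then show ?thesis using wuv by (simp add: k_def prod_eq_iff)
  qed
  \<comment> \<open>The vectors (0, 1) and (-1, 0) are the images of the unit vectors under the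
    inverse of J; so the columns are multiples of v, and the rows of u.\<close>
  have c1: "(m12 z, m22 z - \<sigma>) = cscale (k * fst u) v"
    using M[of "(0,1)"] by (simp add: fsol_pi wr_def cscale_def)
  have c2: "(\<sigma> - m11 z, - m21 z) = cscale (k * snd u) v"
    using M[of "(-1,0)"] by (simp add: fsol_pi wr_def cscale_def)
  have e: "m12 z = k * fst u * fst v" "m22 z - \<sigma> = k * fst u * snd v" "\<sigma> - m11 z = k * snd u * fst v" "- m21 z = k * snd u * snd v"
    using c1 c2 by (simp_all add: cscale_def)
  have r1: "(m12 z, \<sigma> - m11 z) = cscale (k * fst v) u" "(m22 z - \<sigma>, - m21 z) = cscale (k * snd v) u"
    unfolding e by (simp_all add: cscale_def mult_ac)
  have n: "norm (m21 z) = norm (- m21 z)" by simp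
  \<comment> \<open>The squared Frobenius norm of M(z) - \<sigma>, which for a rank-one matrix is
    |k|^2 |u|^2 |v|^2.\<close>
  define H where "H = (norm (m12 z))\<^sup>2 + (norm (m22 z - \<sigma>))\<^sup>2 + (norm (\<sigma> - m11 z))\<^sup>2 + (norm (m21 z))\<^sup>2"
  have H: "H = (norm k)\<^sup>2 * (norm u)\<^sup>2 * (norm v)\<^sup>2"
    unfolding H_def n e norm_cvec_square by (simp add: norm_mult power_mult_distrib algebra_simps)
  have pos: "norm k > 0" "norm u > 0" "norm v > 0" using k0 u v by auto
  have "proj_norm z t = sqrt ((((norm k)\<^sup>2 * (norm u)\<^sup>2) * ((norm k)\<^sup>2 * (norm v)\<^sup>2)) / H)"
    unfolding proj_norm_def Let_def \<rho>_def[symmetric] \<sigma>_def[symmetric] H_def[symmetric] c1 c2 r1 energy_scale u(3) v(3)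
    unfolding norm_cvec_square[of u] norm_cvec_square[of v] by (simp add: norm_mult power_mult_distrib algebra_simps)
  also have "\<dots> = sqrt ((norm k)\<^sup>2)" unfolding H using pos by (simp add: power2_eq_square)
  finally have pk: "proj_norm z t = norm k" by simp
  have "(\<rho> - \<sigma>) * integral {0..pi} (\<lambda>x. dot (fsol z u x) (fsol z v x)) = deriv hill z * wr u v"
    unfolding \<sigma>_def by (rule pairing_identity[OF \<rho>\<sigma>(1) v(2) u(2)[unfolded \<sigma>_def]])
  then have "k * integral {0..pi} (\<lambda>x. dot (fsol z u x) (fsol z v x)) = deriv hill z"
    using wuv by (simp add: k_def)
  then have "norm k * alpha_abs p q (of_real t) z = norm (deriv hill z)"
    unfolding \<alpha> norm_mult[symmetric] by simp
  \<comment> \<open>\<alpha> and \<open>deriv hill z\<close> vanish together, and then both sides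
    are 0 by the convention for division by zero.\<close>
  then show "1 / alpha_abs p q (of_real t) z = proj_norm z t / norm (deriv hill z)"
    unfolding pk using pos(1) by (auto simp: divide_simps)
  define G where "G = exp ((\<bar>Im z\<bar> + 4 * qbd) * pi)"
  \<comment> \<open>A solution of energy 1 cannot have a small initial value; hence |k| is bounded
    by a multiple of |k| |u| |v| = sqrt H.\<close>
  have one: "1 \<le> norm x * G * sqrt pi" if "energy z x = 1" for x
  proof -
    have "1\<^sup>2 \<le> (norm x * G * sqrt pi)\<^sup>2" using energy_le[of z x] that by (simp add: G_def power_mult_distrib)
    then show ?thesis by (rule power2_le_imp_le) (simp add: G_def)
  qed
  have "norm k * (1 * 1) \<le> norm k * ((norm u * G * sqrt pi) * (norm v * G * sqrt pi))"
    by (intro mult_left_mono mult_mono one u(3) v(3)) (auto simp: G_def)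
  also have "\<dots> = pi * G\<^sup>2 * (norm k * norm u * norm v)" by (simp add: power2_eq_square mult_ac)
  also have "norm k * norm u * norm v = sqrt H" unfolding H by (simp add: real_sqrt_mult)
  finally have "norm k \<le> pi * G\<^sup>2 * sqrt H" by simp
  then show "proj_norm z t \<le> pi * (exp ((\<bar>Im z\<bar> + 4 * qbd) * pi))\<^sup>2 *
      sqrt ((norm (m12 z))\<^sup>2 + (norm (m22 z - inverse (floquet (of_real t))))\<^sup>2 +
        (norm (inverse (floquet (of_real t)) - m11 z))\<^sup>2 + (norm (m21 z))\<^sup>2)"
    unfolding pk G_def H_def \<sigma>_def \<rho>_def .
qed

text \<open>Numerator and denominator under the root are jointly continuous in the spectral
  parameter and t. Measurability, unlike continuity, survives zeros of the denominator.\<close>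

lemma borel_measurable_proj_norm [measurable (raw)]:
  assumes "f \<in> borel_measurable M" "g \<in> borel_measurable M"
  shows "(\<lambda>s. proj_norm (f s) (g s)) \<in> borel_measurable M"
proof -
  have ch: "continuous_on UNIV m11" "continuous_on UNIV m12" "continuous_on UNIV m21" "continuous_on UNIV m22"
    by (intro holomorphic_on_imp_continuous_on holomorphic_monodromy)+
  note ci = continuous_intros continuous_on_compose2[OF ch(1)] continuous_on_compose2[OF ch(2)]
    continuous_on_compose2[OF ch(3)] continuous_on_compose2[OF ch(4)]
  have fl: "continuous_on UNIV (\<lambda>u::complex \<times> real. floquet (of_real (snd u)))"
    unfolding floquet_def by (intro continuous_intros)
  have b: "F \<in> borel_measurable (borel \<Otimes>\<^sub>M borel)" if "continuous_on UNIV F" for F :: "complex \<times> real \<Rightarrow> real"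
    using borel_measurable_continuous_onI[OF that] by (simp add: borel_prod)
  let ?s = "\<lambda>u::complex \<times> real. inverse (floquet (of_real (snd u)))"
  have "(\<lambda>u. (energy (fst u) (m12 (fst u), m22 (fst u) - ?s u) + energy (fst u) (?s u - m11 (fst u), - m21 (fst u))) *
      (energy (fst u) (m12 (fst u), ?s u - m11 (fst u)) + energy (fst u) (m22 (fst u) - ?s u, - m21 (fst u))))
      \<in> borel_measurable (borel \<Otimes>\<^sub>M borel)"
    by (rule b) (intro ci fl; simp)
  moreover have "(\<lambda>u. (norm (m12 (fst u)))\<^sup>2 + (norm (m22 (fst u) - ?s u))\<^sup>2 + (norm (?s u - m11 (fst u)))\<^sup>2 +
      (norm (m21 (fst u)))\<^sup>2) \<in> borel_measurable (borel \<Otimes>\<^sub>M borel)"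
    by (rule b) (intro ci fl; simp)
  ultimately have "(\<lambda>u::complex \<times> real. proj_norm (fst u) (snd u)) \<in> borel_measurable (borel \<Otimes>\<^sub>M borel)"
    unfolding proj_norm_def Let_def by measurable
  moreover have "(\<lambda>s. (f s, g s)) \<in> M \<rightarrow>\<^sub>M borel \<Otimes>\<^sub>M borel" using assms by measurable
  ultimately have "(\<lambda>u. proj_norm (fst u) (snd u)) \<circ> (\<lambda>s. (f s, g s)) \<in> borel_measurable M"
    by (intro measurable_comp)
  then show ?thesis by (simp add: o_def)
qed

end

section \<open>Integrability of 1/alpha\<close>

lemma sin_pi_of_real_eq_0_iff: "sin (of_real pi * of_real t :: complex) = 0 \<longleftrightarrow> sin (pi * t) = 0"
  by (metis of_real_mult sin_of_real of_real_eq_0_iff)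

lemma isCont_tendsto_nhds: "isCont f a \<Longrightarrow> (f \<longlongrightarrow> f a) (nhds a)"
  by (simp add: isCont_def tendsto_at_iff_tendsto_nhds)

text \<open>At a zero of order n one has f = (z - w)^n g and f' = (z - w)^(n-1) h, where h w = n g w
  \<noteq> 0. Hence |f'| is comparable to |f| to the power (n - 1) / n.\<close>

lemma deriv_lower_bound_near_zero:
  fixes f :: "complex \<Rightarrow> complex"
  assumes f: "f holomorphic_on UNIV" and nc: "\<not> f constant_on UNIV" and "f w = 0"
  obtains r \<kappa> \<beta> where "r > 0" "\<kappa> > 0" "0 \<le> \<beta>" "\<beta> < 1"
    "\<And>z. z \<in> ball w r \<Longrightarrow> \<kappa> * norm (f z) powr \<beta> \<le> norm (deriv f z)"
proof -
  obtain g s n where n: "0 < n" and s: "0 < s" and g: "g holomorphic_on ball w s"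
    and fg: "\<And>z. z \<in> ball w s \<Longrightarrow> f z = (z - w) ^ n * g z" and gn: "\<And>z. z \<in> ball w s \<Longrightarrow> g z \<noteq> 0"
    by (rule holomorphic_factor_zero_nonconstant[OF f open_UNIV connected_UNIV UNIV_I \<open>f w = 0\<close> nc]) (rule that)
  define h where "h = (\<lambda>z. of_nat n * g z + (z - w) * deriv g z)"
  have df: "deriv f z = (z - w) ^ (n - 1) * h z" if z: "z \<in> ball w s" for z
  proof -
    have "(g has_field_derivative deriv g z) (at z)" by (rule holomorphic_derivI[OF g open_ball z])
    moreover obtain m where m: "n = Suc m" using n by (cases n) auto
    have "((\<lambda>z. (z - w) ^ n) has_field_derivative of_nat n * (z - w) ^ m) (at z)"
    proof -
      have "((\<lambda>z. z - w) has_field_derivative 1) (at z)" by (auto intro!: derivative_eq_intros)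
      from DERIV_power[OF this, of n] show ?thesis by (simp add: m)
    qed
    ultimately have "((\<lambda>z. (z - w) ^ n * g z) has_field_derivative
        of_nat n * (z - w) ^ m * g z + deriv g z * (z - w) ^ n) (at z)" by (intro DERIV_mult)
    moreover have "of_nat n * (z - w) ^ m * g z + deriv g z * (z - w) ^ n = (z - w) ^ (n - 1) * h z"
      unfolding m h_def power_Suc diff_Suc_1 by (simp only: distrib_left mult_ac)
    ultimately have "((\<lambda>z. (z - w) ^ n * g z) has_field_derivative (z - w) ^ (n - 1) * h z) (at z)" by simp
    moreover have "\<forall>\<^sub>F x in nhds z. f x = (x - w) ^ n * g x"
      by (rule eventually_nhds_in_open[THEN eventually_mono, OF open_ball z]) (rule fg)
    ultimately have "(f has_field_derivative (z - w) ^ (n - 1) * h z) (at z)"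
      by (subst DERIV_cong_ev[OF refl _ refl])
    then show ?thesis by (rule DERIV_imp_deriv)
  qed
  have w: "w \<in> ball w s" using s by simp
  have "continuous_on (ball w s) g" "continuous_on (ball w s) h"
    unfolding h_def by (intro continuous_intros holomorphic_on_imp_continuous_on g holomorphic_deriv open_ball)+
  then have cg: "isCont g w" and ch: "isCont h w"
    using w by (simp_all add: continuous_on_eq_continuous_at)
  have hw: "h w \<noteq> 0" using gn[OF w] n by (simp add: h_def)
  have "norm (h w) / 2 < norm (h w)" "norm (g w) < norm (g w) + 1" using hw by simp_all
  then have "\<forall>\<^sub>F z in nhds w. norm (h z) > norm (h w) / 2" "\<forall>\<^sub>F z in nhds w. norm (g z) < norm (g w) + 1"
    using order_tendstoD(1)[OF tendsto_norm[OF isCont_tendsto_nhds[OF ch]]]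
      order_tendstoD(2)[OF tendsto_norm[OF isCont_tendsto_nhds[OF cg]]] by blast+
  then have "\<forall>\<^sub>F z in nhds w. norm (h z) > norm (h w) / 2 \<and> norm (g z) < norm (g w) + 1"
    by (rule eventually_conj)
  then obtain r0 where r0: "r0 > 0" "\<And>z. dist z w < r0 \<Longrightarrow> norm (h z) > norm (h w) / 2 \<and> norm (g z) < norm (g w) + 1"
    unfolding eventually_nhds_metric by blast
  define \<beta> where "\<beta> = real (n - 1) / real n"
  define C where "C = (norm (g w) + 1) powr \<beta>"
  have C: "C > 0" by (simp add: C_def add_nonneg_eq_0_iff)
  have \<beta>: "0 \<le> \<beta>" "\<beta> < 1" using n by (simp_all add: \<beta>_def)
  show thesis
  proof (rule that[of "min r0 s" "norm (h w) / 2 / C" \<beta>])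
    show "0 < min r0 s" using r0 s by simp
    show "0 < norm (h w) / 2 / C" using hw C by simp
    show "0 \<le> \<beta>" "\<beta> < 1" by (rule \<beta>)+
    fix z assume z: "z \<in> ball w (min r0 s)"
    then have zs: "z \<in> ball w s" and zr: "norm (h z) > norm (h w) / 2" "norm (g z) < norm (g w) + 1"
      using r0(2)[of z] by (auto simp: dist_commute)
    show "norm (h w) / 2 / C * norm (f z) powr \<beta> \<le> norm (deriv f z)"
    \<comment> \<open>At w the left side is 0 also for \<beta> = 0, because 0 \<open>powr\<close> 0
      is 0.\<close>
    proof (cases "z = w")
      case True
      then show ?thesis using \<open>f w = 0\<close> by simp
    next
      case False
      have "norm (f z) powr \<beta> = (norm (z - w) ^ n) powr \<beta> * norm (g z) powr \<beta>"
        by (simp add: fg[OF zs] norm_mult norm_power powr_mult)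
      also have "(norm (z - w) ^ n) powr \<beta> = norm (z - w) ^ (n - 1)"
        using False n by (simp add: powr_realpow[symmetric] powr_powr \<beta>_def)
      also have "norm (z - w) ^ (n - 1) * norm (g z) powr \<beta> \<le> norm (z - w) ^ (n - 1) * C"
        unfolding C_def using zr \<beta> by (intro mult_left_mono powr_mono2) auto
      finally have "norm (h w) / 2 / C * norm (f z) powr \<beta> \<le> norm (h w) / 2 / C * (norm (z - w) ^ (n - 1) * C)"
        using C by (intro mult_left_mono) auto
      also have "\<dots> = norm (z - w) ^ (n - 1) * (norm (h w) / 2)" using C by simp
      also have "\<dots> \<le> norm (z - w) ^ (n - 1) * norm (h z)" using zr by (intro mult_left_mono) auto
      also have "\<dots> = norm (deriv f z)" by (simp add: df[OF zs] norm_mult norm_power)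
      finally show ?thesis .
    qed
  qed
qed

text \<open>K may contain several roots of f = c, of different orders. If no constants worked, a
  sequence of counterexamples would accumulate at such a root and contradict the local bound
  there.\<close>

lemma deriv_lower_bound_compact:
  fixes f :: "complex \<Rightarrow> complex"
  assumes f: "f holomorphic_on UNIV" and nc: "\<not> f constant_on UNIV" and K: "compact K"
  obtains \<eta> \<kappa> \<beta> where "\<eta> > 0" "\<kappa> > 0" "0 \<le> \<beta>" "\<beta> < 1"
    "\<And>z. z \<in> K \<Longrightarrow> norm (f z - c) < \<eta> \<Longrightarrow> \<kappa> * norm (f z - c) powr \<beta> \<le> norm (deriv f z)"
proof -
  \<comment> \<open>One integer governs all three constants, so that a single sequence of
    counterexamples suffices.\<close>
  have "\<exists>n. \<forall>z\<in>K. norm (f z - c) < 1 / real (Suc n) \<longrightarrow>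
     1 / real (Suc n) * norm (f z - c) powr (1 - 1 / real (Suc n)) \<le> norm (deriv f z)"
  proof (rule ccontr)
    assume neg: "\<not> ?thesis"
    have "\<forall>n. \<exists>z. z \<in> K \<and> norm (f z - c) < 1 / real (Suc n) \<and>
      norm (deriv f z) < 1 / real (Suc n) * norm (f z - c) powr (1 - 1 / real (Suc n))"
      using neg by (auto simp: not_le)
    from choice[OF this] obtain z where z: "\<forall>n. z n \<in> K \<and> norm (f (z n) - c) < 1 / real (Suc n) \<and>
      norm (deriv f (z n)) < 1 / real (Suc n) * norm (f (z n) - c) powr (1 - 1 / real (Suc n))" ..
    obtain w \<phi> where w: "w \<in> K" "strict_mono \<phi>" "(z \<circ> \<phi>) \<longlonglongrightarrow> w"
      using K z unfolding compact_def by meson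
    have inv: "(\<lambda>n. 1 / real (Suc (\<phi> n))) \<longlonglongrightarrow> 0"
      using LIMSEQ_subseq_LIMSEQ[OF LIMSEQ_inverse_real_of_nat w(2)] by (simp add: o_def inverse_eq_divide)
    have cf: "isCont f w"
      using holomorphic_on_imp_continuous_on[OF f] by (simp add: continuous_on_eq_continuous_at)
    have "(\<lambda>n. f (z (\<phi> n))) \<longlonglongrightarrow> f w" using isCont_tendsto_compose[OF cf w(3)] by (simp add: o_def)
    moreover have "(\<lambda>n. f (z (\<phi> n)) - c) \<longlonglongrightarrow> 0"
      by (rule Lim_null_comparison[OF _ inv]) (use z less_imp_le in \<open>auto intro!: always_eventually\<close>)
    then have "(\<lambda>n. f (z (\<phi> n))) \<longlonglongrightarrow> c" by (simp add: LIM_zero_iff)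
    ultimately have fw: "f w = c" by (rule LIMSEQ_unique)
    have f': "(\<lambda>z. f z - c) holomorphic_on UNIV" by (intro holomorphic_intros f)
    have nc': "\<not> (\<lambda>z. f z - c) constant_on UNIV"
    proof
      assume "(\<lambda>z. f z - c) constant_on UNIV"
      then obtain d where "\<And>z. f z - c = d" unfolding constant_on_def by blast
      then have "\<And>z. f z = d + c" by (simp add: algebra_simps)
      then show False using nc unfolding constant_on_def by blast
    qed
    obtain r \<kappa> \<beta> where r: "r > 0" "\<kappa> > 0" "0 \<le> \<beta>" "\<beta> < 1"
      "\<And>z. z \<in> ball w r \<Longrightarrow> \<kappa> * norm (f z - c) powr \<beta> \<le> norm (deriv (\<lambda>z. f z - c) z)"
      by (rule deriv_lower_bound_near_zero[OF f' nc', of w]) (use fw that in auto)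
    have df: "deriv (\<lambda>z. f z - c) z = deriv f z" for z
    proof -
      have "(f has_field_derivative deriv f z) (at z)" by (rule holomorphic_derivI[OF f open_UNIV UNIV_I])
      then have "((\<lambda>z. f z - c) has_field_derivative deriv f z) (at z)" by (auto intro!: derivative_eq_intros)
      then show ?thesis by (rule DERIV_imp_deriv)
    qed
    have "\<forall>\<^sub>F n in sequentially. z (\<phi> n) \<in> ball w r"
      using tendstoD[OF w(3) r(1)] by (simp add: dist_commute)
    moreover have "\<forall>\<^sub>F n in sequentially. 1 / real (Suc (\<phi> n)) < min \<kappa> (1 - \<beta>)"
      using r by (intro order_tendstoD(2)[OF inv]) auto
    ultimately have "\<forall>\<^sub>F n in sequentially. False"
    proof eventually_elim
      case (elim n)
      define x e where "x = norm (f (z (\<phi> n)) - c)" and "e = 1 / real (Suc (\<phi> n))"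
      have zn: "x < e" "norm (deriv f (z (\<phi> n))) < e * x powr (1 - e)"
        using z[THEN spec, of "\<phi> n"] unfolding x_def e_def by blast+
      have e: "e < \<kappa>" "e < 1 - \<beta>" "e > 0" "e \<le> 1" using elim(2) by (auto simp: e_def)
      \<comment> \<open>Eventually e < \<kappa> and 1 - e > \<beta>; as x < 1, the larger exponent
        gives the smaller power, and the counterexample satisfies the local bound.\<close>
      have "e * x powr (1 - e) \<le> \<kappa> * x powr \<beta>"
      proof (rule mult_mono)
        show "x powr (1 - e) \<le> x powr \<beta>"
          by (rule powr_mono') (use zn e in \<open>auto simp: x_def\<close>)
      qed (use e r in auto)
      also have "\<dots> \<le> norm (deriv f (z (\<phi> n)))" using r(5)[OF elim(1)] by (simp add: df x_def)
      finally show ?case using zn by simp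
    qed
    then show False by simp
  qed
  then obtain n where n: "\<And>z. z \<in> K \<Longrightarrow> norm (f z - c) < 1 / real (Suc n) \<Longrightarrow>
     1 / real (Suc n) * norm (f z - c) powr (1 - 1 / real (Suc n)) \<le> norm (deriv f z)" by blast
  show thesis
    by (rule that[of "1 / real (Suc n)" "1 / real (Suc n)" "1 - 1 / real (Suc n)"]) (use n in auto)
qed

text \<open>The singular function is dominated by the sum of a translate and a reflected translate
  of the one-sided power.\<close>

lemma set_integrable_abs_powr:
  assumes "0 \<le> \<beta>" "\<beta> < 1" "\<delta> > 0"
  shows "integrable lborel (\<lambda>t::real. indicator {t0 - \<delta><..<t0 + \<delta>} t * (C * \<bar>t - t0\<bar> powr (- \<beta>)))"
proof -
  define f where "f = (\<lambda>x::real. indicator {0..\<delta>} x * x powr (- \<beta>))"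
  have "(\<lambda>x. x powr (- \<beta>)) integrable_on {0..\<delta>}"
    using has_integral_powr_from_0[of "- \<beta>" \<delta>] assms by (auto simp: integrable_on_def)
  then have "(\<lambda>x. x powr (- \<beta>)) absolutely_integrable_on {0..\<delta>}"
    by (rule nonnegative_absolutely_integrable_1) simp
  then have "integrable lebesgue f" by (simp add: f_def set_integrable_def)
  moreover have fm: "f \<in> borel_measurable lborel" unfolding f_def by measurable
  ultimately have "integrable lborel f" by (simp add: integrable_completion)
  then have "integrable lborel (\<lambda>t. f (- t0 + 1 * t))" "integrable lborel (\<lambda>t. f (t0 + (-1) * t))"
    by (intro lborel_integrable_real_affine; simp)+
  then have i: "integrable lborel (\<lambda>t. \<bar>C\<bar> * (f (- t0 + 1 * t) + f (t0 + (-1) * t)))" by simp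
  show ?thesis
  proof (rule Bochner_Integration.integrable_bound[OF i])
    show "(\<lambda>t::real. indicator {t0 - \<delta><..<t0 + \<delta>} t * (C * \<bar>t - t0\<bar> powr (- \<beta>))) \<in> borel_measurable lborel"
      by measurable
    have f0: "f x \<ge> 0" for x by (simp add: f_def)
    have "norm (indicator {t0 - \<delta><..<t0 + \<delta>} t * (C * \<bar>t - t0\<bar> powr (- \<beta>)))
      \<le> norm (\<bar>C\<bar> * (f (- t0 + 1 * t) + f (t0 + (-1) * t)))" for t
    proof (cases "t \<in> {t0 - \<delta><..<t0 + \<delta>}")
      case True
      have "\<bar>t - t0\<bar> powr (- \<beta>) \<le> f (- t0 + 1 * t) + f (t0 + (-1) * t)"
      proof (cases "t \<ge> t0")
        case t: True
        then have "f (- t0 + 1 * t) = \<bar>t - t0\<bar> powr (- \<beta>)" using True by (auto simp: f_def)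
        then show ?thesis using f0 by simp
      next
        case t: False
        then have "f (t0 + (-1) * t) = \<bar>t - t0\<bar> powr (- \<beta>)" using True by (auto simp: f_def)
        then show ?thesis using f0[of "- t0 + 1 * t"] by simp
      qed
      then have "\<bar>C\<bar> * \<bar>t - t0\<bar> powr (- \<beta>) \<le> \<bar>C\<bar> * (f (- t0 + 1 * t) + f (t0 + (-1) * t))"
        by (rule mult_left_mono) simp
      then show ?thesis using True add_nonneg_nonneg[OF f0 f0, of "- t0 + 1 * t" "t0 + (-1) * t"] by (simp add: abs_mult)
    qed simp
    then show "AE t in lborel. norm (indicator {t0 - \<delta><..<t0 + \<delta>} t * (C * \<bar>t - t0\<bar> powr (- \<beta>)))
      \<le> norm (\<bar>C\<bar> * (f (- t0 + 1 * t) + f (t0 + (-1) * t)))" by simp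
  qed
qed

lemma cos_pi_separation:
  fixes t0 :: real
  assumes "sin (pi * t0) \<noteq> 0"
  obtains \<delta> \<kappa> where "\<delta> > 0" "\<kappa> > 0" "\<And>t. \<bar>t - t0\<bar> < \<delta> \<Longrightarrow> \<kappa> * \<bar>t - t0\<bar> \<le> \<bar>2 * cos (pi * t) - 2 * cos (pi * t0)\<bar>"
proof -
  let ?D = "- (2 * pi * sin (pi * t0))"
  have "((\<lambda>t. 2 * cos (pi * t)) has_real_derivative ?D) (at t0)"
    by (auto intro!: derivative_eq_intros)
  then have "((\<lambda>t. \<bar>(2 * cos (pi * t) - 2 * cos (pi * t0)) / (t - t0)\<bar>) \<longlongrightarrow> \<bar>?D\<bar>) (at t0)"
    unfolding has_field_derivative_iff by (rule tendsto_rabs)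
  moreover have D: "\<bar>?D\<bar> / 2 < \<bar>?D\<bar>" using assms by simp
  ultimately have "\<forall>\<^sub>F t in at t0. \<bar>?D\<bar> / 2 < \<bar>(2 * cos (pi * t) - 2 * cos (pi * t0)) / (t - t0)\<bar>"
    by (rule order_tendstoD(1))
  then obtain d where d: "d > 0" "\<And>t. t \<noteq> t0 \<Longrightarrow> dist t t0 < d \<Longrightarrow> \<bar>?D\<bar> / 2 < \<bar>(2 * cos (pi * t) - 2 * cos (pi * t0)) / (t - t0)\<bar>"
    unfolding eventually_at by blast
  show thesis
  proof (rule that[of d "\<bar>?D\<bar> / 2"])
    show "d > 0" by (rule d(1))
    show "\<bar>?D\<bar> / 2 > 0" using assms by simp
    fix t assume t: "\<bar>t - t0\<bar> < d"
    show "\<bar>?D\<bar> / 2 * \<bar>t - t0\<bar> \<le> \<bar>2 * cos (pi * t) - 2 * cos (pi * t0)\<bar>"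
    proof (cases "t = t0")
      case False
      then have "\<bar>?D\<bar> / 2 \<le> \<bar>2 * cos (pi * t) - 2 * cos (pi * t0)\<bar> / \<bar>t - t0\<bar>"
        using d(2)[of t] t by (simp add: dist_real_def abs_divide)
      then show ?thesis using False by (simp add: pos_le_divide_eq)
    qed simp
  qed
qed

section \<open>Labelled eigenvalues near a non-integer parameter\<close>

context dirac
begin

lemma hill_not_constant_on: "\<not> hill constant_on UNIV"
  unfolding constant_on_def using hill_not_constant by blast

text \<open>The connected image meets the large open square T and avoids its frontier, so it stays
  inside.\<close>

lemma eigenvalue_curve_bounded:
  fixes L :: "real \<Rightarrow> complex"
  assumes S: "connected S" and L: "continuous_on S L" and c: "c < 2"
    and hill: "\<And>t. t \<in> S \<Longrightarrow> norm (hill (L t)) \<le> c"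
  shows "bounded (L ` S)"
proof (cases "S = {}")
  case False
  then obtain s where s: "s \<in> S" by blast
  obtain R where R: "R > 0" "\<And>z. R \<le> norm z \<Longrightarrow> exp (pi * \<bar>Im z\<bar>) / 2 - 1 \<le> norm (hill z)"
    "\<And>c. c < 2 \<Longrightarrow> \<exists>N. \<forall>z. N \<le> norm z \<longrightarrow> Re z \<in> \<int> \<longrightarrow> c < norm (hill z)"
    by (rule hill_lower_bounds) (rule that)
  obtain N where N: "\<And>z. N \<le> norm z \<Longrightarrow> Re z \<in> \<int> \<Longrightarrow> c < norm (hill z)" using R(3)[OF c] by blast
  \<comment> \<open>The integer n puts the vertical sides on integer lines, lies beyond the radii N
    and R of the two lower bounds, and leaves \<open>L s\<close> inside the square.\<close>
  obtain n :: nat where n: "max (max N R) (max (norm (L s)) 2) < real n" using reals_Archimedean2 by blast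
  define T where "T = {z. \<bar>Re z\<bar> < real n \<and> \<bar>Im z\<bar> < real n}"
  have "open T" unfolding T_def by (intro open_Collect_conj open_Collect_less continuous_intros)
  have "closed {z. \<bar>Re z\<bar> \<le> real n \<and> \<bar>Im z\<bar> \<le> real n}"
    by (intro closed_Collect_conj closed_Collect_le continuous_intros)
  then have "closure T \<subseteq> {z. \<bar>Re z\<bar> \<le> real n \<and> \<bar>Im z\<bar> \<le> real n}"
    by (intro closure_minimal) (auto simp: T_def)
  then have fr: "\<bar>Re z\<bar> = real n \<or> \<bar>Im z\<bar> = real n" if "z \<in> frontier T" for z
  proof -
    have "z \<in> closure T" "z \<notin> T" using that interior_open[OF \<open>open T\<close>] by (simp_all add: frontier_def)
    moreover have "\<bar>Re z\<bar> \<le> real n \<and> \<bar>Im z\<bar> \<le> real n"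
      using subsetD[OF \<open>closure T \<subseteq> _\<close> \<open>z \<in> closure T\<close>] by simp
    ultimately show ?thesis unfolding T_def mem_Collect_eq by linarith
  qed
  have "L ` S \<inter> frontier T = {}"
  proof (rule ccontr)
    assume "L ` S \<inter> frontier T \<noteq> {}"
    then obtain t where t: "t \<in> S" "L t \<in> frontier T" by blast
    from fr[OF t(2)] have "c < norm (hill (L t))"
    proof
      assume r: "\<bar>Re (L t)\<bar> = real n"
      then have "Re (L t) = real n \<or> Re (L t) = - real n" by linarith
      then have "Re (L t) \<in> \<int>" by auto
      moreover have "N \<le> norm (L t)" using abs_Re_le_cmod[of "L t"] r n by simp
      ultimately show ?thesis by (intro N)
    next
      assume i: "\<bar>Im (L t)\<bar> = real n"
      then have "exp (pi * real n) / 2 - 1 \<le> norm (hill (L t))"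
        using R(2)[of "L t"] abs_Im_le_cmod[of "L t"] n by simp
      \<comment> \<open>On horizontal sides |F| is then at least 6 / 2 - 1 = 2, which exceeds
        c.\<close>
      moreover have "6 \<le> exp (pi * real n)"
      proof -
        have "3 * 2 \<le> pi * real n" using pi_gt3 n by (intro mult_mono) auto
        then show ?thesis using exp_ge_add_one_self[of "pi * real n"] by linarith
      qed
      ultimately show ?thesis using c by linarith
    qed
    then show False using hill[OF t(1)] by simp
  qed
  moreover have "connected (L ` S)" by (rule connected_continuous_image[OF L S])
  moreover have "L s \<in> T"
    using abs_Re_le_cmod[of "L s"] abs_Im_le_cmod[of "L s"] n by (simp add: T_def)
  then have "L ` S \<inter> T \<noteq> {}" using s by blast
  ultimately have "L ` S \<subseteq> T" using connected_Int_frontier[of "L ` S" T] by blast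
  moreover have "bounded T"
  proof -
    have "norm z \<le> 2 * real n" if "z \<in> T" for z
      using cmod_le[of z] that by (simp add: T_def)
    then show ?thesis unfolding bounded_iff by blast
  qed
  ultimately show ?thesis by (rule bounded_subset[rotated])
qed simp

text \<open>\<open>proj_norm\<close> lies below a continuous function of (z, t), which is bounded
  over the product of K and [a, b].\<close>

lemma inverse_alpha_bound_compact:
  assumes K: "compact K"
  obtains C where "C \<ge> 0" "\<And>z t. z \<in> K \<Longrightarrow> t \<in> {a..b::real} \<Longrightarrow> sin (of_real pi * of_real t :: complex) \<noteq> 0 \<Longrightarrow>
    hill z = 2 * cos (of_real pi * of_real t) \<Longrightarrow> 1 / alpha_abs p q (of_real t) z \<le> C / norm (deriv hill z)"
proof -
  let ?s = "\<lambda>t::real. inverse (floquet (of_real t))"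
  define E where "E = (\<lambda>(z, t). pi * (exp ((\<bar>Im z\<bar> + 4 * qbd) * pi))\<^sup>2 *
      sqrt ((norm (m12 z))\<^sup>2 + (norm (m22 z - ?s t))\<^sup>2 + (norm (?s t - m11 z))\<^sup>2 + (norm (m21 z))\<^sup>2))"
  have ch: "continuous_on UNIV m11" "continuous_on UNIV m12" "continuous_on UNIV m21" "continuous_on UNIV m22"
    by (intro holomorphic_on_imp_continuous_on holomorphic_monodromy)+
  have fl: "continuous_on (K \<times> {a..b}) (\<lambda>u::complex \<times> real. floquet (of_real (snd u)))"
    unfolding floquet_def by (intro continuous_intros)
  have "continuous_on (K \<times> {a..b}) E"
    unfolding E_def case_prod_unfold
    by (intro continuous_intros fl continuous_on_compose2[OF ch(1)] continuous_on_compose2[OF ch(2)]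
      continuous_on_compose2[OF ch(3)] continuous_on_compose2[OF ch(4)]) auto
  then have "compact (E ` (K \<times> {a..b}))" by (intro compact_continuous_image compact_Times K) auto
  then have "bounded (E ` (K \<times> {a..b}))" by (rule compact_imp_bounded)
  then obtain C where C: "\<forall>y\<in>E ` (K \<times> {a..b}). norm y \<le> C" unfolding bounded_iff ..
  show thesis
  proof (rule that[of "\<bar>C\<bar>"])
    fix z t assume z: "z \<in> K" and t: "t \<in> {a..b}" and sin: "sin (of_real pi * of_real t :: complex) \<noteq> 0"
      and hill: "hill z = 2 * cos (of_real pi * of_real t)"
    have "proj_norm z t \<le> E (z, t)" using inverse_alpha_abs(2)[OF sin hill] by (simp add: E_def)
    also have "E (z, t) \<le> \<bar>C\<bar>"
    proof -
      have "norm (E (z, t)) \<le> C" by (rule bspec[OF C]) (intro imageI SigmaI z t)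
      then show ?thesis by simp
    qed
    finally show "1 / alpha_abs p q (of_real t) z \<le> \<bar>C\<bar> / norm (deriv hill z)"
      unfolding inverse_alpha_abs(1)[OF sin hill] by (intro divide_right_mono) auto
  qed simp
qed

text \<open>The multiplicity counts the labels with this value, among them (n, j) itself, so it is
  positive.\<close>

lemma labeling_eigenvalue:
  assumes "valid_labeling p q lam" "j \<in> {1,2}"
  shows "hill (lam n j t) = 2 * cos (of_real pi * of_real t)"
proof -
  let ?S = "{(n',j'). j' \<in> {1,2} \<and> lam n' j' t = lam n j t}"
  have "finite ?S \<and> alg_mult p q (of_real t) (lam n j t) = enat (card ?S)"
    using assms(1)[unfolded valid_labeling_def, THEN conjunct1, THEN spec, THEN spec] .
  then have "finite ?S" "alg_mult p q (of_real t) (lam n j t) = enat (card ?S)" by blast+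
  moreover have "(n, j) \<in> ?S" using assms(2) by simp
  then have "?S \<noteq> {}" by blast
  ultimately have "alg_mult p q (of_real t) (lam n j t) \<noteq> 0"
    by (simp only: enat_0_iff card_0_eq not_False_eq_True)
  then have "eigenvalue p q (of_real t) (lam n j t)" by (rule alg_mult_eigenvalue)
  then show ?thesis by (simp only: eigenvalue_iff_hill)
qed

lemma labeling_isCont:
  assumes lab: "valid_labeling p q lam" and j: "j \<in> {1,2}" and "alg_mult p q (of_real t) (lam n j t) = 1"
  shows "isCont (lam n j) t"
proof -
  obtain \<delta> g where g: "\<delta> > 0" "g holomorphic_on ball (complex_of_real t) \<delta>"
    "\<forall>s. \<bar>s - t\<bar> < \<delta> \<longrightarrow> alg_mult p q (of_real s) (lam n j s) = 1 \<and> lam n j s = g (complex_of_real s)"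
    using assms(1)[unfolded valid_labeling_def, THEN conjunct2, THEN conjunct1, THEN spec, THEN bspec, OF j, THEN spec,
      THEN mp, OF assms(3)] by blast
  have "isCont g (complex_of_real t)"
    using holomorphic_on_imp_continuous_on[OF g(2)] g(1) by (simp add: continuous_on_eq_continuous_at)
  then have "isCont (\<lambda>s. g (complex_of_real s)) t" by (intro continuous_intros isCont_o2[of t complex_of_real g]) auto
  moreover have "\<forall>\<^sub>F s in nhds t. lam n j s = g (complex_of_real s)"
    unfolding eventually_nhds_metric using g(1,3) by (auto simp: dist_real_def)
  ultimately show ?thesis by (rule isCont_cong[THEN iffD2, rotated])
qed

text \<open>No limit of the label at \<open>t0\<close> is at hand, and several roots of different
  orders may be approached. It suffices that the values on both sides of \<open>t0\<close> lie in a
  compact set, on which the bounds for |F'| and |\<alpha>| are uniform.\<close>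

lemma inverse_alpha_integrable:
  fixes t0 :: real
  assumes lab: "valid_labeling p q lam" and j: "j \<in> {1,2}" and sin: "sin (pi * t0) \<noteq> 0"
  shows "\<exists>\<epsilon>>0. set_integrable lborel {t0 - \<epsilon> <..< t0 + \<epsilon>} (\<lambda>t. 1 / alpha_abs p q (of_real t) (lam n j t))"
proof -
  define L where "L = lam n j"
  have hill': "hill (L t) = 2 * cos (of_real pi * of_real t)" for t
    unfolding L_def by (rule labeling_eigenvalue[OF lab j])
  have hill: "hill (L t) = of_real (2 * cos (pi * t))" for t
    unfolding hill' by (simp only: of_real_mult cos_of_real[symmetric] of_real_numeral)
  have "finite {t. t0 - 1 \<le> t \<and> t \<le> t0 + 1 \<and> alg_mult p q (of_real t) (L t) \<noteq> 1}"
    unfolding L_def using lab[unfolded valid_labeling_def, THEN conjunct2, THEN conjunct2, THEN spec, THEN bspec, OF j,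
      THEN spec, THEN spec] .
  from finite_set_avoid[OF this, of t0] obtain d1 where d1: "d1 > 0"
    "\<forall>x\<in>{t. t0 - 1 \<le> t \<and> t \<le> t0 + 1 \<and> alg_mult p q (of_real t) (L t) \<noteq> 1}. x \<noteq> t0 \<longrightarrow> d1 \<le> dist t0 x" by blast
  have cont: "isCont L t" if "t \<noteq> t0" "\<bar>t - t0\<bar> < min d1 1" for t
  proof -
    have "alg_mult p q (of_real t) (L t) = 1"
    proof (rule ccontr)
      assume "alg_mult p q (of_real t) (L t) \<noteq> 1"
      then have "d1 \<le> dist t0 t" using d1(2) that by (auto simp: abs_less_iff)
      then show False using that by (simp add: dist_real_def abs_minus_commute)
    qed
    then show ?thesis using labeling_isCont[OF lab j] unfolding L_def by blast
  qed
  \<comment> \<open>The midpoint between |2 cos(\<pi> \<open>t0\<close>)| and 2: room for nearby t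
    below the threshold of \<open>eigenvalue_curve_bounded\<close>.\<close>
  define c where "c = 1 + \<bar>cos (pi * t0)\<bar>"
  have "(cos (pi * t0))\<^sup>2 < 1" using sin sin_cos_squared_add[of "pi * t0"] by (smt (verit) zero_less_power2)
  then have c1: "\<bar>cos (pi * t0)\<bar> < 1" by (simp add: abs_square_less_1)
  then have c: "c < 2" by (simp add: c_def)
  have "isCont (\<lambda>t. \<bar>2 * cos (pi * t)\<bar>) t0" "isCont (\<lambda>t. sin (pi * t)) t0" by (intro continuous_intros)+
  note lim = this[THEN isCont_tendsto_nhds]
  have "\<bar>2 * cos (pi * t0)\<bar> < c" using c1 by (simp add: c_def)
  then have "\<forall>\<^sub>F t in nhds t0. \<bar>2 * cos (pi * t)\<bar> < c" by (rule order_tendstoD(2)[OF lim(1)])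
  moreover have "\<forall>\<^sub>F t in nhds t0. sin (pi * t) \<noteq> 0" by (rule tendsto_imp_eventually_ne[OF lim(2) sin])
  ultimately have "\<forall>\<^sub>F t in nhds t0. \<bar>2 * cos (pi * t)\<bar> < c \<and> sin (pi * t) \<noteq> 0" by (rule eventually_conj)
  then obtain d2 where d2: "d2 > 0" "\<And>t. dist t t0 < d2 \<Longrightarrow> \<bar>2 * cos (pi * t)\<bar> < c \<and> sin (pi * t) \<noteq> 0"
    unfolding eventually_nhds_metric by blast
  define d where "d = min d2 (min d1 1)"
  have d: "d > 0" using d1 d2 by (simp add: d_def)
  \<comment> \<open>Applied to the two sides of \<open>t0\<close> separately, because the label may
    jump there and each side is connected.\<close>
  have bd: "bounded (L ` S)" if "connected S" "S \<subseteq> {t0 - d<..<t0 + d} - {t0}" for S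
  proof (rule eigenvalue_curve_bounded[OF \<open>connected S\<close> _ c])
    show "continuous_on S L"
    proof (rule continuous_at_imp_continuous_on, rule ballI)
      fix t assume "t \<in> S"
      then have "t \<in> {t0 - d<..<t0 + d} - {t0}" using that(2) by blast
      then show "isCont L t" by (intro cont) (auto simp: d_def abs_less_iff)
    qed
    fix t assume "t \<in> S"
    then have "t \<in> {t0 - d<..<t0 + d} - {t0}" using that(2) by blast
    then have "dist t t0 < d2" by (auto simp: d_def dist_real_def abs_less_iff)
    then show "norm (hill (L t)) \<le> c" using d2(2)[of t] unfolding hill norm_of_real by simp
  qed
  have "bounded (L ` {t0 - d<..<t0} \<union> L ` {t0<..<t0 + d})"
    unfolding bounded_Un using d by (intro conjI bd) auto
  then have K: "compact (closure (L ` {t0 - d<..<t0} \<union> L ` {t0<..<t0 + d}))" (is "compact ?K")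
    by (simp only: compact_closure)
  have LK: "L t \<in> ?K" if "t \<in> {t0 - d<..<t0 + d} - {t0}" for t
  proof (rule subsetD[OF closure_subset])
    show "L t \<in> L ` {t0 - d<..<t0} \<union> L ` {t0<..<t0 + d}" using that by (cases "t < t0") auto
  qed
  obtain \<eta> \<kappa> \<beta> where B: "\<eta> > 0" "\<kappa> > 0" "0 \<le> \<beta>" "\<beta> < 1"
    "\<And>z. z \<in> ?K \<Longrightarrow> norm (hill z - of_real (2 * cos (pi * t0))) < \<eta> \<Longrightarrow>
       \<kappa> * norm (hill z - of_real (2 * cos (pi * t0))) powr \<beta> \<le> norm (deriv hill z)"
    by (rule deriv_lower_bound_compact[OF holomorphic_monodromy(5) hill_not_constant_on K]) (rule that)
  obtain d3 \<kappa>' where sep: "d3 > 0" "\<kappa>' > 0" "\<And>t. \<bar>t - t0\<bar> < d3 \<Longrightarrow> \<kappa>' * \<bar>t - t0\<bar> \<le> \<bar>2 * cos (pi * t) - 2 * cos (pi * t0)\<bar>"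
    by (rule cos_pi_separation[OF sin]) (rule that)
  have "isCont (\<lambda>t. 2 * cos (pi * t)) t0" by (intro continuous_intros)
  then have "\<forall>\<^sub>F t in nhds t0. dist (2 * cos (pi * t)) (2 * cos (pi * t0)) < \<eta>"
    by (rule tendstoD[OF isCont_tendsto_nhds B(1)])
  then obtain d4 where d4: "d4 > 0" "\<And>t. dist t t0 < d4 \<Longrightarrow> \<bar>2 * cos (pi * t) - 2 * cos (pi * t0)\<bar> < \<eta>"
    unfolding eventually_nhds_metric dist_real_def by blast
  obtain C where C: "C \<ge> 0" "\<And>z t. z \<in> ?K \<Longrightarrow> t \<in> {t0 - 1..t0 + 1} \<Longrightarrow> sin (of_real pi * of_real t :: complex) \<noteq> 0 \<Longrightarrow>
    hill z = 2 * cos (of_real pi * of_real t) \<Longrightarrow> 1 / alpha_abs p q (of_real t) z \<le> C / norm (deriv hill z)"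
    by (rule inverse_alpha_bound_compact[OF K]) (rule that)
  define \<epsilon> where "\<epsilon> = min d (min d3 d4)"
  have \<epsilon>: "\<epsilon> > 0" "\<epsilon> \<le> d" "\<epsilon> \<le> d3" "\<epsilon> \<le> d4" "\<epsilon> \<le> 1" "\<epsilon> \<le> d2" using d sep(1) d4(1) by (auto simp: \<epsilon>_def d_def)
  let ?I = "{t0 - \<epsilon><..<t0 + \<epsilon>}"
  define A where "A = (\<lambda>t. 1 / alpha_abs p q (of_real t) (L t))"
  have sinI: "sin (of_real pi * of_real t :: complex) \<noteq> 0" if "t \<in> ?I" for t
  proof -
    have "sin (pi * t) \<noteq> 0" using d2(2)[of t] that \<epsilon> by (auto simp: dist_real_def abs_less_iff)
    then show ?thesis unfolding sin_pi_of_real_eq_0_iff .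
  qed
  have A0: "A t \<ge> 0" for t by (simp add: A_def alpha_abs_def Let_def)
  define M where "M = C / (\<kappa> * \<kappa>' powr \<beta>)"
  have bound: "A t \<le> M * \<bar>t - t0\<bar> powr (- \<beta>)" if t: "t \<in> ?I" "t \<noteq> t0" for t
  proof -
    have tt: "\<bar>t - t0\<bar> < d3" "dist t t0 < d4" "t \<in> {t0 - d<..<t0 + d} - {t0}" "t \<in> {t0 - 1..t0 + 1}"
      using t \<epsilon> by (auto simp: dist_real_def abs_less_iff)
    have n: "norm (hill (L t) - of_real (2 * cos (pi * t0))) = \<bar>2 * cos (pi * t) - 2 * cos (pi * t0)\<bar>"
      unfolding hill of_real_diff[symmetric] norm_of_real by simp
    have "\<kappa> * (\<kappa>' * \<bar>t - t0\<bar>) powr \<beta> \<le> \<kappa> * \<bar>2 * cos (pi * t) - 2 * cos (pi * t0)\<bar> powr \<beta>"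
      using sep B tt(1) by (intro mult_left_mono powr_mono2) auto
    also have "\<dots> \<le> norm (deriv hill (L t))"
      using B(5)[OF LK[OF tt(3)]] d4(2)[OF tt(2)] unfolding n by blast
    finally have low: "\<kappa> * (\<kappa>' powr \<beta> * \<bar>t - t0\<bar> powr \<beta>) \<le> norm (deriv hill (L t))"
      using sep(2) by (simp add: powr_mult)
    have pos: "0 < \<kappa> * (\<kappa>' powr \<beta> * \<bar>t - t0\<bar> powr \<beta>)" using B(2) sep(2) t(2) by simp
    have "A t \<le> C / norm (deriv hill (L t))"
      unfolding A_def by (rule C(2)[OF LK[OF tt(3)] tt(4) sinI[OF t(1)] hill'])
    also have "\<dots> \<le> C / (\<kappa> * (\<kappa>' powr \<beta> * \<bar>t - t0\<bar> powr \<beta>))"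
      by (rule divide_left_mono[OF low C(1) mult_pos_pos[OF less_le_trans[OF pos low] pos]])
    also have "\<dots> = M * \<bar>t - t0\<bar> powr (- \<beta>)" by (simp add: M_def powr_minus divide_inverse mult_ac)
    finally show ?thesis .
  qed
  \<comment> \<open>The label is cut off at \<open>t0\<close>, the one point of the interval where
    its continuity is unknown; this makes it Borel.\<close>
  define L0 where "L0 = (\<lambda>t. indicator (?I - {t0}) t *\<^sub>R L t)"
  have "continuous_on (?I - {t0}) L"
    by (rule continuous_at_imp_continuous_on, rule ballI, rule cont) (use \<epsilon> in \<open>auto simp: d_def abs_less_iff\<close>)
  then have L0m: "L0 \<in> borel_measurable borel"
    unfolding L0_def by (intro borel_measurable_continuous_on_indicator) auto
  have dm: "deriv hill \<in> borel_measurable borel"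
    by (intro borel_measurable_continuous_onI holomorphic_on_imp_continuous_on holomorphic_deriv holomorphic_monodromy open_UNIV)
  \<comment> \<open>A Borel expression for the integrand: through \<open>proj_norm\<close> away from
    \<open>t0\<close>, and by its own value at \<open>t0\<close>.\<close>
  define H where "H = (\<lambda>t. if t = t0 then indicator ?I t * A t0 else indicator ?I t * (proj_norm (L0 t) t / norm (deriv hill (L0 t))))"
  have "(\<lambda>t. deriv hill (L0 t)) \<in> borel_measurable borel" using L0m dm by measurable
  then have Hm: "H \<in> borel_measurable lborel" unfolding H_def using L0m by measurable
  have HA: "indicator ?I t *\<^sub>R A t = H t" for t
  proof (cases "t = t0 \<or> t \<notin> ?I")
    case False
    then show ?thesis using inverse_alpha_abs(1)[OF sinI[of t] hill'] by (simp add: H_def L0_def A_def)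
  qed (auto simp: H_def)
  have "set_integrable lborel ?I A"
    unfolding set_integrable_def
  proof (rule Bochner_Integration.integrable_bound[OF set_integrable_abs_powr[OF B(3,4) \<epsilon>(1)]])
    show "(\<lambda>t. indicator ?I t *\<^sub>R A t) \<in> borel_measurable lborel" unfolding HA by (rule Hm)
    \<comment> \<open>The point \<open>t0\<close> is left out, since there the power is 0 and
      dominates nothing.\<close>
    show "AE t in lborel. norm (indicator ?I t *\<^sub>R A t) \<le> norm (indicator ?I t * (M * \<bar>t - t0\<bar> powr (- \<beta>)))"
      using AE_lborel_singleton[of t0]
    proof eventually_elim
      case (elim t)
      then show ?case using bound[of t] A0[of t] by (auto simp: indicator_def)
    qed
  qed
  then show ?thesis using \<epsilon>(1) unfolding A_def L_def by blast
qed

end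

theorem theorem3:
  fixes p q :: "real \<Rightarrow> complex" and t0 :: real and z0 :: complex
  assumes "\<forall>x. p (x + pi) = p x" and "\<forall>x. q (x + pi) = q x"
    and "bounded_variation_on p 0 pi" and "bounded_variation_on q 0 pi"
    and "t0 \<in> {-1<..1} - {0, 1}"
    and "multiple_eigenvalue p q (of_real t0) z0"
  shows "spectral_singularity p q z0 \<and>
         (\<forall>lam. valid_labeling p q lam \<longrightarrow> \<not> ESS p q lam z0)"
proof -
  interpret dirac p q by standard (fact assms(3,4))+
  have t0: "t0 \<in> {-1<..<1}" "t0 \<noteq> 0" using assms(5) by auto
  have "sin (pi * t0) \<noteq> 0"
  proof (cases "t0 > 0")
    case True
    then have "0 < sin (pi * t0)" using t0 by (intro sin_gt_zero) auto
    then show ?thesis by simp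
  next
    case False
    then have t: "0 < - t0" "- t0 < 1" using t0 by auto
    have "0 < sin (pi * (- t0))"
      using mult_pos_pos[OF pi_gt_zero t(1)] mult_strict_left_mono[OF t(2) pi_gt_zero]
      by (intro sin_gt_zero) (simp_all only: mult_1_right)
    then show ?thesis by simp
  qed
  then have sin: "sin (of_real pi * of_real t0 :: complex) \<noteq> 0" unfolding sin_pi_of_real_eq_0_iff .
  note crit = multiple_eigenvalue_deriv[OF sin assms(6)]
  have "\<not> ESS p q lam z0" if lab: "valid_labeling p q lam" for lam
  proof
    assume "ESS p q lam z0"
    then obtain s n j where j: "j \<in> {1,2}" and z0: "z0 = lam n j s" and
      ni: "\<forall>\<epsilon>>0. \<not> set_integrable lborel {s - \<epsilon> <..< s + \<epsilon>} (\<lambda>t. 1 / alpha_abs p q (of_real t) (lam n j t))"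
      unfolding ESS_def by blast
    have hs: "hill z0 = 2 * cos (of_real pi * of_real s)" unfolding z0 by (rule labeling_eigenvalue[OF lab j])
    \<comment> \<open>The parameter s that witnesses an ESS need not be \<open>t0\<close>. The value
      F(\<open>z0\<close>) is the same for both, and being different from 2 and -2 it shows that s
      is no integer either.\<close>
    have "hill z0 \<noteq> 2" "hill z0 \<noteq> - 2"
      using crit(1) sin sin_cos_squared_add[of "of_real pi * of_real t0 :: complex"] by (auto simp: power2_eq_square)
    then have "sin (of_real pi * of_real s :: complex) \<noteq> 0" by (rule sin_nonzero_hill[OF hs])
    then have "sin (pi * s) \<noteq> 0" unfolding sin_pi_of_real_eq_0_iff .
    then show False using inverse_alpha_integrable[OF lab j, of s n] ni by blast
  qed
  then show ?thesis using spectral_singularity_of_critical[OF t0(1) sin crit] by blast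
qed

end
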